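(* Let $\mathcal{A}$ be the collection of all non-big fields of algebraic numbers. There exists a single first-order formula $Q(t)$ in the language of rings, of the form $\forall x_1\forall x_2\exists x_3\cdots\exists x_r\,\bigwedge_{i=1}^{\ell} P_i(t,x_1,\dots,x_r)=0$ with $P_i\in\mathbb{Z}[t,x_1,\dots,x_r]$, such that for every $K\in\mathcal{A}$ the formula $Q(t)$, with quantifiers ranging over $\mathcal{O}_K$, defines $\mathbb{Z}$ in $\mathcal{O}_K$, i.e. $\{t\in\mathcal{O}_K : \mathcal{O}_K\models Q(t)\}=\mathbb{Z}$. Consequently, for every $K\in\mathcal{A}$ the first-order theory of $\mathcal{O}_K$ in the language of rings is undecidable.
   Context: A field of algebraic numbers is an algebraic, possibly infinite, extension $K$ of $\mathbb{Q}$ (inside a fixed algebraic closure $\overline{\mathbb{Q}}$); $\mathcal{O}_K$ denotes its ring of algebraic integers. $K$ is called big if for every positive integer $n$, $K$ contains a number field $F$ (finite extension of $\mathbb{Q}$) with $[F:\mathbb{Q}]$ divisible by $n$; equivalently $[K:\mathbb{Q}]=\prod_{p}p^\infty$ as a supernatural number. $K$ is non-big if it is not big. The language of rings is $(0,1,+,\times)$. The first-order theory of a ring is the set of sentences of this language true in the ring; it is undecidable if there is no algorithm deciding membership in this set. *)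

theory Defs
  imports
    "HOL-Computational_Algebra.Computational_Algebra"
    "HOL-Library.Poly_Mapping"
    "HOL-Library.Nat_Bijection"
begin

section \<open>Fields of algebraic numbers\<close>

text \<open>The fixed algebraic closure of the rationals is the set of algebraic complex numbers.\<close>

definition is_subfield :: "complex set \<Rightarrow> bool" where
  "is_subfield K \<longleftrightarrow> 0 \<in> K \<and> 1 \<in> K \<and>
     (\<forall>x\<in>K. \<forall>y\<in>K. x + y \<in> K \<and> x * y \<in> K) \<and>
     (\<forall>x\<in>K. - x \<in> K \<and> inverse x \<in> K)"

definition field_of_algebraic_numbers :: "complex set \<Rightarrow> bool" where
  "field_of_algebraic_numbers K \<longleftrightarrow> is_subfield K \<and> (\<forall>x\<in>K. algebraic x)"

definition ring_of_integers :: "complex set \<Rightarrow> complex set" where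
  "ring_of_integers K = {x \<in> K. algebraic_int x}"

definition rat_scale :: "rat \<Rightarrow> complex \<Rightarrow> complex" where
  "rat_scale q x = of_rat q * x"

global_interpretation rat_vs: vector_space rat_scale
  by unfold_locales (simp_all add: rat_scale_def algebra_simps of_rat_add of_rat_mult)

definition number_field :: "complex set \<Rightarrow> bool" where
  "number_field F \<longleftrightarrow> is_subfield F \<and> (\<exists>B. finite B \<and> rat_vs.span B = F)"

text \<open>
  Only meaningful for number fields: the library's \<open>dim\<close> is \<open>0\<close> on
  infinite-dimensional spaces, which is why \<open>big\<close> requires \<open>number_field F\<close>.
\<close>

definition degree_over_rat :: "complex set \<Rightarrow> nat" where
  "degree_over_rat F = rat_vs.dim F"

definition big :: "complex set \<Rightarrow> bool" where
  "big K \<longleftrightarrow> (\<forall>n>0. \<exists>F. F \<subseteq> K \<and> number_field F \<and> n dvd degree_over_rat F)"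

definition non_big_fields :: "complex set set" where
  "non_big_fields = {K. field_of_algebraic_numbers K \<and> \<not> big K}"


section \<open>The first-order language of rings\<close>

datatype rterm = Var nat | Zero | One | Add rterm rterm | Mul rterm rterm

datatype rform =
    Eq rterm rterm
  | Neg rform
  | Conj rform rform
  | Forall nat rform
  | Exists nat rform

primrec tval :: "(nat \<Rightarrow> 'a::comm_ring_1) \<Rightarrow> rterm \<Rightarrow> 'a" where
  "tval e (Var i) = e i"
| "tval e Zero = 0"
| "tval e One = 1"
| "tval e (Add s t) = tval e s + tval e t"
| "tval e (Mul s t) = tval e s * tval e t"

text \<open>Satisfaction in the subring \<open>R\<close>: quantifiers range over \<open>R\<close>.\<close>

primrec sat :: "'a::comm_ring_1 set \<Rightarrow> (nat \<Rightarrow> 'a) \<Rightarrow> rform \<Rightarrow> bool" where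
  "sat R e (Eq s t) \<longleftrightarrow> tval e s = tval e t"
| "sat R e (Neg \<phi>) \<longleftrightarrow> \<not> sat R e \<phi>"
| "sat R e (Conj \<phi> \<psi>) \<longleftrightarrow> sat R e \<phi> \<and> sat R e \<psi>"
| "sat R e (Forall i \<phi>) \<longleftrightarrow> (\<forall>a\<in>R. sat R (e(i := a)) \<phi>)"
| "sat R e (Exists i \<phi>) \<longleftrightarrow> (\<exists>a\<in>R. sat R (e(i := a)) \<phi>)"

primrec tvars :: "rterm \<Rightarrow> nat set" where
  "tvars (Var i) = {i}"
| "tvars Zero = {}"
| "tvars One = {}"
| "tvars (Add s t) = tvars s \<union> tvars t"
| "tvars (Mul s t) = tvars s \<union> tvars t"

primrec fvars :: "rform \<Rightarrow> nat set" where
  "fvars (Eq s t) = tvars s \<union> tvars t"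
| "fvars (Neg \<phi>) = fvars \<phi>"
| "fvars (Conj \<phi> \<psi>) = fvars \<phi> \<union> fvars \<psi>"
| "fvars (Forall i \<phi>) = fvars \<phi> - {i}"
| "fvars (Exists i \<phi>) = fvars \<phi> - {i}"

lemma tval_cong: "(\<And>i. i \<in> tvars t \<Longrightarrow> e i = e' i) \<Longrightarrow> tval e t = tval e' t"
  by (induction t) auto

lemma sat_cong: "(\<And>i. i \<in> fvars \<phi> \<Longrightarrow> e i = e' i) \<Longrightarrow> sat R e \<phi> \<longleftrightarrow> sat R e' \<phi>"
proof (induction \<phi> arbitrary: e e')
  case (Eq s t)
  then show ?case using tval_cong[of s e e'] tval_cong[of t e e'] by auto
next
  case (Neg \<phi>)
  from Neg.IH[of e e'] Neg.prems show ?case by simp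
next
  case (Conj \<phi> \<psi>)
  from Conj.IH(1)[of e e'] Conj.IH(2)[of e e'] Conj.prems show ?case by simp
next
  case (Forall i \<phi>)
  have "sat R (e(i := a)) \<phi> \<longleftrightarrow> sat R (e'(i := a)) \<phi>" for a
    by (rule Forall.IH) (use Forall.prems in auto)
  then show ?case by simp
next
  case (Exists i \<phi>)
  have "sat R (e(i := a)) \<phi> \<longleftrightarrow> sat R (e'(i := a)) \<phi>" for a
    by (rule Exists.IH) (use Exists.prems in auto)
  then show ?case by simp
qed

text \<open>
  By \<open>sat_cong\<close>, the default value \<open>0\<close> in the two environments below is immaterial
  (for \<open>defined_set\<close>, when \<open>0\<close> is the only free variable of the formula).
\<close>

definition defined_set :: "'a::comm_ring_1 set \<Rightarrow> rform \<Rightarrow> 'a set" where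
  "defined_set R \<phi> = {t \<in> R. sat R ((\<lambda>_. 0)(0 := t)) \<phi>}"

definition first_order_theory :: "'a::comm_ring_1 set \<Rightarrow> rform set" where
  "first_order_theory R = {\<phi>. fvars \<phi> = {} \<and> sat R (\<lambda>_. 0) \<phi>}"


section \<open>Polynomial equations as atomic formulas\<close>

text \<open>
  An integer polynomial is a finitely supported map from monomials (finitely supported
  exponent vectors) to coefficients. Since the language has no subtraction, the
  equation \<open>P = 0\<close> is written as \<open>P\<^sup>+ = P\<^sup>-\<close>, where \<open>P = P\<^sup>+ - P\<^sup>-\<close> separates the
  positive from the negative coefficients.
\<close>

type_synonym int_mpoly = "(nat \<Rightarrow>\<^sub>0 nat) \<Rightarrow>\<^sub>0 int"

definition poly_vars :: "int_mpoly \<Rightarrow> nat set" where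
  "poly_vars P = (\<Union>m\<in>Poly_Mapping.keys P. Poly_Mapping.keys m)"

definition poly_eval :: "(nat \<Rightarrow> 'a::comm_ring_1) \<Rightarrow> int_mpoly \<Rightarrow> 'a" where
  "poly_eval e P =
     (\<Sum>m\<in>Poly_Mapping.keys P.
        of_int (Poly_Mapping.lookup P m) * (\<Prod>i\<in>Poly_Mapping.keys m. e i ^ Poly_Mapping.lookup m i))"

primrec nat_tm :: "nat \<Rightarrow> rterm" where
  "nat_tm 0 = Zero"
| "nat_tm (Suc n) = Add (nat_tm n) One"

primrec pow_tm :: "rterm \<Rightarrow> nat \<Rightarrow> rterm" where
  "pow_tm t 0 = One"
| "pow_tm t (Suc n) = Mul t (pow_tm t n)"

definition monom_tm :: "(nat \<Rightarrow>\<^sub>0 nat) \<Rightarrow> rterm" where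
  "monom_tm m =
     foldr (\<lambda>i t. Mul (pow_tm (Var i) (Poly_Mapping.lookup m i)) t)
       (sorted_list_of_set (Poly_Mapping.keys m)) One"

definition sum_tm :: "((nat \<Rightarrow>\<^sub>0 nat) \<Rightarrow> nat) \<Rightarrow> (nat \<Rightarrow>\<^sub>0 nat) list \<Rightarrow> rterm" where
  "sum_tm c ms = foldr (\<lambda>m t. Add (Mul (nat_tm (c m)) (monom_tm m)) t) ms Zero"

definition poly_eqn :: "int_mpoly \<Rightarrow> rform" where
  "poly_eqn P =
     Eq (sum_tm (\<lambda>m. nat (Poly_Mapping.lookup P m)) (sorted_list_of_set (Poly_Mapping.keys P)))
        (sum_tm (\<lambda>m. nat (- Poly_Mapping.lookup P m)) (sorted_list_of_set (Poly_Mapping.keys P)))"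

lemma tval_nat_tm: "tval e (nat_tm n) = of_nat n"
  by (induction n) (simp_all add: add.commute)

lemma tval_pow_tm: "tval e (pow_tm t n) = tval e t ^ n"
  by (induction n) simp_all

lemma tval_monom_tm: "tval e (monom_tm m) = (\<Prod>i\<in>Poly_Mapping.keys m. e i ^ Poly_Mapping.lookup m i)"
proof -
  have "tval e (foldr (\<lambda>i t. Mul (pow_tm (Var i) (Poly_Mapping.lookup m i)) t) xs One) =
        (\<Prod>i\<leftarrow>xs. e i ^ Poly_Mapping.lookup m i)" for xs
    by (induction xs) (simp_all add: tval_pow_tm)
  then show ?thesis
    by (simp add: monom_tm_def prod.distinct_set_conv_list[symmetric])
qed

lemma tval_sum_tm:
  "tval e (sum_tm c ms) = (\<Sum>m\<leftarrow>ms. of_nat (c m) * (\<Prod>i\<in>Poly_Mapping.keys m. e i ^ Poly_Mapping.lookup m i))"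
  unfolding sum_tm_def by (induction ms) (simp_all add: tval_nat_tm tval_monom_tm)

lemma sat_poly_eqn: "sat R e (poly_eqn P) \<longleftrightarrow> poly_eval e P = 0"
proof -
  let ?v = "\<lambda>m. \<Prod>i\<in>Poly_Mapping.keys m. e i ^ Poly_Mapping.lookup m i"
  have "of_int k = (of_nat (nat k) - of_nat (nat (- k)) :: 'a)" for k
    by (cases "k \<ge> 0") simp_all
  then have "poly_eval e P =
      (\<Sum>m\<in>Poly_Mapping.keys P. of_nat (nat (Poly_Mapping.lookup P m)) * ?v m) -
      (\<Sum>m\<in>Poly_Mapping.keys P. of_nat (nat (- Poly_Mapping.lookup P m)) * ?v m)"
    by (simp add: poly_eval_def sum_subtractf[symmetric] left_diff_distrib[symmetric])
  then show ?thesis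
    by (simp add: poly_eqn_def tval_sum_tm sum.distinct_set_conv_list[symmetric])
qed

fun conj_list :: "rform list \<Rightarrow> rform" where
  "conj_list [] = Eq Zero Zero"
| "conj_list [\<phi>] = \<phi>"
| "conj_list (\<phi> # \<psi> # \<phi>s) = Conj \<phi> (conj_list (\<psi> # \<phi>s))"

lemma sat_conj_list: "sat R e (conj_list \<phi>s) \<longleftrightarrow> (\<forall>\<phi>\<in>set \<phi>s. sat R e \<phi>)"
  by (induction \<phi>s rule: conj_list.induct) simp_all

text \<open>
  The formula \<open>\<forall>x\<^sub>1 \<forall>x\<^sub>2 \<exists>x\<^sub>3 \<dots> \<exists>x\<^sub>r. \<And>\<^sub>i P\<^sub>i(t, x\<^sub>1, \<dots>, x\<^sub>r) = 0\<close>,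
  where variable \<open>0\<close> is \<open>t\<close> and variable \<open>j\<close> is \<open>x\<^sub>j\<close>.
\<close>

definition AAE_formula :: "nat \<Rightarrow> int_mpoly list \<Rightarrow> rform" where
  "AAE_formula r Ps =
     Forall 1 (Forall 2 (foldr Exists [3..<Suc r] (conj_list (map poly_eqn Ps))))"


section \<open>Decidability\<close>

text \<open>
  Algorithms are \<open>\<mu>\<close>-recursive functions; \<open>reval f xs y\<close> states that \<open>f\<close> halts on input \<open>xs\<close>
  with output \<open>y\<close>.
\<close>

datatype recf =
    RZero
  | RSucc
  | RProj nat
  | RComp recf "recf list"
  | RPrec recf recf
  | RMin recf

inductive reval :: "recf \<Rightarrow> nat list \<Rightarrow> nat \<Rightarrow> bool" where
  reval_zero: "reval RZero xs 0"
| reval_succ: "reval RSucc [x] (Suc x)"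
| reval_proj: "i < length xs \<Longrightarrow> reval (RProj i) xs (xs ! i)"
| reval_comp: "list_all2 (\<lambda>g y. reval g xs y) gs ys \<Longrightarrow> reval f ys z \<Longrightarrow>
    reval (RComp f gs) xs z"
| reval_prec_0: "reval f xs y \<Longrightarrow> reval (RPrec f g) (0 # xs) y"
| reval_prec_Suc: "reval (RPrec f g) (n # xs) y \<Longrightarrow> reval g (n # y # xs) z \<Longrightarrow>
    reval (RPrec f g) (Suc n # xs) z"
| reval_min: "reval f (n # xs) 0 \<Longrightarrow> (\<forall>m<n. \<exists>y. reval f (m # xs) (Suc y)) \<Longrightarrow>
    reval (RMin f) xs n"

lemma reval_deterministic: "reval f xs y \<Longrightarrow> reval f xs y' \<Longrightarrow> y = y'"
proof (induction f xs y arbitrary: y' rule: reval.induct)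
  case (reval_comp xs gs ys f z)
  from reval_comp.prems obtain ys' where
    ys': "list_all2 (\<lambda>g y. reval g xs y) gs ys'" "reval f ys' y'"
    by (cases rule: reval.cases) auto
  have "ys = ys'"
    using reval_comp.IH(1) ys'(1) by (auto simp: list_all2_conv_all_nth intro!: nth_equalityI)
  with reval_comp.IH(2) ys'(2) show ?case by blast
next
  case (reval_prec_Suc f g n xs y z)
  from reval_prec_Suc.prems obtain u where "reval (RPrec f g) (n # xs) u" "reval g (n # u # xs) y'"
    by (cases rule: reval.cases) auto
  with reval_prec_Suc.IH show ?case by blast
next
  case (reval_min f n xs)
  from reval_min.prems have y': "reval f (y' # xs) 0" "\<forall>m<y'. \<exists>y. reval f (m # xs) (Suc y)"
    by (cases rule: reval.cases; auto)+
  show ?case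
  proof (rule linorder_cases[of n y'])
    assume "n < y'"
    with y'(2) obtain u where "reval f (n # xs) (Suc u)" by blast
    with reval_min.IH(1) show ?thesis by blast
  next
    assume "y' < n"
    with reval_min.IH(2) obtain u where "\<forall>v. reval f (y' # xs) v \<longrightarrow> Suc u = v" by blast
    with y'(1) show ?thesis by blast
  qed
qed (erule reval.cases; simp)+

definition decidable_nat_set :: "nat set \<Rightarrow> bool" where
  "decidable_nat_set A \<longleftrightarrow> (\<exists>f. \<forall>n. reval f [n] (if n \<in> A then 1 else 0))"

primrec tcode :: "rterm \<Rightarrow> nat" where
  "tcode (Var i) = prod_encode (0, i)"
| "tcode Zero = prod_encode (1, 0)"
| "tcode One = prod_encode (2, 0)"
| "tcode (Add s t) = prod_encode (3, prod_encode (tcode s, tcode t))"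
| "tcode (Mul s t) = prod_encode (4, prod_encode (tcode s, tcode t))"

primrec fcode :: "rform \<Rightarrow> nat" where
  "fcode (Eq s t) = prod_encode (0, prod_encode (tcode s, tcode t))"
| "fcode (Neg \<phi>) = prod_encode (1, fcode \<phi>)"
| "fcode (Conj \<phi> \<psi>) = prod_encode (2, prod_encode (fcode \<phi>, fcode \<psi>))"
| "fcode (Forall i \<phi>) = prod_encode (3, prod_encode (i, fcode \<phi>))"
| "fcode (Exists i \<phi>) = prod_encode (4, prod_encode (i, fcode \<phi>))"

lemma tcode_inject: "tcode s = tcode t \<longleftrightarrow> s = t"
proof (induction s arbitrary: t)
  case (Var i) then show ?case by (cases t) simp_all
next
  case Zero then show ?case by (cases t) simp_all
next
  case One then show ?case by (cases t) simp_all
next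
  case (Add s1 s2) then show ?case by (cases t) simp_all
next
  case (Mul s1 s2) then show ?case by (cases t) simp_all
qed

lemma fcode_inject: "fcode \<phi> = fcode \<psi> \<longleftrightarrow> \<phi> = \<psi>"
proof (induction \<phi> arbitrary: \<psi>)
  case (Eq s t) then show ?case by (cases \<psi>) (simp_all add: tcode_inject)
next
  case (Neg \<phi>) then show ?case by (cases \<psi>) simp_all
next
  case (Conj \<phi>1 \<phi>2) then show ?case by (cases \<psi>) simp_all
next
  case (Forall i \<phi>) then show ?case by (cases \<psi>) simp_all
next
  case (Exists i \<phi>) then show ?case by (cases \<psi>) simp_all
qed

definition decidable :: "rform set \<Rightarrow> bool" where
  "decidable T \<longleftrightarrow> decidable_nat_set (fcode ` T)"

end

theory Submission
  imports Defs "Jordan_Normal_Form.Char_Poly" "HOL-Number_Theory.Cong"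
begin

text \<open>
  For \<open>b\<close> in \<open>O\<^sub>K\<close> and \<open>d = b (b + 2)\<close>, the powers \<open>X + Y \<surd>d\<close> of the norm one unit \<open>(1 + b) + \<surd>d\<close>
  satisfy \<open>X \<equiv> 1\<close> and \<open>Y \<equiv> n\<close> modulo \<open>b\<close>, where \<open>n\<close> is the exponent. The formula says of \<open>t\<close> that for
  every \<open>b\<close> some solution of \<open>X\<^sup>2 - d Y\<^sup>2 = 1\<close> has \<open>X \<equiv> 1\<close> and \<open>Y \<equiv> t\<close> modulo \<open>b\<close>. It defines a
  subring of \<open>O\<^sub>K\<close>, since the parameter \<open>1 + b\<close> can be replaced by the \<open>X\<close> of an earlier solution.

  Suppose that \<open>t\<close> of degree \<open>n > 1\<close> over the rationals satisfies it; then so do all \<open>t\<^sup>k\<close>. Choose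
  \<open>b\<close> in \<open>m \<int>[t]\<close> rational if \<open>t\<close> has a nonreal conjugate, and with \<open>d < 0\<close> otherwise. The
  solutions for \<open>1, t, \<dots>, t\<^sup>n\<^sup>-\<^sup>1\<close> lie in a number field \<open>G\<close> inside \<open>K\<close>; their norms down to \<open>\<rat>(t)\<close> have
  \<open>X \<equiv> 1\<close> and \<open>Y \<equiv> c t\<^sup>k\<close> modulo \<open>m\<close>, where \<open>c = [G : \<rat>(t)]\<close>. As in Dirichlet's unit theorem the norm one
  units have rank less than \<open>n\<close>, so these \<open>n\<close> units are multiplicatively dependent, and a primitive
  relation \<open>e\<close> gives that \<open>m\<close> divides \<open>c (e\<^sub>0 + e\<^sub>1 t + \<dots>)\<close>. If \<open>m = 6 n\<^sub>0 D\<close> with \<open>D\<close> a multiple of the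
  discriminant of \<open>t\<close>, then \<open>n\<^sub>0\<close> divides \<open>c\<close> and hence the degree of \<open>G\<close>, which is impossible when \<open>n\<^sub>0\<close>
  witnesses that \<open>K\<close> is not big.

  Undecidability follows by diagonalization: nonnegativity is being a sum of four rational squares,
  and Goedel's beta function makes recursive functions definable.
\<close>

section \<open>The ring of algebraic integers\<close>

text \<open>Let \<open>F\<close> be the field generated by \<open>t\<close>, of degree
  \<open>n\<close>. A norm one unit has one logarithm for each conjugate of \<open>t\<close>. It
  vanishes at a real conjugate where \<open>d\<close> is negative, and complex conjugates share it
  up to sign. If all conjugates are real and \<open>d\<close> is positive at each of them, nothing
  lowers the rank below \<open>n\<close>, so \<open>n\<close> units may be independent; the choice
  of \<open>b\<close> removes at least one dimension. The powers of \<open>t\<close> are used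
  together because their linear independence splits a single congruence modulo \<open>m\<close> into
  one divisibility per exponent. The exponents of a relation are not under control, only their gcd
  is: a common prime can be cancelled because the factor 6 of \<open>m\<close> leaves no nontrivial
  roots of unity among these units. The field \<open>G\<close> is not under control either, since it
  depends on \<open>m\<close>. What is fixed beforehand is \<open>n0\<close>, which divides the
  degree of no number field inside \<open>K\<close>.\<close>

definition int_span :: "complex set \<Rightarrow> complex set" where
  "int_span V = {\<Sum>v\<in>V. of_int (c v) * v | c. True}"

lemma int_combination_single:
  assumes "finite V" "v \<in> V"
  shows "(\<Sum>w\<in>V. of_int (if w = v then 1 else 0) * w) = (v :: complex)"
proof -
  have "(\<Sum>w\<in>V. of_int (if w = v then 1 else 0) * w) = (\<Sum>w\<in>V. if w = v then w else 0)"
    by (rule sum.cong) auto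
  then show ?thesis using assms by simp
qed

lemma int_span_base: "finite V \<Longrightarrow> v \<in> V \<Longrightarrow> v \<in> int_span V"
  unfolding int_span_def
  by (rule CollectI, rule exI[of _ "\<lambda>w. if w = v then 1 else 0"], rule conjI, rule int_combination_single[symmetric]) simp_all

lemma int_span_add: "x \<in> int_span V \<Longrightarrow> y \<in> int_span V \<Longrightarrow> x + y \<in> int_span V"
  unfolding int_span_def
proof clarify
  fix c d
  show "\<exists>e. (\<Sum>v\<in>V. of_int (c v) * v) + (\<Sum>v\<in>V. of_int (d v) * v) = (\<Sum>v\<in>V. of_int (e v) * v) \<and> True"
    by (rule exI[of _ "\<lambda>v. c v + d v"]) (simp add: sum.distrib algebra_simps)
qed

lemma int_span_scale: "x \<in> int_span V \<Longrightarrow> of_int k * x \<in> int_span V"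
  unfolding int_span_def
proof clarify
  fix c
  show "\<exists>e. of_int k * (\<Sum>v\<in>V. of_int (c v) * v) = (\<Sum>v\<in>V. of_int (e v) * v) \<and> True"
    by (rule exI[of _ "\<lambda>v. k * c v"]) (simp add: sum_distrib_left algebra_simps)
qed

lemma int_span_sum:
  "(\<And>i. i \<in> I \<Longrightarrow> f i \<in> int_span V) \<Longrightarrow> (\<Sum>i\<in>I. of_int (c i) * f i) \<in> int_span V"
proof (induction I rule: infinite_finite_induct)
  case (insert i I)
  then show ?case by (simp add: int_span_add int_span_scale)
next
  case (infinite A)
  then show ?case using int_span_def by (auto intro!: exI[of _ "\<lambda>_. 0"])
next
  case empty
  then show ?case using int_span_def by (auto intro!: exI[of _ "\<lambda>_. 0"])
qed

text \<open>Determinant trick: multiplication by \<open>z\<close> acts on the generators through an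
  integer matrix, and the nonzero vector of generators is an eigenvector. So \<open>z\<close> is a
  root of the characteristic polynomial, which is monic with integer coefficients.\<close>

lemma algebraic_int_by_int_span:
  assumes fin: "finite V" and one: "v0 \<in> V" "v0 \<noteq> 0"
    and closed: "\<And>v. v \<in> V \<Longrightarrow> z * v \<in> int_span V"
  shows "algebraic_int z"
proof -
  obtain vs where vs: "set vs = V" "distinct vs" using finite_distinct_list[OF fin] by blast
  define n where "n = length vs"
  have bij: "bij_betw ((!) vs) {..<n} V"
    using vs bij_betw_nth[OF vs(2), of "{..<n}" V] by (simp add: n_def)
  have "\<exists>c. z * vs ! i = (\<Sum>j<n. of_int (c j) * vs ! j)" if "i < n" for i
  proof -
    have "z * vs ! i \<in> int_span V" using that vs by (intro closed) (auto simp: n_def)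
    then obtain c where "z * vs ! i = (\<Sum>v\<in>V. of_int (c v) * v)" unfolding int_span_def by auto
    also have "\<dots> = (\<Sum>j<n. of_int (c (vs ! j)) * vs ! j)"
      by (rule sum.reindex_bij_betw[OF bij, symmetric])
    finally show ?thesis by (intro exI[of _ "\<lambda>j. c (vs ! j)"])
  qed
  then obtain C where C: "\<And>i. i < n \<Longrightarrow> z * vs ! i = (\<Sum>j<n. of_int (C i j) * vs ! j)" by metis
  define A :: "int mat" where "A = mat n n (\<lambda>(i, j). C i j)"
  define v where "v = vec n (\<lambda>i. vs ! i)"
  have A: "A \<in> carrier_mat n n" by (simp add: A_def)
  let ?A = "map_mat of_int A :: complex mat"
  have A': "?A \<in> carrier_mat n n" using A by simp
  have "?A *\<^sub>v v = z \<cdot>\<^sub>v v"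
  proof (rule eq_vecI)
    show "dim_vec (?A *\<^sub>v v) = dim_vec (z \<cdot>\<^sub>v v)" using A by (simp add: v_def)
    fix i assume i: "i < dim_vec (z \<cdot>\<^sub>v v)"
    then have "i < n" by (simp add: v_def)
    then show "(?A *\<^sub>v v) $ i = (z \<cdot>\<^sub>v v) $ i"
      using A by (simp add: v_def A_def scalar_prod_def C lessThan_atLeast0)
  qed
  moreover have "v \<noteq> 0\<^sub>v n"
  proof
    assume v: "v = 0\<^sub>v n"
    from one vs obtain i where i: "i < n" "vs ! i = v0" by (auto simp: in_set_conv_nth n_def)
    have "v $ i = 0" using i v by simp
    then show False using i one by (simp add: v_def)
  qed
  ultimately have "eigenvalue ?A z"
    using A by (auto simp: eigenvalue_def eigenvector_def v_def intro!: exI[of _ v])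
  then have "poly (char_poly ?A) z = 0" using eigenvalue_root_char_poly[OF A'] by simp
  also have "char_poly ?A = map_poly of_int (char_poly A)"
    using of_int_hom.char_poly_hom[OF A] by simp
  finally have "poly (map_poly of_int (char_poly A)) z = 0" .
  moreover have "lead_coeff (char_poly A) = 1" using degree_monic_char_poly[OF A] by simp
  ultimately show ?thesis using algebraic_int_altdef_ipoly by blast
qed

text \<open>The coefficients are complex numbers that happen to lie in \<open>\<int>\<close>;
  \<open>\<lfloor>Re z\<rfloor>\<close> reads off the integer, so that the relation gets the shape
  of \<open>int_span\<close>.\<close>

lemma monic_power_in_int_span:
  assumes "lead_coeff p = 1" "\<forall>i. coeff p i \<in> \<int>" "poly p x = 0"
  shows "x ^ degree p = (\<Sum>i<degree p. of_int (- \<lfloor>Re (coeff p i)\<rfloor>) * x ^ i)"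
proof -
  have c: "coeff p i = of_int \<lfloor>Re (coeff p i)\<rfloor>" for i
    using assms(2) by (metis Ints_cases Re_complex_of_real floor_of_int of_real_of_int_eq)
  have "0 = (\<Sum>i\<le>degree p. coeff p i * x ^ i)" using assms(3) by (simp add: poly_altdef)
  also have "\<dots> = (\<Sum>i<degree p. coeff p i * x ^ i) + x ^ degree p"
    using assms(1) by (simp add: lessThan_Suc_atMost[symmetric])
  also have "(\<Sum>i<degree p. coeff p i * x ^ i) = - (\<Sum>i<degree p. of_int (- \<lfloor>Re (coeff p i)\<rfloor>) * x ^ i)"
    by (subst sum_negf[symmetric], rule sum.cong[OF refl], subst c, simp)
  finally show ?thesis by (simp add: algebra_simps)
qed

text \<open>The monomials \<open>x ^ i * y ^ j\<close> with exponents below the two degrees span a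
  module that \<open>x\<close> and \<open>y\<close> both preserve; sum and product are treated
  together because they act on this same module.\<close>

lemma algebraic_int_add_mult:
  fixes x y :: complex
  assumes "algebraic_int x" "algebraic_int y"
  shows "algebraic_int (x + y) \<and> algebraic_int (x * y)"
proof -
  from assms obtain p q where p: "lead_coeff p = 1" "\<forall>i. coeff p i \<in> \<int>" "poly p x = 0"
    and q: "lead_coeff q = 1" "\<forall>i. coeff q i \<in> \<int>" "poly q y = 0"
    by (auto simp: algebraic_int.simps)
  define a b where "a = degree p" and "b = degree q"
  define V where "V = (\<lambda>(i, j). x ^ i * y ^ j) ` ({..<a} \<times> {..<b})"
  have fin: "finite V" by (simp add: V_def)
  have pos: "a > 0" "b > 0"
    using p q by (auto simp: a_def b_def intro!: Nat.gr0I elim!: degree_eq_zeroE)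
  have base: "x ^ i * y ^ j \<in> int_span V" if "i < a" "j < b" for i j
    using that by (intro int_span_base fin) (auto simp: V_def)
  have X: "x * v \<in> int_span V" if "v \<in> V" for v
  proof -
    from that obtain i j where ij: "v = x ^ i * y ^ j" "i < a" "j < b" by (auto simp: V_def)
    show ?thesis
    proof (cases "Suc i < a")
      case True
      then show ?thesis using base[of "Suc i" j] ij by (simp add: mult_ac)
    next
      case False
      \<comment> \<open>Only \<open>i = a - 1\<close> leaves the range of exponents; there the monic
        relation rewrites \<open>x ^ a\<close>.\<close>
      then have "x * v = x ^ a * y ^ j" using ij by (metis Suc_lessI mult.assoc power_Suc)
      also have "\<dots> = (\<Sum>i<a. of_int (- \<lfloor>Re (coeff p i)\<rfloor>) * (x ^ i * y ^ j))"
        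
        by (subst monic_power_in_int_span[OF p, folded a_def]) (simp only: sum_distrib_right mult.assoc)
      also have "\<dots> \<in> int_span V" using ij by (intro int_span_sum base) auto
      finally show ?thesis .
    qed
  qed
  have Y: "y * v \<in> int_span V" if "v \<in> V" for v
  proof -
    from that obtain i j where ij: "v = x ^ i * y ^ j" "i < a" "j < b" by (auto simp: V_def)
    show ?thesis
    proof (cases "Suc j < b")
      case True
      then show ?thesis using base[of i "Suc j"] ij by (simp add: mult_ac)
    next
      case False
      then have "y * v = x ^ i * y ^ b" using ij by (metis Suc_lessI mult.assoc mult.commute power_Suc)
      also have "\<dots> = (\<Sum>j<b. of_int (- \<lfloor>Re (coeff q j)\<rfloor>) * (x ^ i * y ^ j))"
        
        by (subst monic_power_in_int_span[OF q, folded b_def]) (simp only: sum_distrib_left mult_ac)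
      also have "\<dots> \<in> int_span V" using ij by (intro int_span_sum base) auto
      finally show ?thesis .
    qed
  qed
  have one: "1 \<in> V" using pos by (force simp: V_def image_iff intro!: bexI[of _ "(0, 0)"])
  \<comment> \<open>For the product, \<open>x\<close> has to act on \<open>y * v\<close>, which is
    known to be in the span but need not be a generator.\<close>
  have X': "x * w \<in> int_span V" if w: "w \<in> int_span V" for w
  proof -
    from w obtain c where "w = (\<Sum>v\<in>V. of_int (c v) * v)" by (auto simp: int_span_def)
    then have "x * w = (\<Sum>v\<in>V. of_int (c v) * (x * v))" by (simp add: sum_distrib_left mult_ac)
    also have "\<dots> \<in> int_span V" by (intro int_span_sum X)
    finally show ?thesis .
  qed
  have "algebraic_int (x + y)"
    by (rule algebraic_int_by_int_span[OF fin one]) (auto simp: ring_distribs intro!: int_span_add X Y)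
  moreover have "algebraic_int (x * y)"
    by (rule algebraic_int_by_int_span[OF fin one]) (auto simp: mult.assoc intro!: X' Y)
  ultimately show ?thesis ..
qed

lemmas algebraic_int_add = algebraic_int_add_mult[THEN conjunct1]
  and algebraic_int_mult = algebraic_int_add_mult[THEN conjunct2]

lemma algebraic_int_diff: "algebraic_int x \<Longrightarrow> algebraic_int y \<Longrightarrow> algebraic_int (x - y :: complex)"
  using algebraic_int_add[of x "- y"] by auto

lemma algebraic_int_power: "algebraic_int x \<Longrightarrow> algebraic_int (x ^ n :: complex)"
  by (induction n) (auto intro: algebraic_int_mult)

lemma algebraic_int_sum:
  "(\<And>i. i \<in> I \<Longrightarrow> algebraic_int (f i)) \<Longrightarrow> algebraic_int (\<Sum>i\<in>I. f i :: complex)"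
  by (induction I rule: infinite_finite_induct) (auto intro: algebraic_int_add)

lemma algebraic_int_prod:
  "(\<And>i. i \<in> I \<Longrightarrow> algebraic_int (f i)) \<Longrightarrow> algebraic_int (\<Prod>i\<in>I. f i :: complex)"
  by (induction I rule: infinite_finite_induct) (auto intro: algebraic_int_mult)

section \<open>Subfields of the complex numbers and simple extensions\<close>

locale complex_subfield =
  fixes F :: "complex set"
  assumes is_subfield: "is_subfield F"
begin

lemma zero_closed [simp, intro]: "0 \<in> F"
  and one_closed [simp, intro]: "1 \<in> F"
  and add_closed [intro]: "x \<in> F \<Longrightarrow> y \<in> F \<Longrightarrow> x + y \<in> F"
  and mult_closed [intro]: "x \<in> F \<Longrightarrow> y \<in> F \<Longrightarrow> x * y \<in> F"
  and minus_closed [intro]: "x \<in> F \<Longrightarrow> - x \<in> F"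
  and inverse_closed [intro]: "x \<in> F \<Longrightarrow> inverse x \<in> F"
  using is_subfield by (auto simp: is_subfield_def)

lemma diff_closed [intro]: "x \<in> F \<Longrightarrow> y \<in> F \<Longrightarrow> x - y \<in> F"
  using add_closed[of x "- y"] minus_closed by auto

lemma divide_closed [intro]: "x \<in> F \<Longrightarrow> y \<in> F \<Longrightarrow> x / y \<in> F"
  using mult_closed[of x "inverse y"] inverse_closed by (auto simp: divide_inverse)

lemma power_closed [intro]: "x \<in> F \<Longrightarrow> x ^ n \<in> F"
  by (induction n) auto

lemma sum_closed: "(\<And>i. i \<in> I \<Longrightarrow> f i \<in> F) \<Longrightarrow> (\<Sum>i\<in>I. f i) \<in> F"
  by (induction I rule: infinite_finite_induct) auto

lemma of_nat_closed [simp, intro]: "of_nat n \<in> F"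
  by (induction n) auto

lemma of_int_closed [simp, intro]: "of_int n \<in> F"
  by (cases n rule: int_cases2) auto

lemma Rats_subset: "\<rat> \<subseteq> F"
  by (auto elim!: Rats_cases')

end

lemma complex_subfield_Rats: "complex_subfield \<rat>"
  by unfold_locales (auto simp: is_subfield_def)

text \<open>Fields are subsets of one type here, so polynomials over a field are complex polynomials
  with restricted coefficients.\<close>

definition poly_over :: "'a::zero set \<Rightarrow> 'a poly set" where
  "poly_over F = {p. \<forall>i. coeff p i \<in> F}"

lemma poly_over_mono: "F \<subseteq> G \<Longrightarrow> poly_over F \<subseteq> poly_over G"
  by (auto simp: poly_over_def)

context complex_subfield
begin

lemma poly_over_0 [simp, intro]: "0 \<in> poly_over F"
  and poly_over_1 [simp, intro]: "1 \<in> poly_over F"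
  and poly_over_pCons: "pCons a p \<in> poly_over F \<longleftrightarrow> a \<in> F \<and> p \<in> poly_over F"
  and poly_over_add [intro]: "p \<in> poly_over F \<Longrightarrow> q \<in> poly_over F \<Longrightarrow> p + q \<in> poly_over F"
  and poly_over_minus [intro]: "p \<in> poly_over F \<Longrightarrow> - p \<in> poly_over F"
  and poly_over_diff [intro]: "p \<in> poly_over F \<Longrightarrow> q \<in> poly_over F \<Longrightarrow> p - q \<in> poly_over F"
  and poly_over_mult [intro]: "p \<in> poly_over F \<Longrightarrow> q \<in> poly_over F \<Longrightarrow> p * q \<in> poly_over F"
  and poly_over_smult [intro]: "a \<in> F \<Longrightarrow> p \<in> poly_over F \<Longrightarrow> Polynomial.smult a p \<in> poly_over F"
  and poly_over_monom [intro]: "a \<in> F \<Longrightarrow> monom a n \<in> poly_over F"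
proof -
  show "pCons a p \<in> poly_over F \<longleftrightarrow> a \<in> F \<and> p \<in> poly_over F"
    by (auto simp: poly_over_def coeff_pCons split: nat.splits)
qed (auto simp: poly_over_def coeff_mult coeff_1 intro!: sum_closed)

lemma poly_over_power [intro]: "p \<in> poly_over F \<Longrightarrow> p ^ n \<in> poly_over F"
  by (induction n) auto

lemma poly_over_pcompose [intro]:
  "p \<in> poly_over F \<Longrightarrow> q \<in> poly_over F \<Longrightarrow> pcompose p q \<in> poly_over F"
  by (induction p) (auto simp: poly_over_pCons pcompose_pCons)

lemma poly_over_pderiv [intro]: "p \<in> poly_over F \<Longrightarrow> pderiv p \<in> poly_over F"
  by (auto simp: poly_over_def coeff_pderiv simp del: of_nat_Suc)

lemma poly_closed: "p \<in> poly_over F \<Longrightarrow> x \<in> F \<Longrightarrow> poly p x \<in> F"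
  by (induction p) (auto simp: poly_over_pCons)

end

section \<open>Simple extensions and minimal polynomials\<close>

definition adjoin :: "complex set \<Rightarrow> complex \<Rightarrow> complex set" where
  "adjoin F \<theta> = (\<lambda>p. poly p \<theta>) ` poly_over F"

definition is_minpoly :: "complex set \<Rightarrow> complex \<Rightarrow> complex poly \<Rightarrow> bool" where
  "is_minpoly F \<theta> g \<longleftrightarrow> g \<in> poly_over F \<and> lead_coeff g = 1 \<and> poly g \<theta> = 0 \<and>
     (\<forall>p\<in>poly_over F. degree p < degree g \<longrightarrow> poly p \<theta> = 0 \<longrightarrow> p = 0)"

text \<open>Factors \<open>z\<close> are cancelled from the equation until its constant term
  \<open>a\<close> is nonzero; then \<open>a + z * p(z) = 0\<close> is solved for the inverse of
  \<open>z\<close>.\<close>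

lemma inverse_algebraic_eq_poly:
  fixes z :: complex
  assumes "p \<in> poly_over \<rat>" "p \<noteq> 0" "poly p z = 0" "z \<noteq> 0"
  shows "\<exists>q\<in>poly_over \<rat>. inverse z = poly q z"
  using assms
proof (induction p)
  case (pCons a p)
  interpret R: complex_subfield "\<rat>" by (rule complex_subfield_Rats)
  have ap: "a \<in> \<rat>" "p \<in> poly_over \<rat>" using pCons.prems by (simp_all add: R.poly_over_pCons)
  show ?case
  proof (cases "a = 0")
    case True
    with pCons ap show ?thesis by auto
  next
    case False
    have "a + z * poly p z = 0" using pCons.prems by simp
    then have "inverse z = poly (Polynomial.smult (- inverse a) p) z"
      using False \<open>z \<noteq> 0\<close> by (simp add: field_simps add_eq_0_iff)
    moreover have "Polynomial.smult (- inverse a) p \<in> poly_over \<rat>" using ap by auto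
    ultimately show ?thesis by blast
  qed
qed auto

lemma algebraic_poly_over_Rats:
  "algebraic (z :: complex) \<Longrightarrow> \<exists>p\<in>poly_over \<rat>. p \<noteq> 0 \<and> poly p z = 0"
  unfolding algebraic_def poly_over_def using Ints_subset_Rats by fastforce

context complex_subfield
begin

lemma subset_adjoin: "F \<subseteq> adjoin F \<theta>"
proof
  fix x assume "x \<in> F"
  then show "x \<in> adjoin F \<theta>"
    unfolding adjoin_def by (intro image_eqI[of _ _ "[:x:]"]) (auto simp: poly_over_pCons)
qed

lemma generator_in_adjoin: "\<theta> \<in> adjoin F \<theta>"
  unfolding adjoin_def by (intro image_eqI[of _ _ "[:0, 1:]"]) (auto simp: poly_over_pCons)

lemma adjoin_subset:
  assumes "is_subfield K" "F \<subseteq> K" "\<theta> \<in> K"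
  shows "adjoin F \<theta> \<subseteq> K"
proof -
  interpret K: complex_subfield K by unfold_locales (rule assms)
  show ?thesis unfolding adjoin_def using K.poly_closed poly_over_mono[OF assms(2)] assms(3) by auto
qed

text \<open>The elements of \<open>adjoin\<close> are polynomial expressions only. An inverse exists
  among them because the inverse of an algebraic \<open>x\<close> is a rational polynomial in
  \<open>x\<close>, and composition makes it a polynomial in \<theta>.\<close>

lemma is_subfield_adjoin:
  assumes alg: "\<And>x. x \<in> adjoin F \<theta> \<Longrightarrow> algebraic x"
  shows "is_subfield (adjoin F \<theta>)"
  unfolding is_subfield_def
proof (intro conjI ballI)
  show "0 \<in> adjoin F \<theta>" "1 \<in> adjoin F \<theta>" using subset_adjoin by auto
  fix x assume x: "x \<in> adjoin F \<theta>"
  then obtain p where p: "p \<in> poly_over F" "x = poly p \<theta>" by (auto simp: adjoin_def)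
  show "- x \<in> adjoin F \<theta>"
    unfolding adjoin_def using p by (intro image_eqI[of _ _ "- p"]) auto
  show "inverse x \<in> adjoin F \<theta>"
  proof (cases "x = 0")
    case True
    then show ?thesis using subset_adjoin by auto
  next
    case False
    obtain r where "r \<in> poly_over \<rat>" "r \<noteq> 0" "poly r x = 0"
      using algebraic_poly_over_Rats[OF alg[OF x]] by blast
    then obtain q where q: "q \<in> poly_over \<rat>" "inverse x = poly q x"
      using inverse_algebraic_eq_poly[of r x] False by blast
    have "q \<in> poly_over F" using q poly_over_mono[OF Rats_subset] by auto
    then show ?thesis unfolding adjoin_def
      using p q by (intro image_eqI[of _ _ "pcompose q p"]) (auto simp: poly_pcompose)
  qed
  fix y assume "y \<in> adjoin F \<theta>"
  then obtain q where q: "q \<in> poly_over F" "y = poly q \<theta>" by (auto simp: adjoin_def)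
  show "x + y \<in> adjoin F \<theta>"
    unfolding adjoin_def using p q by (intro image_eqI[of _ _ "p + q"]) auto
  show "x * y \<in> adjoin F \<theta>"
    unfolding adjoin_def using p q by (intro image_eqI[of _ _ "p * q"]) auto
qed

lemma is_minpoly_exists:
  assumes "algebraic \<theta>"
  shows "\<exists>g. is_minpoly F \<theta> g"
proof -
  define P where "P g \<longleftrightarrow> g \<in> poly_over F \<and> g \<noteq> 0 \<and> poly g \<theta> = 0" for g
  obtain p where "P p"
    using algebraic_poly_over_Rats[OF assms] poly_over_mono[OF Rats_subset] by (auto simp: P_def)
  then have "P (arg_min degree P)" by (rule arg_min_natI)
  moreover define h where "h = arg_min degree P"
  ultimately have h: "P h" by simp
  have min: "degree h \<le> degree q" if "P q" for q
    unfolding h_def using that by (rule arg_min_nat_le)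
  define g where "g = Polynomial.smult (inverse (lead_coeff h)) h"
  have "lead_coeff g = 1" using h by (simp add: g_def P_def)
  moreover have "poly g \<theta> = 0" "g \<in> poly_over F"
    using h by (auto simp: g_def P_def poly_over_def)
  moreover have "degree g = degree h" using h by (simp add: g_def P_def)
  ultimately show ?thesis using min unfolding is_minpoly_def P_def by (metis linorder_not_less)
qed

lemma is_minpoly_degree_pos: "is_minpoly F \<theta> g \<Longrightarrow> degree g > 0"
  by (auto simp: is_minpoly_def intro!: Nat.gr0I elim!: degree_eq_zeroE)

text \<open>Each step cancels the leading term by a monomial multiple of \<open>g\<close>; as
  \<open>g\<close> is monic over \<open>F\<close>, no coefficient ever leaves
  \<open>F\<close>.\<close>

lemma minpoly_division:
  assumes g: "is_minpoly F \<theta> g" and p: "p \<in> poly_over F"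
  shows "\<exists>q r. q \<in> poly_over F \<and> r \<in> poly_over F \<and> p = g * q + r \<and> degree r < degree g"
  using p
proof (induction "degree p" arbitrary: p rule: less_induct)
  case less
  have gF: "g \<in> poly_over F" and lc: "lead_coeff g = 1" using g by (auto simp: is_minpoly_def)
  show ?case
  proof (cases "degree p < degree g")
    case True
    with less.prems show ?thesis by (intro exI[of _ 0] exI[of _ p]) auto
  next
    case False
    define s where "s = monom (lead_coeff p) (degree p - degree g)"
    have sF: "s \<in> poly_over F" using less.prems by (auto simp: s_def poly_over_def)
    have p0: "p \<noteq> 0" using False is_minpoly_degree_pos[OF g] by auto
    then have lp: "lead_coeff p \<noteq> 0" by simp
    have s: "degree s = degree p - degree g" "s \<noteq> 0"
      unfolding s_def using lp Polynomial.degree_monom_eq[OF lp] by (simp_all add: monom_eq_0_iff)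
    then have ds: "degree (g * s) = degree p"
      using False is_minpoly_degree_pos[OF g] by (subst degree_mult_eq) auto
    have "lead_coeff (g * s) = lead_coeff p"
    proof -
      have "lead_coeff s = lead_coeff p" unfolding s(1) by (simp add: s_def)
      then show ?thesis using lc by (simp add: lead_coeff_mult)
    qed
    then have cz: "coeff (p - g * s) (degree p) = 0" using ds by simp
    have "degree (p - g * s) < degree p"
    proof (cases "p - g * s = 0")
      case True
      then show ?thesis using False is_minpoly_degree_pos[OF g] by (metis degree_0 gr0I not_less0)
    next
      case F: False
      have "degree (p - g * s) \<le> degree p" using ds by (intro degree_diff_le) auto
      moreover have "degree (p - g * s) \<noteq> degree p" using cz F by (metis leading_coeff_0_iff)
      ultimately show ?thesis by simp
    qed
    moreover have "p - g * s \<in> poly_over F" using less.prems sF gF by auto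
    ultimately obtain q r where "q \<in> poly_over F" "r \<in> poly_over F" "p - g * s = g * q + r"
      "degree r < degree g" using less.hyps by blast
    then show ?thesis using sF
      by (intro exI[of _ "q + s"] exI[of _ r]) (auto simp: algebra_simps)
  qed
qed

text \<open>This plays the role of the embeddings over \<open>F\<close>: a polynomial identity that
  holds at \<theta> holds at every conjugate, since the remainder modulo \<open>g\<close> vanishes
  at \<theta> and so is zero.\<close>

lemma minpoly_root_transfer:
  assumes g: "is_minpoly F \<theta> g" and p: "p \<in> poly_over F" "poly p \<theta> = 0" and \<rho>: "poly g \<rho> = 0"
  shows "poly p \<rho> = 0"
proof -
  obtain q r where qr: "q \<in> poly_over F" "r \<in> poly_over F" "p = g * q + r" "degree r < degree g"
    using minpoly_division[OF g p(1)] by blast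
  have "poly r \<theta> = 0" using qr p g by (simp add: is_minpoly_def)
  then have "r = 0" using g qr by (auto simp: is_minpoly_def)
  then show ?thesis using qr \<rho> by simp
qed

text \<open>The monic integer equation of \<open>h(\<theta>)\<close>, composed with
  \<open>h\<close>, is an identity over \<open>F\<close> and moves to every conjugate.\<close>

lemma minpoly_algebraic_int_transfer:
  assumes g: "is_minpoly F \<theta> g" and h: "h \<in> poly_over F" "algebraic_int (poly h \<theta>)"
    and \<rho>: "poly g \<rho> = 0"
  shows "algebraic_int (poly h \<rho>)"
proof -
  from h obtain p where p: "lead_coeff p = 1" "\<forall>i. coeff p i \<in> \<int>" "poly p (poly h \<theta>) = 0"
    by (auto simp: algebraic_int.simps)
  have "p \<in> poly_over F" using p(2) Ints_subset_Rats Rats_subset by (auto simp: poly_over_def)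
  then have "poly (pcompose p h) \<rho> = 0"
    using p h by (intro minpoly_root_transfer[OF g _ _ \<rho>]) (auto simp: poly_pcompose)
  then show ?thesis using p by (auto simp: poly_pcompose intro!: algebraic_int.intros[of p])
qed

text \<open>The identity \<open>p * v = 1\<close> that witnesses invertibility at \<theta> moves to
  every conjugate.\<close>

lemma minpoly_nonroot_transfer:
  assumes g: "is_minpoly F \<theta> g" and alg: "\<And>x. x \<in> adjoin F \<theta> \<Longrightarrow> algebraic x"
    and p: "p \<in> poly_over F" "poly p \<theta> \<noteq> 0" and \<rho>: "poly g \<rho> = 0"
  shows "poly p \<rho> \<noteq> 0"
proof -
  have "inverse (poly p \<theta>) \<in> adjoin F \<theta>"
    using is_subfield_adjoin[OF alg] p by (auto simp: is_subfield_def adjoin_def)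
  then obtain v where v: "v \<in> poly_over F" "inverse (poly p \<theta>) = poly v \<theta>" by (auto simp: adjoin_def)
  have "poly (p * v - 1) \<theta> = 0" using p v(2)[symmetric] by simp
  then have "poly (p * v - 1) \<rho> = 0"
    using p v by (intro minpoly_root_transfer[OF g _ _ \<rho>]) auto
  then show ?thesis by auto
qed

end

section \<open>Number fields and multiplicativity of the degree\<close>

lemma number_field_subfield: "number_field F \<Longrightarrow> complex_subfield F"
  by unfold_locales (simp add: number_field_def)

lemma number_field_basis:
  assumes "number_field F"
  obtains B where "finite B" "\<not> rat_vs.dependent B" "rat_vs.span B = F" "card B = degree_over_rat F"
proof -
  from assms obtain S where S: "finite S" "rat_vs.span S = F" by (auto simp: number_field_def)
  obtain B where B: "B \<subseteq> S" "\<not> rat_vs.dependent B" "rat_vs.span B = rat_vs.span S"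
    using rat_vs.maximal_independent_subset[of S]
    by (metis rat_vs.span_eq rat_vs.span_superset subset_trans)
  have "finite B" using S B finite_subset by blast
  moreover have "card B = degree_over_rat F"
    unfolding degree_over_rat_def using rat_vs.dim_span_eq_card_independent[OF B(2)] B S by simp
  ultimately show ?thesis using that B S by simp
qed

lemma span_in_subfield:
  assumes "complex_subfield F" "B \<subseteq> F" shows "rat_vs.span B \<subseteq> F"
proof -
  interpret complex_subfield F by fact
  show ?thesis
  proof
    fix x assume "x \<in> rat_vs.span B"
    then show "x \<in> F"
      by (induction rule: rat_vs.span_induct_alt)
        (use assms(2) Rats_subset in \<open>auto simp: rat_scale_def intro!: add_closed mult_closed\<close>)
  qed
qed

text \<open>Tower law: the products of a basis of \<open>F\<close> with the powers of \<theta> below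
  the degree of \<open>g\<close> form a basis of the extension.\<close>

lemma number_field_adjoin:
  assumes F: "number_field F" and g: "is_minpoly F \<theta> g"
    and alg: "\<And>x. x \<in> adjoin F \<theta> \<Longrightarrow> algebraic x"
  shows "number_field (adjoin F \<theta>) \<and> degree_over_rat (adjoin F \<theta>) = degree g * degree_over_rat F"
proof -
  interpret complex_subfield F using F by (rule number_field_subfield)
  obtain B where B: "finite B" "\<not> rat_vs.dependent B" "rat_vs.span B = F" "card B = degree_over_rat F"
    using number_field_basis[OF F] .
  define n where "n = degree g"
  let ?\<phi> = "\<lambda>(b, j). b * \<theta> ^ j"
  have BF: "b \<in> F" if "b \<in> B" for b using that B rat_vs.span_base by auto
  \<comment> \<open>Coefficients are indexed by pairs because distinct pairs might still give equal
    products; that they do not is deduced next, from the relation with coefficients 1 and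
    -1.\<close>
  have zero: "u (b, j) = 0"
    if "(\<Sum>(b, j)\<in>B \<times> {..<n}. of_rat (u (b, j)) * (b * \<theta> ^ j)) = 0" and bj: "b \<in> B" "j < n" for u :: "complex \<times> nat \<Rightarrow> rat" and b j
  proof -
    define c where "c i = (if i < n then \<Sum>b\<in>B. of_rat (u (b, i)) * b else 0)" for i
    define p where "p = (\<Sum>i<n. monom (c i) i)"
    have cF: "c i \<in> F" for i unfolding c_def using BF Rats_subset
      by (auto intro!: sum_closed mult_closed)
    have co: "coeff p i = c i" for i
      by (simp add: p_def coeff_sum coeff_monom if_distrib c_def cong: if_cong)
    have pF: "p \<in> poly_over F" using cF co by (simp add: poly_over_def)
    have "poly p \<theta> = (\<Sum>i<n. \<Sum>b\<in>B. of_rat (u (b, i)) * (b * \<theta> ^ i))"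
      by (simp add: p_def poly_sum poly_monom c_def sum_distrib_right mult.assoc)
    also have "\<dots> = (\<Sum>b\<in>B. \<Sum>i<n. of_rat (u (b, i)) * (b * \<theta> ^ i))" by (rule sum.swap)
    also have "\<dots> = 0" using that(1) by (simp add: sum.cartesian_product case_prod_beta')
    finally have "poly p \<theta> = 0" .
    moreover have "degree p < degree g"
    proof -
      have "degree p \<le> n - 1" by (rule degree_le) (auto simp: co c_def)
      then show ?thesis using is_minpoly_degree_pos[OF g] by (simp add: n_def)
    qed
    ultimately have "p = 0" using g pF by (auto simp: is_minpoly_def)
    then have "c j = 0" using co[of j] by simp
    then have "(\<Sum>b\<in>B. rat_scale (u (b, j)) b) = 0" using bj by (simp add: c_def rat_scale_def)
    then show "u (b, j) = 0"
      using rat_vs.independentD[OF B(2) B(1) order_refl, of "\<lambda>b. u (b, j)" b] bj by simp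
  qed
  have inj: "inj_on ?\<phi> (B \<times> {..<n})"
  proof (rule inj_onI, rule ccontr)
    fix x y assume xy: "x \<in> B \<times> {..<n}" "y \<in> B \<times> {..<n}" "?\<phi> x = ?\<phi> y" "x \<noteq> y"
    define u :: "complex \<times> nat \<Rightarrow> rat" where "u z = (if z = x then 1 else if z = y then -1 else 0)" for z
    have "(\<Sum>(b, j)\<in>B \<times> {..<n}. of_rat (u (b, j)) * (b * \<theta> ^ j)) =
      (\<Sum>z\<in>B \<times> {..<n}. (if z = x then ?\<phi> z else 0) - (if z = y then ?\<phi> z else 0))"
      using xy(4) by (intro sum.cong) (auto simp: u_def)
    also have "\<dots> = 0" using xy B(1) by (simp add: sum_subtractf)
    finally have "u (fst x, snd x) = 0" by (rule zero) (use xy in auto)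
    then show False by (simp add: u_def)
  qed
  define B' where "B' = ?\<phi> ` (B \<times> {..<n})"
  have finB': "finite B'" using B by (simp add: B'_def)
  have indep: "\<not> rat_vs.dependent B'"
  proof (rule rat_vs.independent_if_scalars_zero[OF finB'])
    fix f x assume s: "(\<Sum>x\<in>B'. rat_scale (f x) x) = 0" and x: "x \<in> B'"
    obtain b j where bj: "b \<in> B" "j < n" "x = b * \<theta> ^ j" using x by (auto simp: B'_def)
    have "(\<Sum>(b, j)\<in>B \<times> {..<n}. of_rat (f (?\<phi> (b, j))) * (b * \<theta> ^ j)) = 0"
      using s unfolding B'_def sum.reindex[OF inj] by (simp add: rat_scale_def case_prod_beta')
    from zero[OF this bj(1,2)] bj show "f x = 0" by simp
  qed
  interpret A: complex_subfield "adjoin F \<theta>" by unfold_locales (rule is_subfield_adjoin[OF alg])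
  have span: "rat_vs.span B' = adjoin F \<theta>"
  proof
    have "B' \<subseteq> adjoin F \<theta>" 
      using A.mult_closed[OF subsetD[OF subset_adjoin BF] A.power_closed[OF generator_in_adjoin]]
      by (auto simp: B'_def)
    then show "rat_vs.span B' \<subseteq> adjoin F \<theta>" by (intro span_in_subfield A.complex_subfield_axioms)
  next
    have base: "b * \<theta> ^ j \<in> rat_vs.span B'" if "b \<in> F" "j < n" for b j
    proof -
      have "b \<in> rat_vs.span B" using that B by simp
      then show ?thesis
      proof (induction rule: rat_vs.span_induct_alt)
        case base
        then show ?case by (simp add: rat_vs.span_zero)
      next
        case (step c x y)
        have "x * \<theta> ^ j \<in> rat_vs.span B'" using step that by (intro rat_vs.span_base) (auto simp: B'_def)
        then have "rat_scale c (x * \<theta> ^ j) + y * \<theta> ^ j \<in> rat_vs.span B'"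
          using step by (intro rat_vs.span_add rat_vs.span_scale)
        moreover have "rat_scale c (x * \<theta> ^ j) + y * \<theta> ^ j = (rat_scale c x + y) * \<theta> ^ j"
          by (simp add: rat_scale_def algebra_simps)
        ultimately show ?case by simp
      qed
    qed
    show "adjoin F \<theta> \<subseteq> rat_vs.span B'"
    proof
      fix x assume "x \<in> adjoin F \<theta>"
      then obtain p where p: "p \<in> poly_over F" "x = poly p \<theta>" by (auto simp: adjoin_def)
      obtain q r where qr: "q \<in> poly_over F" "r \<in> poly_over F" "p = g * q + r" "degree r < degree g"
        using minpoly_division[OF g p(1)] by blast
      have "x = poly r \<theta>" using qr p g by (simp add: is_minpoly_def)
      also have "\<dots> = (\<Sum>i\<le>degree r. coeff r i * \<theta> ^ i)" by (simp add: poly_altdef)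
      also have "\<dots> \<in> rat_vs.span B'"
        using qr by (intro rat_vs.span_sum base) (auto simp: poly_over_def n_def)
      finally show "x \<in> rat_vs.span B'" .
    qed
  qed
  have "degree_over_rat (adjoin F \<theta>) = card B'"
    unfolding degree_over_rat_def span[symmetric] by (rule rat_vs.dim_span_eq_card_independent[OF indep])
  also have "\<dots> = degree g * degree_over_rat F"
    unfolding B'_def card_image[OF inj] using B by (simp add: card_cartesian_product n_def)
  finally show ?thesis using finB' span A.is_subfield by (auto simp: number_field_def)
qed

lemma number_field_Rats: "number_field \<rat>" "degree_over_rat \<rat> = 1"
proof -
  have indep: "\<not> rat_vs.dependent {1}" by (simp add: rat_vs.dependent_single)
  have span: "rat_vs.span {1} = \<rat>"
    by (auto simp: rat_vs.span_singleton rat_scale_def Rats_def)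
  show "number_field \<rat>"
    using span complex_subfield_Rats by (auto simp: number_field_def complex_subfield_def)
  show "degree_over_rat \<rat> = 1"
    unfolding degree_over_rat_def span[symmetric] using rat_vs.dim_span_eq_card_independent[OF indep] by simp
qed

no_notation vec_index (infixl "$" 100)

section \<open>Symmetric functions of conjugates\<close>

text \<open>The reversed polynomial with roots \<open>us\<close>: its coefficients are the signed
  elementary symmetric functions. As a power series it has a logarithmic derivative, and the ring
  may be a ring of polynomials, as it is later.\<close>

definition newton_fps :: "'a::comm_ring_1 list \<Rightarrow> 'a fps" where
  "newton_fps us = prod_list (map (\<lambda>u. 1 - fps_const u * fps_X) us)"

text \<open>Logarithmic derivative: each factor \<open>1 - u X\<close> contributes
  \<open>- u / (1 - u X)\<close>, and these geometric series add up to the series of power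
  sums.\<close>

lemma newton_fps_deriv:
  fixes us :: "'a::comm_ring_1 list"
  shows "fps_deriv (newton_fps us) = - (newton_fps us * Abs_fps (\<lambda>n. \<Sum>u\<leftarrow>us. u ^ Suc n))"
proof (induction us)
  case Nil
  then show ?case by (simp add: newton_fps_def fps_eq_iff fps_mult_nth)
next
  case (Cons u us)
  let ?P = "Abs_fps (\<lambda>n. \<Sum>u\<leftarrow>us. u ^ Suc n)" and ?G = "Abs_fps (\<lambda>n. u ^ Suc n)"
  have G: "(1 - fps_const u * fps_X) * ?G = fps_const u"
  proof (rule fps_ext)
    fix n show "((1 - fps_const u * fps_X) * ?G) $ n = fps_const u $ n"
      by (cases n) (simp_all add: algebra_simps)
  qed
  have s: "Abs_fps (\<lambda>n. \<Sum>u\<leftarrow>u # us. u ^ Suc n) = ?G + ?P" by (simp add: fps_eq_iff)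
  have "fps_deriv (newton_fps (u # us)) =
      - fps_const u * newton_fps us + (1 - fps_const u * fps_X) * fps_deriv (newton_fps us)"
    by (simp add: newton_fps_def algebra_simps del: fps_const_neg)
  also have "\<dots> = - (((1 - fps_const u * fps_X) * ?G) * newton_fps us
      + (1 - fps_const u * fps_X) * newton_fps us * ?P)"
    unfolding G Cons.IH by (simp add: algebra_simps del: fps_const_neg)
  also have "\<dots> = - ((1 - fps_const u * fps_X) * newton_fps us * (?G + ?P))"
    by (simp add: algebra_simps)
  finally show ?case unfolding s by (simp add: newton_fps_def)
qed

lemma newton_identity:
  "of_nat (Suc k) * newton_fps us $ Suc k = - (\<Sum>i\<le>k. newton_fps us $ i * (\<Sum>u\<leftarrow>us. u ^ Suc (k - i)))"
  using arg_cong[OF newton_fps_deriv[of us], of "\<lambda>f. f $ k"]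
  by (simp add: fps_mult_nth atLeast0AtMost algebra_simps)

lemma newton_fps_0: "newton_fps us $ 0 = 1"
  by (induction us) (simp_all add: newton_fps_def fps_mult_nth)

lemma newton_fps_Cons_Suc:
  "newton_fps (u # us) $ Suc k = newton_fps us $ Suc k - u * newton_fps us $ k"
  by (simp add: newton_fps_def left_diff_distrib mult.assoc)

lemma newton_fps_nth:
  fixes us :: "'a::idom list"
  shows "newton_fps us $ k =
    (if k \<le> length us then coeff (\<Prod>u\<leftarrow>us. [:- u, 1:]) (length us - k) else 0)"
proof (induction us arbitrary: k)
  case Nil
  then show ?case by (simp add: newton_fps_def coeff_1)
next
  case (Cons u us)
  let ?q = "\<Prod>u\<leftarrow>us. [:- u, 1:]"
  have deg: "degree ?q = length us"
  proof (induction us)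
    case (Cons u us)
    have "(\<Prod>u\<leftarrow>us. [:- u, 1:]) \<noteq> 0" by (auto simp: prod_list_zero_iff)
    then show ?case using Cons by (simp add: degree_mult_eq del: mult_pCons_left)
  qed simp
  have hi: "coeff ?q m = 0" if "m > length us" for m using deg that by (simp add: coeff_eq_0)
  have e: "(\<Prod>u\<leftarrow>u # us. [:- u, 1:]) = Polynomial.smult (- u) ?q + pCons 0 ?q" by simp
  show ?case
  proof (cases k)
    case 0
    have "coeff ?q (length us) = 1" using Cons.IH[of 0] by (simp add: newton_fps_0)
    then show ?thesis
      using hi[of "Suc (length us)"] unfolding 0 e by (simp add: newton_fps_0 del: mult_pCons_left)
  next
    case (Suc j)
    show ?thesis
      unfolding Suc newton_fps_Cons_Suc Cons.IH e
      by (auto simp: coeff_pCons hi Suc_diff_le not_le split: nat.splits)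
        (metis Suc_diff_Suc Suc_le_eq Suc_inject)
  qed
qed

text \<open>Newton's identities recover the elementary symmetric functions, the product among them,
  from the power sums at the price of dividing by positive integers. Hence membership of a norm in
  \<open>R\<close> follows from membership of traces.\<close>

lemma prod_list_in_by_power_sums:
  fixes us :: "'a::comm_ring_1 list"
  assumes "1 \<in> R"
    and add: "\<And>x y. x \<in> R \<Longrightarrow> y \<in> R \<Longrightarrow> x + y \<in> R"
    and mult: "\<And>x y. x \<in> R \<Longrightarrow> y \<in> R \<Longrightarrow> x * y \<in> R"
    and minus: "\<And>x. x \<in> R \<Longrightarrow> - x \<in> R"
    and div: "\<And>k x. of_nat (Suc k) * x \<in> R \<Longrightarrow> x \<in> R"
    and ps: "\<And>k. (\<Sum>u\<leftarrow>us. u ^ Suc k) \<in> R"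
  shows "prod_list us \<in> R"
proof -
  have zero: "0 \<in> R" using add[OF assms(1) minus[OF assms(1)]] by simp
  have sum: "(\<And>i. i \<in> I \<Longrightarrow> f i \<in> R) \<Longrightarrow> sum f I \<in> R" for f and I :: "nat set"
    by (induction I rule: infinite_finite_induct) (auto simp: zero add)
  have r: "newton_fps us $ k \<in> R" for k
  proof (induction k rule: less_induct)
    case (less k)
    show ?case
    proof (cases k)
      case 0
      then show ?thesis using assms(1) by (simp add: newton_fps_0)
    next
      case (Suc j)
      have "of_nat (Suc j) * newton_fps us $ Suc j \<in> R"
        unfolding newton_identity using less Suc by (intro minus sum mult ps) auto
      then show ?thesis unfolding Suc by (rule div)
    qed
  qed
  \<comment> \<open>Vanishing above the length is part of the claim because the recursion combines
    two neighbouring coefficients.\<close>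
  have top: "newton_fps us $ k = (if k = length us then (-1) ^ k * prod_list us else 0)"
    if "k \<ge> length us" for k
    using that
  proof (induction us arbitrary: k)
    case Nil
    then show ?case by (simp add: newton_fps_def)
  next
    case (Cons u us)
    then obtain j where "k = Suc j" by (cases k) auto
    with Cons.prems Cons.IH[of "Suc j"] Cons.IH[of j] show ?case
      by (auto simp: newton_fps_Cons_Suc)
  qed
  have "(-1) ^ length us * prod_list us \<in> R"
    using r[of "length us"] top[of "length us"] by simp
  then show ?thesis using minus[of "- prod_list us"] by (cases "even (length us)") auto
qed

lemma prod_list_minpoly_roots:
  fixes g :: "complex poly"
  assumes "lead_coeff g = 1"
  obtains \<rho>s where "g = (\<Prod>\<rho>\<leftarrow>\<rho>s. [:- \<rho>, 1:])" "length \<rho>s = degree g"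
proof -
  have "g \<noteq> 0" using assms by auto
  from alg_closed_imp_factorization[OF this] assms obtain A where
    A: "size A = degree g" "g = (\<Prod>x\<in>#A. [:-x, 1:])" by auto
  obtain xs where "mset xs = A" using ex_mset by blast
  then show ?thesis using that[of xs] A by (metis mset_map prod_mset_prod_list size_mset)
qed

context complex_subfield
begin

text \<open>Newton's identities in the other direction: the term \<open>i = 0\<close> has
  coefficient 1, so each power sum is solved for in terms of earlier ones and of coefficients of the
  polynomial.\<close>

lemma power_sums_closed:
  assumes g: "(\<Prod>\<rho>\<leftarrow>\<rho>s. [:- \<rho>, 1:]) \<in> poly_over F"
  shows "(\<Sum>\<rho>\<leftarrow>\<rho>s. \<rho> ^ k) \<in> F"
proof (induction k rule: less_induct)
  case (less k)
  have r: "newton_fps \<rho>s $ k \<in> F" for k using g by (auto simp: newton_fps_nth poly_over_def)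
  show ?case
  proof (cases k)
    case 0
    then show ?thesis by (simp add: sum_list_triv)
  next
    case (Suc j)
    let ?s = "\<Sum>\<rho>\<leftarrow>\<rho>s. \<rho> ^ Suc j"
      and ?T = "\<Sum>i<j. newton_fps \<rho>s $ Suc i * (\<Sum>\<rho>\<leftarrow>\<rho>s. \<rho> ^ Suc (j - Suc i))"
    have e: "(\<Sum>i\<le>j. newton_fps \<rho>s $ i * (\<Sum>\<rho>\<leftarrow>\<rho>s. \<rho> ^ Suc (j - i))) = ?s + ?T"
      by (simp add: newton_fps_0 sum.atMost_shift)
    have "of_nat (Suc j) * newton_fps \<rho>s $ Suc j = - (?s + ?T)"
      unfolding newton_identity e ..
    then have "?s = - (of_nat (Suc j) * newton_fps \<rho>s $ Suc j) - ?T"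
      by (simp only: minus_minus add_diff_cancel_right')
    also have "\<dots> \<in> F"
      using less Suc r by (intro diff_closed minus_closed sum_closed mult_closed of_nat_closed)
        (auto simp del: power_Suc)
    finally show ?thesis using Suc by simp
  qed
qed

lemma poly_sum_roots_closed:
  assumes g: "(\<Prod>\<rho>\<leftarrow>\<rho>s. [:- \<rho>, 1:]) \<in> poly_over F" and h: "h \<in> poly_over F"
  shows "(\<Sum>\<rho>\<leftarrow>\<rho>s. poly h \<rho>) \<in> F"
proof -
  have "(\<Sum>\<rho>\<leftarrow>\<rho>s. poly h \<rho>) = (\<Sum>i\<le>degree h. coeff h i * (\<Sum>\<rho>\<leftarrow>\<rho>s. \<rho> ^ i))"
    by (induction \<rho>s) (simp_all add: poly_altdef sum.distrib algebra_simps)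
  then show ?thesis using h power_sums_closed[OF g] by (auto simp: poly_over_def intro!: sum_closed)
qed

text \<open>Descent without Galois groups. The coefficients of a power sum of the polynomials
  \<open>w \<rho>\<close> are sums of \<open>h(\<rho>)\<close> over all roots, hence lie in
  \<open>F\<close>; Newton's identities over the polynomial ring then carry this over to the
  product.\<close>

lemma conjugate_product_closed:
  assumes g: "(\<Prod>\<rho>\<leftarrow>\<rho>s. [:- \<rho>, 1:]) \<in> poly_over F"
    and w: "\<And>i. \<exists>h\<in>poly_over F. \<forall>x. coeff (w x) i = poly h x"
  shows "(\<Prod>\<rho>\<leftarrow>\<rho>s. w \<rho>) \<in> poly_over F"
proof (rule prod_list_in_by_power_sums)
  have pw: "\<exists>h\<in>poly_over F. \<forall>x. coeff (w x ^ k) i = poly h x" for k i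
  proof (induction k arbitrary: i)
    case 0
    show ?case by (rule bexI[of _ "if i = 0 then 1 else 0"]) (auto simp: coeff_1)
  next
    case (Suc k)
    from w obtain a where a: "\<And>i. a i \<in> poly_over F" "\<And>i x. coeff (w x) i = poly (a i) x" by metis
    from Suc obtain b where b: "\<And>i. b i \<in> poly_over F" "\<And>i x. coeff (w x ^ k) i = poly (b i) x" by metis
    have "(\<Sum>j\<le>i. a j * b (i - j)) \<in> poly_over F"
      using a b by (induction "{..i}" rule: infinite_finite_induct)
        (auto simp: poly_over_def coeff_sum coeff_mult intro!: sum_closed mult_closed)
    then show ?case using a b by (intro bexI[of _ "\<Sum>j\<le>i. a j * b (i - j)"])
        (auto simp: coeff_mult poly_sum)
  qed
  fix k
  show "(\<Sum>u\<leftarrow>map w \<rho>s. u ^ Suc k) \<in> poly_over F"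
    unfolding poly_over_def
  proof (intro CollectI allI)
    fix i
    obtain h where h: "h \<in> poly_over F" "\<And>x. coeff (w x ^ Suc k) i = poly h x" using pw by metis
    have "coeff (\<Sum>u\<leftarrow>map w \<rho>s. u ^ Suc k) i = (\<Sum>\<rho>\<leftarrow>\<rho>s. poly h \<rho>)"
      unfolding h(2)[symmetric] by (induction \<rho>s) simp_all
    then show "coeff (\<Sum>u\<leftarrow>map w \<rho>s. u ^ Suc k) i \<in> F"
      using poly_sum_roots_closed[OF g h(1)] by simp
  qed
  fix p :: "complex poly"
  assume p: "of_nat (Suc k) * p \<in> poly_over F"
  have "coeff p i \<in> F" for i
  proof -
    have "of_nat (Suc k) * coeff p i \<in> F"
      using p by (simp add: poly_over_def of_nat_poly del: of_nat_Suc)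
    then have "of_nat (Suc k) * coeff p i / of_nat (Suc k) \<in> F" by (rule divide_closed) blast
    then show ?thesis by (simp del: of_nat_Suc)
  qed
  then show "p \<in> poly_over F" by (simp add: poly_over_def)
qed auto

end

section \<open>Relative norms of solutions of Pell equations\<close>

text \<open>Computing modulo \<open>X\<^sup>2 - d\<close> replaces the adjunction of a square root
  of \<open>d\<close>, and makes no distinction whether \<open>d\<close> is a square in
  \<open>F\<close>.\<close>

lemma poly_mod_quadratic:
  assumes "complex_subfield F" "d \<in> F" "p \<in> poly_over F"
  shows "\<exists>A\<in>F. \<exists>B\<in>F. \<exists>H. p = [:A, B:] + [:- d, 0, 1:] * H"
  using assms(3)
proof (induction p)
  case 0
  interpret complex_subfield F by fact
  show ?case by (intro bexI[of _ 0] exI[of _ 0]) auto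
next
  case (pCons a p)
  interpret complex_subfield F by fact
  have a: "a \<in> F" "p \<in> poly_over F" using pCons.prems by (simp_all add: poly_over_pCons)
  then obtain A B H where AB: "A \<in> F" "B \<in> F" "p = [:A, B:] + [:- d, 0, 1:] * H"
    using pCons.IH by blast
  have "pCons a p = [:a + d * B, A:] + [:- d, 0, 1:] * (pCons B H)"
    unfolding AB(3) by (simp add: poly_eq_poly_eq_iff[symmetric] fun_eq_iff algebra_simps)
  moreover have "a + d * B \<in> F" using a AB assms by auto
  ultimately show ?case using AB by blast
qed

text \<open>Brahmagupta's identity. Since \<open>m\<close> divides \<open>d\<close>, the term
  \<open>d * (B * Y)\<close> disappears modulo \<open>m\<close>: the first components multiply and
  the second ones add. Divisibility by \<open>m\<close> is expressed by the quotient being an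
  algebraic integer.\<close>

lemma pell_congruence_mult:
  fixes A B X Y d m y z :: complex
  assumes "m \<noteq> 0" "algebraic_int m" "algebraic_int (d / m)" "algebraic_int y" "algebraic_int z"
    and "A\<^sup>2 - d * B\<^sup>2 = 1" "algebraic_int ((A - 1) / m)" "algebraic_int ((B - y) / m)"
    and "X\<^sup>2 - d * Y\<^sup>2 = 1" "algebraic_int ((X - 1) / m)" "algebraic_int ((Y - z) / m)"
  shows "(A * X + d * (B * Y))\<^sup>2 - d * (A * Y + B * X)\<^sup>2 = 1"
    and "algebraic_int ((A * X + d * (B * Y) - 1) / m)"
    and "algebraic_int ((A * Y + B * X - (y + z)) / m)"
proof -
  define a b x w where "a = (A - 1) / m" and "b = (B - y) / m" and "x = (X - 1) / m" and "w = (Y - z) / m"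
  have e: "A = 1 + m * a" "B = y + m * b" "X = 1 + m * x" "Y = z + m * w"
    using assms(1) by (simp_all add: a_def b_def x_def w_def)
  have i: "algebraic_int a" "algebraic_int b" "algebraic_int x" "algebraic_int w"
    using assms by (simp_all add: a_def b_def x_def w_def)
  have "(A * X + d * (B * Y))\<^sup>2 - d * (A * Y + B * X)\<^sup>2 = (A\<^sup>2 - d * B\<^sup>2) * (X\<^sup>2 - d * Y\<^sup>2)"
    by (simp add: power2_eq_square algebra_simps)
  then show "(A * X + d * (B * Y))\<^sup>2 - d * (A * Y + B * X)\<^sup>2 = 1" using assms by simp
  have BY: "algebraic_int B" "algebraic_int Y"
    using i assms unfolding e by (auto intro!: algebraic_int_add algebraic_int_mult)
  have "(A * X + d * (B * Y) - 1) / m = a + x + m * a * x + (d / m) * (B * Y)"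
    using assms(1) unfolding e(1,3) by (simp add: field_simps)
  moreover have "algebraic_int (a + x + m * a * x + (d / m) * (B * Y))"
    by (intro algebraic_int_add algebraic_int_mult i BY assms)
  ultimately show "algebraic_int ((A * X + d * (B * Y) - 1) / m)" by (simp only:)
  have "(A * Y + B * X - (y + z)) / m = w + b + a * Y + x * B"
    using assms(1) unfolding e by (simp add: field_simps)
  then show "algebraic_int ((A * Y + B * X - (y + z)) / m)"
    using i BY assms by (auto intro!: algebraic_int_add algebraic_int_mult)
qed

text \<open>\<open>[:X, Y:]\<close> is \<open>X + Y T\<close> with \<open>T\<close> in place of
  \<surd>d, and \<open>H\<close> is the quotient discarded on reduction modulo
  \<open>T\<^sup>2 - d\<close>.\<close>

lemma pell_product:
  fixes d m y :: complex
  assumes m: "m \<noteq> 0" "algebraic_int m" "algebraic_int (d / m)" "algebraic_int y"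
    and p: "\<And>x. x \<in> set xs \<Longrightarrow> (X x)\<^sup>2 - d * (Y x)\<^sup>2 = 1 \<and> algebraic_int ((X x - 1) / m) \<and>
      algebraic_int ((Y x - y) / m)"
  shows "\<exists>A B H. (\<Prod>x\<leftarrow>xs. [:X x, Y x:]) = [:A, B:] + [:- d, 0, 1:] * H \<and> A\<^sup>2 - d * B\<^sup>2 = 1 \<and>
    algebraic_int ((A - 1) / m) \<and> algebraic_int ((B - of_nat (length xs) * y) / m)"
  using p
proof (induction xs)
  case Nil
  then show ?case by (intro exI[of _ 1] exI[of _ 0]) auto
next
  case (Cons x xs)
  then obtain A B H where AB: "(\<Prod>x\<leftarrow>xs. [:X x, Y x:]) = [:A, B:] + [:- d, 0, 1:] * H"
    "A\<^sup>2 - d * B\<^sup>2 = 1" "algebraic_int ((A - 1) / m)" "algebraic_int ((B - of_nat (length xs) * y) / m)"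
    by auto
  have x: "(X x)\<^sup>2 - d * (Y x)\<^sup>2 = 1" "algebraic_int ((X x - 1) / m)" "algebraic_int ((Y x - y) / m)"
    using Cons.prems[of x] by auto
  have ly: "algebraic_int (of_nat (length xs) * y)" using m by (intro algebraic_int_mult) auto
  note * = pell_congruence_mult[OF m(1,2,3) ly m(4) AB(2,3,4) x]
  have "(\<Prod>x\<leftarrow>x # xs. [:X x, Y x:]) = [:X x, Y x:] * ([:A, B:] + [:- d, 0, 1:] * H)"
    by (simp add: AB(1) del: mult_pCons_left)
  also have "\<dots> = [:A * X x + d * (B * Y x), A * Y x + B * X x:] +
      [:- d, 0, 1:] * ([:X x, Y x:] * H + [:B * Y x:])"
    by (simp add: poly_eq_poly_eq_iff[symmetric] fun_eq_iff algebra_simps)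
  finally have e: "(\<Prod>x\<leftarrow>x # xs. [:X x, Y x:]) =
      [:A * X x + d * (B * Y x), A * Y x + B * X x:] + [:- d, 0, 1:] * ([:X x, Y x:] * H + [:B * Y x:])" .
  have l: "of_nat (length (x # xs)) * y = of_nat (length xs) * y + y" by (simp add: algebra_simps)
  show ?case unfolding l using e * by blast
qed

text \<open>All that is used of the relative norm from \<open>G\<close> to \<open>F\<close>, with
  \<open>c\<close> in the role of the degree. It is stated for all \<open>d\<close>,
  \<open>y\<close> and \<open>m\<close>, so that it composes along towers: the residue
  \<open>y\<close> of one step becomes a multiple of itself in the next.\<close>

definition pell_norm :: "nat \<Rightarrow> complex set \<Rightarrow> complex set \<Rightarrow> bool" where
  "pell_norm c F G \<longleftrightarrow> (\<forall>d y m X Y. d \<in> F \<longrightarrow> y \<in> F \<longrightarrow> m \<in> F \<longrightarrow> m \<noteq> 0 \<longrightarrow> algebraic_int m \<longrightarrow>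
     algebraic_int (d / m) \<longrightarrow> algebraic_int y \<longrightarrow> X \<in> G \<longrightarrow> Y \<in> G \<longrightarrow> X\<^sup>2 - d * Y\<^sup>2 = 1 \<longrightarrow>
     algebraic_int ((X - 1) / m) \<longrightarrow> algebraic_int ((Y - y) / m) \<longrightarrow>
     (\<exists>A\<in>F. \<exists>B\<in>F. A\<^sup>2 - d * B\<^sup>2 = 1 \<and> algebraic_int ((A - 1) / m) \<and>
        algebraic_int ((B - of_nat c * y) / m)))"

lemma pell_norm_refl: "pell_norm 1 F F"
  unfolding pell_norm_def by auto

lemma pell_norm_trans:
  assumes "pell_norm a F G" "pell_norm b G H" "F \<subseteq> G" "complex_subfield F"
  shows "pell_norm (b * a) F H"
  unfolding pell_norm_def
proof (intro allI impI)
  interpret complex_subfield F by fact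
  fix d y m X Y
  assume h: "d \<in> F" "y \<in> F" "m \<in> F" "m \<noteq> 0" "algebraic_int m" "algebraic_int (d / m)"
    "algebraic_int y" "X \<in> H" "Y \<in> H" "X\<^sup>2 - d * Y\<^sup>2 = 1" "algebraic_int ((X - 1) / m)"
    "algebraic_int ((Y - y) / m)"
  then obtain A B where AB: "A \<in> G" "B \<in> G" "A\<^sup>2 - d * B\<^sup>2 = 1" "algebraic_int ((A - 1) / m)"
    "algebraic_int ((B - of_nat b * y) / m)"
    using assms(2)[unfolded pell_norm_def, rule_format, of d y m X Y] assms(3) by blast
  have "of_nat b * y \<in> F" "algebraic_int (of_nat b * y)" using h by (auto intro: algebraic_int_mult)
  then have "\<exists>A'\<in>F. \<exists>B'\<in>F. A'\<^sup>2 - d * B'\<^sup>2 = 1 \<and> algebraic_int ((A' - 1) / m) \<and>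
        algebraic_int ((B' - of_nat a * (of_nat b * y)) / m)"
    using assms(1)[unfolded pell_norm_def, rule_format, of d "of_nat b * y" m A B] h AB by blast
  then show "\<exists>A'\<in>F. \<exists>B'\<in>F. A'\<^sup>2 - d * B'\<^sup>2 = 1 \<and> algebraic_int ((A' - 1) / m) \<and>
        algebraic_int ((B' - of_nat (b * a) * y) / m)" by (simp add: mult_ac)
qed

text \<open>The norm is the product of \<open>X + Y T\<close> over all conjugates. It is reduced
  modulo \<open>T\<^sup>2 - d\<close> in two ways: one keeps track of the congruences, the other of
  the field of coefficients.\<close>

lemma (in complex_subfield) pell_norm_adjoin:
  assumes g: "is_minpoly F \<theta> g"
  shows "pell_norm (degree g) F (adjoin F \<theta>)"
  unfolding pell_norm_def
proof (intro allI impI)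
  fix d y m X Y
  assume h: "d \<in> F" "y \<in> F" "m \<in> F" "m \<noteq> 0" "algebraic_int m" "algebraic_int (d / m)"
    "algebraic_int y" "X \<in> adjoin F \<theta>" "Y \<in> adjoin F \<theta>" "X\<^sup>2 - d * Y\<^sup>2 = 1"
    "algebraic_int ((X - 1) / m)" "algebraic_int ((Y - y) / m)"
  obtain p where p: "p \<in> poly_over F" "X = poly p \<theta>" using h by (auto simp: adjoin_def)
  obtain q where q: "q \<in> poly_over F" "Y = poly q \<theta>" using h by (auto simp: adjoin_def)
  have gF: "g \<in> poly_over F" and lc: "lead_coeff g = 1" using g by (auto simp: is_minpoly_def)
  obtain \<rho>s where \<rho>s: "g = (\<Prod>\<rho>\<leftarrow>\<rho>s. [:- \<rho>, 1:])" "length \<rho>s = degree g"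
    using prod_list_minpoly_roots[OF lc] .
  have root: "poly g \<rho> = 0" if "\<rho> \<in> set \<rho>s" for \<rho>
    using that unfolding \<rho>s(1) by (auto simp: poly_prod_list prod_list_zero_iff image_iff)
  have conj: "(poly p \<rho>)\<^sup>2 - d * (poly q \<rho>)\<^sup>2 = 1 \<and> algebraic_int ((poly p \<rho> - 1) / m) \<and>
      algebraic_int ((poly q \<rho> - y) / m)" if \<rho>: "\<rho> \<in> set \<rho>s" for \<rho>
  proof (intro conjI)
    have "poly (p\<^sup>2 - [:d:] * q\<^sup>2 - 1) \<rho> = 0"
      using p q h by (intro minpoly_root_transfer[OF g _ _ root[OF \<rho>]])
        (auto simp: poly_over_pCons)
    then show "(poly p \<rho>)\<^sup>2 - d * (poly q \<rho>)\<^sup>2 = 1" by simp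
    have "algebraic_int (poly (Polynomial.smult (1 / m) (p - 1)) \<rho>)"
      using p h by (intro minpoly_algebraic_int_transfer[OF g _ _ root[OF \<rho>]]) auto
    then show "algebraic_int ((poly p \<rho> - 1) / m)" by simp
    have "algebraic_int (poly (Polynomial.smult (1 / m) (q - [:y:])) \<rho>)"
      using q h by (intro minpoly_algebraic_int_transfer[OF g _ _ root[OF \<rho>]])
        (auto simp: poly_over_pCons intro!: poly_over_smult poly_over_diff divide_closed)
    then show "algebraic_int ((poly q \<rho> - y) / m)" by simp
  qed
  let ?N = "\<Prod>\<rho>\<leftarrow>\<rho>s. [:poly p \<rho>, poly q \<rho>:]"
  obtain A B H where AB: "?N = [:A, B:] + [:- d, 0, 1:] * H" "A\<^sup>2 - d * B\<^sup>2 = 1"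
    "algebraic_int ((A - 1) / m)" "algebraic_int ((B - of_nat (length \<rho>s) * y) / m)"
    using pell_product[of m d y \<rho>s "poly p" "poly q"] h conj by blast
  have "?N \<in> poly_over F"
  proof (rule conjugate_product_closed)
    show "(\<Prod>\<rho>\<leftarrow>\<rho>s. [:- \<rho>, 1:]) \<in> poly_over F" using gF \<rho>s by simp
    fix i
    show "\<exists>h\<in>poly_over F. \<forall>x. coeff [:poly p x, poly q x:] i = poly h x"
      using p q by (intro bexI[of _ "if i = 0 then p else if i = 1 then q else 0"])
        (auto simp: coeff_pCons split: nat.splits)
  qed
  then obtain A' B' H' where A'B': "A' \<in> F" "B' \<in> F" "?N = [:A', B':] + [:- d, 0, 1:] * H'"
    using poly_mod_quadratic[OF complex_subfield_axioms h(1)] by blast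
  have "v - u = r - s" if "r + u = s + v" for r s u v :: "complex poly"
    using that by (simp add: algebra_simps)
  from this[OF trans[OF AB(1)[symmetric] A'B'(3)]]
  have eq: "[:- d, 0, 1:] * (H' - H) = [:A - A', B - B':]"
    by (simp only: right_diff_distrib) simp
  \<comment> \<open>A nonzero multiple of the quadratic has degree at least 2, but the two
    remainders differ by a polynomial of degree at most 1. So they agree, and \<open>A\<close> and
    \<open>B\<close> lie in \<open>F\<close>.\<close>
  have "H' - H = 0"
  proof (rule ccontr)
    assume ne: "H' - H \<noteq> 0"
    have "degree ([:- d, 0, 1:] * (H' - H)) = 2 + degree (H' - H)"
      using ne by (subst degree_mult_eq) auto
    moreover have "degree [:A - A', B - B':] \<le> 1" by simp
    ultimately show False using eq by simp
  qed
  then have "A = A'" "B = B'" using eq by auto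
  then show "\<exists>A\<in>F. \<exists>B\<in>F. A\<^sup>2 - d * B\<^sup>2 = 1 \<and> algebraic_int ((A - 1) / m) \<and>
        algebraic_int ((B - of_nat (degree g) * y) / m)"
    using A'B' AB \<rho>s(2) by (intro bexI[of _ A] bexI[of _ B]) auto
qed

text \<open>Elements are adjoined one at a time; the factor of the norm congruence and the degree
  are both multiplied by the degree of each minimal polynomial, so \<open>c\<close> is the relative
  degree.\<close>

lemma pell_norm_extension:
  assumes K: "field_of_algebraic_numbers K" and F: "number_field F" "F \<subseteq> K" and xs: "set xs \<subseteq> K"
  shows "\<exists>G c. number_field G \<and> F \<subseteq> G \<and> G \<subseteq> K \<and> set xs \<subseteq> G \<and> pell_norm c F G \<and>
    degree_over_rat G = c * degree_over_rat F"
  using xs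
proof (induction xs)
  case Nil
  then show ?case using F pell_norm_refl by (intro exI[of _ F] exI[of _ 1]) auto
next
  case (Cons x xs)
  then obtain G c where G: "number_field G" "F \<subseteq> G" "G \<subseteq> K" "set xs \<subseteq> G" "pell_norm c F G"
    "degree_over_rat G = c * degree_over_rat F" by auto
  interpret G: complex_subfield G by (rule number_field_subfield[OF G(1)])
  have sub: "adjoin G x \<subseteq> K"
    using K G Cons.prems by (intro G.adjoin_subset) (auto simp: field_of_algebraic_numbers_def)
  have alg: "algebraic z" if "z \<in> adjoin G x" for z
    using sub that K by (auto simp: field_of_algebraic_numbers_def)
  obtain g where g: "is_minpoly G x g"
    using G.is_minpoly_exists[OF alg[OF G.generator_in_adjoin]] by blast
  have "pell_norm (degree g * c) F (adjoin G x)"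
    using pell_norm_trans[OF G(5) G.pell_norm_adjoin[OF g] G(2) number_field_subfield[OF F(1)]] .
  then show ?case
    using number_field_adjoin[OF G(1) g alg] G sub G.subset_adjoin[of x] G.generator_in_adjoin[of x]
    by (intro exI[of _ "adjoin G x"] exI[of _ "degree g * c"]) auto
qed

section \<open>Multiplicative dependence of Pell units\<close>

text \<open>Pigeonhole: there are \<open>(M + 1) ^ n\<close> exponent vectors with entries up to
  \<open>M\<close>, but only about \<open>M ^ (n - 1)\<close> possible vectors of integer parts of
  the fewer than \<open>n\<close> linear forms. Extensional functions make distinct vectors differ
  below \<open>n\<close>.\<close>

lemma small_combinations:
  fixes lam :: "nat \<Rightarrow> 'i \<Rightarrow> real"
  assumes I: "finite I" "card I < n"
  shows "\<exists>E \<subseteq> {..<n} \<rightarrow>\<^sub>E UNIV. finite E \<and> card E > W \<and>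
    (\<forall>e\<in>E. \<forall>e'\<in>E. \<forall>i\<in>I. \<bar>\<Sum>k<n. (real (e k) - real (e' k)) * lam k i\<bar> \<le> 1)"
proof -
  obtain L :: nat where L: "\<And>k i. k < n \<Longrightarrow> i \<in> I \<Longrightarrow> \<bar>lam k i\<bar> \<le> real L"
  proof -
    obtain x where x: "\<forall>z\<in>(\<lambda>(k, i). \<bar>lam k i\<bar>) ` ({..<n} \<times> I). z \<le> x"
      using bdd_above_finite[of "(\<lambda>(k, i). \<bar>lam k i\<bar>) ` ({..<n} \<times> I)"] I
      unfolding bdd_above_def by auto
    show ?thesis
    proof (rule that[of "nat \<lceil>x\<rceil>"])
      fix k i assume "k < n" "i \<in> I"
      then have "\<bar>lam k i\<bar> \<le> x" using x by auto
      then show "\<bar>lam k i\<bar> \<le> real (nat \<lceil>x\<rceil>)" by (meson of_nat_ceiling order_trans)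
    qed
  qed
  \<comment> \<open>Chosen so that \<open>W\<close> times the number of boxes is at most
    \<open>M * (M + 1) ^ (n - 1)\<close>, just less than the number of vectors.\<close>
  define M where "M = W * (2 * n * L + 1) ^ (n - 1)"
  define N where "N = int (n * L * M)"
  define A where "A = {..<n} \<rightarrow>\<^sub>E {..M}"
  define B where "B = I \<rightarrow>\<^sub>E {-N..N}"
  define S where "S e i = (\<Sum>k<n. real (e k) * lam k i)" for e i
  define f where "f e = (\<lambda>i\<in>I. \<lfloor>S e i\<rfloor>)" for e
  have cA: "card A = (M + 1) ^ n" by (simp add: A_def card_funcsetE)
  have cB: "card B = (2 * n * L * M + 1) ^ card I"
  proof -
    have "card {-N..N} = 2 * n * L * M + 1" by (simp add: N_def nat_eq_iff algebra_simps)
    then show ?thesis using I by (simp add: B_def card_funcsetE)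
  qed
  have "finite A" "finite B" using I by (auto simp: A_def B_def intro!: finite_PiE)
  moreover have "f \<in> A \<rightarrow> B"
  proof
    fix e assume e: "e \<in> A"
    show "f e \<in> B" unfolding B_def f_def
    proof (rule restrict_PiE_iff[THEN iffD2], rule ballI)
      fix i assume i: "i \<in> I"
      have "\<bar>S e i\<bar> \<le> (\<Sum>k<n. \<bar>real (e k) * lam k i\<bar>)" unfolding S_def by (rule sum_abs)
      also have "\<dots> \<le> (\<Sum>k<n. real M * real L)"
        using e i L by (intro sum_mono) (auto simp: A_def abs_mult PiE_def Pi_def intro!: mult_mono)
      also have "\<dots> = of_int N" by (simp add: N_def)
      finally show "\<lfloor>S e i\<rfloor> \<in> {-N..N}" by (auto simp: le_floor_iff floor_le_iff)
    qed
  qed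
  moreover have "B \<noteq> {}" by (auto simp: B_def PiE_eq_empty_iff N_def)
  ultimately obtain y where y: "card (f -` {y} \<inter> A) * card B \<ge> card A"
    using pigeonhole_card[of f A B] by blast
  define E where "E = f -` {y} \<inter> A"
  have "card E > W"
  proof (rule ccontr)
    assume "\<not> card E > W"
    then have "card E * card B \<le> W * card B" by (intro mult_le_mono1) simp
    with y have "(M + 1) ^ n \<le> W * (2 * n * L * M + 1) ^ card I"
      unfolding E_def[symmetric] cA cB by (rule order_trans)
    also have "\<dots> \<le> W * (2 * n * L * M + 1) ^ (n - 1)"
      using I by (intro mult_le_mono2 power_increasing) auto
    also have "\<dots> \<le> W * ((2 * n * L + 1) * (M + 1)) ^ (n - 1)"
      by (intro mult_le_mono2 power_mono) (auto simp: algebra_simps)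
    also have "\<dots> = M * (M + 1) ^ (n - 1)"
      unfolding power_mult_distrib by (simp add: M_def mult.assoc)
    also have "\<dots> < (M + 1) * (M + 1) ^ (n - 1)" by simp
    also have "\<dots> = (M + 1) ^ n" using I by (cases n) auto
    finally show False by simp
  qed
  moreover have "finite E" using \<open>finite A\<close> by (simp add: E_def)
  moreover have "\<bar>\<Sum>k<n. (real (e k) - real (e' k)) * lam k i\<bar> \<le> 1"
    if "e \<in> E" "e' \<in> E" "i \<in> I" for e e' i
  proof -
    have "f e i = f e' i" using that by (simp add: E_def)
    then have "\<lfloor>S e i\<rfloor> = \<lfloor>S e' i\<rfloor>" using that by (simp add: f_def)
    then have "\<bar>S e i - S e' i\<bar> \<le> 1" by linarith
    then show ?thesis by (simp add: S_def sum_subtractf left_diff_distrib)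
  qed
  moreover have "E \<subseteq> {..<n} \<rightarrow>\<^sub>E UNIV" by (auto simp: E_def A_def)
  ultimately show ?thesis by blast
qed

lemma norm_prod_power_int:
  fixes P :: "nat \<Rightarrow> complex"
  assumes "\<And>k. k < n \<Longrightarrow> P k \<noteq> 0"
  shows "cmod (\<Prod>k<n. P k powi z k) = exp (\<Sum>k<n. of_int (z k) * ln (cmod (P k)))"
proof -
  have "cmod (P k powi z k) = exp (of_int (z k) * ln (cmod (P k)))" if "k < n" for k
    using assms[OF that] powr_real_of_int'[of "cmod (P k)" "z k"]
    by (simp add: norm_power_int powr_def)
  then show ?thesis by (simp add: prod_norm[symmetric] exp_sum)
qed

section \<open>Finiteness of algebraic integers with bounded conjugates\<close>

lemma coeff_prod_linear_bound:
  fixes us :: "complex list"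
  assumes "\<And>u. u \<in> set us \<Longrightarrow> cmod u \<le> C" "0 \<le> C"
  shows "cmod (coeff (\<Prod>u\<leftarrow>us. [:- u, 1:]) i) \<le> (1 + C) ^ length us"
  using assms(1)
proof (induction us arbitrary: i)
  case Nil
  then show ?case by (simp add: coeff_1)
next
  case (Cons u us)
  let ?q = "\<Prod>u\<leftarrow>us. [:- u, 1:]"
  have e: "(\<Prod>u\<leftarrow>u # us. [:- u, 1:]) = Polynomial.smult (- u) ?q + pCons 0 ?q" by simp
  have q: "cmod (coeff ?q j) \<le> (1 + C) ^ length us" for j using Cons by simp
  have c: "coeff (\<Prod>u\<leftarrow>u # us. [:- u, 1:]) i = - u * coeff ?q i + coeff (pCons 0 ?q) i"
    unfolding e by simp
  have "cmod (coeff (\<Prod>u\<leftarrow>u # us. [:- u, 1:]) i) \<le> cmod (u * coeff ?q i) + cmod (coeff (pCons 0 ?q) i)"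
    unfolding c by (rule order_trans[OF norm_triangle_ineq]) simp
  also have "\<dots> \<le> C * (1 + C) ^ length us + (1 + C) ^ length us"
    using Cons.prems q assms(2)
    by (intro add_mono) (auto simp: norm_mult coeff_pCons intro!: mult_mono split: nat.split)
  also have "\<dots> = (1 + C) ^ length (u # us)" by (simp add: algebra_simps)
  finally show ?case .
qed

lemma finite_bounded_int_polys:
  "finite {p :: complex poly. degree p \<le> n \<and> (\<forall>i. coeff p i \<in> \<int> \<and> cmod (coeff p i) \<le> C)}"
    (is "finite ?P")
proof -
  define Y where "Y = (of_int :: int \<Rightarrow> complex) ` {-\<lceil>C\<rceil>..\<lceil>C\<rceil>}"
  have in_Y: "z \<in> Y" if z: "z \<in> \<int>" "cmod z \<le> C" for z
  proof -
    obtain j where j: "z = of_int j" using z Ints_cases by blast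
    have "\<bar>real_of_int j\<bar> \<le> C" using z j by simp
    then have "-\<lceil>C\<rceil> \<le> j \<and> j \<le> \<lceil>C\<rceil>" by linarith
    then show ?thesis using j by (auto simp: Y_def)
  qed
  let ?g = "\<lambda>p :: complex poly. map (coeff p) [0..<Suc n]"
  have "inj_on ?g ?P"
  proof (rule inj_onI)
    fix p q :: "complex poly"
    assume pq: "p \<in> ?P" "q \<in> ?P" "?g p = ?g q"
    show "p = q"
    proof (rule poly_eqI)
      fix i
      show "coeff p i = coeff q i"
      proof (cases "i \<le> n")
        case True
        then show ?thesis using pq(3) by (auto simp: list_eq_iff_nth_eq simp del: upt_Suc)
      next
        case False
        then show ?thesis using pq by (simp add: coeff_eq_0)
      qed
    qed
  qed
  moreover have "?g ` ?P \<subseteq> {xs. set xs \<subseteq> Y \<and> length xs = Suc n}" using in_Y by auto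
  then have "finite (?g ` ?P)"
    by (rule finite_subset) (intro finite_lists_length_eq, simp add: Y_def)
  ultimately show ?thesis using finite_imageD by blast
qed

lemma algebraic_int_coeff_prod:
  "(\<And>u. u \<in> set us \<Longrightarrow> algebraic_int u) \<Longrightarrow> algebraic_int (coeff (\<Prod>u\<leftarrow>us. [:- u, 1:]) i :: complex)"
proof (induction us arbitrary: i)
  case Nil
  then show ?case by (simp add: coeff_1)
next
  case (Cons u us)
  let ?q = "\<Prod>u\<leftarrow>us. [:- u, 1:]"
  have e: "(\<Prod>u\<leftarrow>u # us. [:- u, 1:]) = Polynomial.smult (- u) ?q + pCons 0 ?q" by simp
  show ?case unfolding e coeff_add coeff_smult coeff_pCons
    using Cons by (auto intro!: algebraic_int_add algebraic_int_mult algebraic_int_diff split: nat.split)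
qed

text \<open>\<open>f\<close> is the minimal polynomial of \<open>t\<close>, so its roots are the conjugates of \<open>t\<close>.\<close>

locale conjugates =
  fixes t :: complex and f :: "complex poly"
  assumes minpoly: "is_minpoly \<rat> t f"
    and algebraic_adjoin: "\<And>x. x \<in> adjoin \<rat> t \<Longrightarrow> algebraic x"
    and algebraic_int: "algebraic_int t"
begin

sublocale Q: complex_subfield \<rat> by (rule complex_subfield_Rats)

definition Z :: "complex set" where "Z = {\<rho>. poly f \<rho> = 0}"

lemma monic: "lead_coeff f = 1" and f_rat: "f \<in> poly_over \<rat>" and t_in_Z: "t \<in> Z"
  using minpoly by (auto simp: is_minpoly_def Z_def)

lemma root_transfer: "p \<in> poly_over \<rat> \<Longrightarrow> poly p t = 0 \<Longrightarrow> \<rho> \<in> Z \<Longrightarrow> poly p \<rho> = 0"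
  using Q.minpoly_root_transfer[OF minpoly] by (simp add: Z_def)

lemma nonroot_transfer: "p \<in> poly_over \<rat> \<Longrightarrow> poly p t \<noteq> 0 \<Longrightarrow> \<rho> \<in> Z \<Longrightarrow> poly p \<rho> \<noteq> 0"
  using Q.minpoly_nonroot_transfer[OF minpoly algebraic_adjoin] by (simp add: Z_def)

lemma algebraic_int_transfer:
  "p \<in> poly_over \<rat> \<Longrightarrow> algebraic_int (poly p t) \<Longrightarrow> \<rho> \<in> Z \<Longrightarrow> algebraic_int (poly p \<rho>)"
  using Q.minpoly_algebraic_int_transfer[OF minpoly] by (simp add: Z_def)

lemma conjugate_algebraic_int: "\<rho> \<in> Z \<Longrightarrow> algebraic_int \<rho>"
  using algebraic_int_transfer[of "[:0, 1:]" \<rho>] algebraic_int by (simp add: Q.poly_over_pCons)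

lemma finite_Z: "finite Z"
  unfolding Z_def using monic by (intro poly_roots_finite) auto

text \<open>The derivative of \<open>f\<close> is nonzero of smaller degree, so it vanishes neither
  at \<open>t\<close> nor at any conjugate: all roots are simple.\<close>

lemma f_eq_prod: "f = (\<Prod>\<rho>\<in>Z. [:- \<rho>, 1:])"
proof -
  have "pderiv f \<in> poly_over \<rat>" using f_rat by auto
  moreover have "pderiv f \<noteq> 0" "degree (pderiv f) < degree f"
    using Q.is_minpoly_degree_pos[OF minpoly] by (auto simp: pderiv_eq_0_iff degree_pderiv)
  ultimately have "poly (pderiv f) t \<noteq> 0" using minpoly by (auto simp: is_minpoly_def)
  then have "rsquarefree f"
    using nonroot_transfer[of "pderiv f"] f_rat by (auto simp: rsquarefree_roots Z_def)
  from complex_poly_decompose_rsquarefree[OF this] monic show ?thesis by (simp add: Z_def)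
qed

lemma card_Z: "card Z = degree f"
proof -
  have "degree (\<Prod>\<rho>\<in>Z. [:- \<rho>, 1:]) = card Z" by (subst degree_prod_sum_eq) auto
  from trans[OF arg_cong[OF f_eq_prod, of degree] this] show ?thesis by (rule sym)
qed

text \<open>Northcott's argument: such a value is a root of its characteristic polynomial, whose
  coefficients are rational algebraic integers, hence integers, and are bounded in terms of
  \<open>C\<close>.\<close>

lemma finite_bounded_values:
  "finite {x. \<exists>h\<in>poly_over \<rat>. x = poly h t \<and> algebraic_int (poly h t) \<and> (\<forall>\<rho>\<in>Z. cmod (poly h \<rho>) \<le> C)}"
    (is "finite ?X")
proof (cases "C \<ge> 0")
  case False
  have "?X = {}"
  proof -
    have "\<not> cmod (poly h t) \<le> C" for h using False by (smt (verit) norm_ge_zero)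
    then show ?thesis using t_in_Z by auto
  qed
  then show ?thesis by (metis finite.emptyI)
next
  case True
  define D where "D = (1 + C) ^ degree f"
  define PP where "PP = {p :: complex poly. degree p \<le> degree f \<and> (\<forall>i. coeff p i \<in> \<int> \<and> cmod (coeff p i) \<le> D)}"
  obtain \<rho>s where \<rho>s: "set \<rho>s = Z" "distinct \<rho>s" using finite_distinct_list[OF finite_Z] by blast
  have len: "length \<rho>s = degree f" using \<rho>s card_Z distinct_card by metis
  have f_list: "f = (\<Prod>\<rho>\<leftarrow>\<rho>s. [:- \<rho>, 1:])"
    using f_eq_prod \<rho>s by (simp add: prod.distinct_set_conv_list[symmetric])
  have "?X \<subseteq> (\<Union>p\<in>PP - {0}. {x. poly p x = 0})"
  proof
    fix x assume "x \<in> ?X"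
    then obtain h where h: "h \<in> poly_over \<rat>" "x = poly h t" "algebraic_int (poly h t)"
      "\<forall>\<rho>\<in>Z. cmod (poly h \<rho>) \<le> C" by auto
    define us where "us = map (poly h) \<rho>s"
    \<comment> \<open>The characteristic polynomial of \<open>poly h t\<close>; its roots may repeat
      if this value generates a smaller field.\<close>
    define G where "G = (\<Prod>u\<leftarrow>us. [:- u, 1:])"
    have "G = (\<Prod>\<rho>\<leftarrow>\<rho>s. [:- poly h \<rho>, 1:])" by (simp add: G_def us_def comp_def)
    also have "\<dots> \<in> poly_over \<rat>"
    proof (rule Q.conjugate_product_closed)
      show "(\<Prod>\<rho>\<leftarrow>\<rho>s. [:- \<rho>, 1:]) \<in> poly_over \<rat>" using f_rat f_list by simp
      fix i
      show "\<exists>p\<in>poly_over \<rat>. \<forall>x. coeff [:- poly h x, 1:] i = poly p x"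
        using h by (intro bexI[of _ "if i = 0 then - h else if i = 1 then 1 else 0"])
          (auto simp: coeff_pCons split: nat.splits)
    qed
    finally have rat: "G \<in> poly_over \<rat>" .
    have int: "coeff G i \<in> \<int>" for i
    proof (rule rational_algebraic_int_is_int)
      show "coeff G i \<in> \<rat>" using rat by (simp add: poly_over_def)
      show "algebraic_int (coeff G i)" unfolding G_def
        using algebraic_int_transfer[OF h(1,3)] \<rho>s by (intro algebraic_int_coeff_prod) (auto simp: us_def)
    qed
    have bd: "cmod (coeff G i) \<le> D" for i
      using coeff_prod_linear_bound[of us C i] h(4) \<rho>s True len by (auto simp: us_def D_def G_def)
    have G0: "G \<noteq> 0" by (auto simp: G_def prod_list_zero_iff)
    have "degree G = length us" unfolding G_def
    proof (induction us)
      case (Cons u us)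
      have "(\<Prod>u\<leftarrow>us. [:- u, 1:]) \<noteq> 0" by (auto simp: prod_list_zero_iff)
      then show ?case using Cons by (simp add: degree_mult_eq del: mult_pCons_left)
    qed simp
    then have "G \<in> PP" using int bd len by (simp add: PP_def us_def)
    moreover have "poly G x = 0"
      using h t_in_Z \<rho>s unfolding G_def us_def
      by (auto simp: poly_prod_list prod_list_zero_iff image_iff)
    ultimately show "x \<in> (\<Union>p\<in>PP - {0}. {x. poly p x = 0})" using G0 by auto
  qed
  moreover have "finite PP" unfolding PP_def by (rule finite_bounded_int_polys)
  then have "finite (\<Union>p\<in>PP - {0}. {x. poly p x = 0})"
    by (intro finite_UN_I) (auto intro: poly_roots_finite)
  ultimately show ?thesis by (rule finite_subset)
qed

end

text \<open>\<open>s\<close> picks a square root of \<open>d\<close> separately at each conjugate.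
  One root per conjugate is enough, since the opposite root turns a norm one unit into its
  inverse.\<close>

locale pell_conjugates = conjugates +
  fixes m :: nat and d :: "complex poly" and s :: "complex \<Rightarrow> complex"
  assumes m_pos: "m > 0"
    and d_rat: "d \<in> poly_over \<rat>"
    and d_nonzero: "poly d t \<noteq> 0"
    and d_dvd: "algebraic_int (poly d t / of_nat m)"
    and s: "\<And>\<rho>. \<rho> \<in> Z \<Longrightarrow> (s \<rho>)\<^sup>2 = poly d \<rho>"
begin

text \<open>
  \<open>P\<close> is the function of the conjugates of one unit \<open>A + B \<surd>d\<close> with \<open>A \<equiv> 1\<close> and \<open>B \<equiv> y\<close> modulo \<open>m\<close>.
\<close>

definition pell_unit :: "(complex \<Rightarrow> complex) \<Rightarrow> (complex \<Rightarrow> complex) \<Rightarrow> bool" where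
  "pell_unit P y \<longleftrightarrow> (\<forall>\<rho>\<in>Z. algebraic_int (y \<rho>)) \<and> (\<exists>A\<in>poly_over \<rat>. \<exists>B\<in>poly_over \<rat>. \<forall>\<rho>\<in>Z.
     P \<rho> = poly A \<rho> + poly B \<rho> * s \<rho> \<and> (poly A \<rho>)\<^sup>2 - poly d \<rho> * (poly B \<rho>)\<^sup>2 = 1 \<and>
     algebraic_int ((poly A \<rho> - 1) / of_nat m) \<and> algebraic_int ((poly B \<rho> - y \<rho>) / of_nat m))"

lemma d_conj: assumes "\<rho> \<in> Z" shows "poly d \<rho> \<noteq> 0" "algebraic_int (poly d \<rho> / of_nat m)"
proof -
  show "poly d \<rho> \<noteq> 0" by (rule nonroot_transfer[OF d_rat d_nonzero assms])
  have "algebraic_int (poly (Polynomial.smult (1 / of_nat m) d) \<rho>)"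
  proof (rule algebraic_int_transfer[OF _ _ assms])
    show "Polynomial.smult (1 / of_nat m) d \<in> poly_over \<rat>"
      by (intro Q.poly_over_smult d_rat Q.divide_closed Q.one_closed Q.of_nat_closed)
    show "algebraic_int (poly (Polynomial.smult (1 / of_nat m) d) t)" using d_dvd by simp
  qed
  then show "algebraic_int (poly d \<rho> / of_nat m)" by simp
qed

lemma pell_unit_mult:
  assumes "pell_unit P y" "pell_unit Q z"
  shows "pell_unit (\<lambda>\<rho>. P \<rho> * Q \<rho>) (\<lambda>\<rho>. y \<rho> + z \<rho>)"
proof -
  from assms(1) obtain A B where A: "A \<in> poly_over \<rat>" "B \<in> poly_over \<rat>"
    "\<And>\<rho>. \<rho> \<in> Z \<Longrightarrow> P \<rho> = poly A \<rho> + poly B \<rho> * s \<rho>"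
    "\<And>\<rho>. \<rho> \<in> Z \<Longrightarrow> (poly A \<rho>)\<^sup>2 - poly d \<rho> * (poly B \<rho>)\<^sup>2 = 1"
    "\<And>\<rho>. \<rho> \<in> Z \<Longrightarrow> algebraic_int ((poly A \<rho> - 1) / of_nat m)"
    "\<And>\<rho>. \<rho> \<in> Z \<Longrightarrow> algebraic_int ((poly B \<rho> - y \<rho>) / of_nat m)"
    by (auto simp: pell_unit_def)
  from assms(2) obtain X Y where X: "X \<in> poly_over \<rat>" "Y \<in> poly_over \<rat>"
    "\<And>\<rho>. \<rho> \<in> Z \<Longrightarrow> Q \<rho> = poly X \<rho> + poly Y \<rho> * s \<rho>"
    "\<And>\<rho>. \<rho> \<in> Z \<Longrightarrow> (poly X \<rho>)\<^sup>2 - poly d \<rho> * (poly Y \<rho>)\<^sup>2 = 1"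
    "\<And>\<rho>. \<rho> \<in> Z \<Longrightarrow> algebraic_int ((poly X \<rho> - 1) / of_nat m)"
    "\<And>\<rho>. \<rho> \<in> Z \<Longrightarrow> algebraic_int ((poly Y \<rho> - z \<rho>) / of_nat m)"
    by (auto simp: pell_unit_def)
  have yz: "\<And>\<rho>. \<rho> \<in> Z \<Longrightarrow> algebraic_int (y \<rho>)" "\<And>\<rho>. \<rho> \<in> Z \<Longrightarrow> algebraic_int (z \<rho>)"
    using assms by (auto simp: pell_unit_def)
  let ?A = "A * X + d * (B * Y)" and ?B = "A * Y + B * X"
  have "?A \<in> poly_over \<rat>" "?B \<in> poly_over \<rat>" using A X d_rat by auto
  moreover have "P \<rho> * Q \<rho> = poly ?A \<rho> + poly ?B \<rho> * s \<rho> \<and>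
     (poly ?A \<rho>)\<^sup>2 - poly d \<rho> * (poly ?B \<rho>)\<^sup>2 = 1 \<and> algebraic_int ((poly ?A \<rho> - 1) / of_nat m) \<and>
     algebraic_int ((poly ?B \<rho> - (y \<rho> + z \<rho>)) / of_nat m)" if \<rho>: "\<rho> \<in> Z" for \<rho>
  proof -
    have m0: "(of_nat m :: complex) \<noteq> 0" using m_pos by simp
    have "P \<rho> * Q \<rho> = poly A \<rho> * poly X \<rho> + (s \<rho>)\<^sup>2 * (poly B \<rho> * poly Y \<rho>) +
        (poly A \<rho> * poly Y \<rho> + poly B \<rho> * poly X \<rho>) * s \<rho>"
      using A X \<rho> by (simp add: power2_eq_square algebra_simps)
    then show ?thesis
      using pell_congruence_mult[OF m0 _ d_conj(2)[OF \<rho>] yz(1)[OF \<rho>] yz(2)[OF \<rho>]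
          A(4)[OF \<rho>] A(5)[OF \<rho>] A(6)[OF \<rho>] X(4)[OF \<rho>] X(5)[OF \<rho>] X(6)[OF \<rho>]] s[OF \<rho>]
      by simp
  qed
  ultimately show ?thesis using yz unfolding pell_unit_def
    by (intro conjI bexI[of _ ?A] bexI[of _ ?B] ballI) (auto intro: algebraic_int_add)
qed

text \<open>Norm one makes \<open>A - B \<surd>d\<close> the inverse; \<open>A\<close> and
  \<open>B\<close> are algebraic integers because they are congruent modulo \<open>m\<close> to
  algebraic integers.\<close>

lemma pell_unit_norm:
  assumes "pell_unit P y"
  obtains A B where "A \<in> poly_over \<rat>" "B \<in> poly_over \<rat>"
    "\<And>\<rho>. \<rho> \<in> Z \<Longrightarrow> P \<rho> = poly A \<rho> + poly B \<rho> * s \<rho>"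
    "\<And>\<rho>. \<rho> \<in> Z \<Longrightarrow> inverse (P \<rho>) = poly A \<rho> - poly B \<rho> * s \<rho>"
    "\<And>\<rho>. \<rho> \<in> Z \<Longrightarrow> P \<rho> \<noteq> 0"
    "\<And>\<rho>. \<rho> \<in> Z \<Longrightarrow> (poly A \<rho>)\<^sup>2 - poly d \<rho> * (poly B \<rho>)\<^sup>2 = 1"
    "\<And>\<rho>. \<rho> \<in> Z \<Longrightarrow> algebraic_int ((poly A \<rho> - 1) / of_nat m)"
    "\<And>\<rho>. \<rho> \<in> Z \<Longrightarrow> algebraic_int ((poly B \<rho> - y \<rho>) / of_nat m)"
    "\<And>\<rho>. \<rho> \<in> Z \<Longrightarrow> algebraic_int (poly A \<rho>)"
    "\<And>\<rho>. \<rho> \<in> Z \<Longrightarrow> algebraic_int (poly B \<rho>)"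
proof -
  from assms obtain A B where A: "A \<in> poly_over \<rat>" "B \<in> poly_over \<rat>"
    "\<And>\<rho>. \<rho> \<in> Z \<Longrightarrow> P \<rho> = poly A \<rho> + poly B \<rho> * s \<rho>"
    "\<And>\<rho>. \<rho> \<in> Z \<Longrightarrow> (poly A \<rho>)\<^sup>2 - poly d \<rho> * (poly B \<rho>)\<^sup>2 = 1"
    "\<And>\<rho>. \<rho> \<in> Z \<Longrightarrow> algebraic_int ((poly A \<rho> - 1) / of_nat m)"
    "\<And>\<rho>. \<rho> \<in> Z \<Longrightarrow> algebraic_int ((poly B \<rho> - y \<rho>) / of_nat m)"
    by (auto simp: pell_unit_def)
  have e: "P \<rho> * (poly A \<rho> - poly B \<rho> * s \<rho>) = 1" if "\<rho> \<in> Z" for \<rho>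
  proof -
    have "P \<rho> * (poly A \<rho> - poly B \<rho> * s \<rho>) = (poly A \<rho>)\<^sup>2 - (s \<rho>)\<^sup>2 * (poly B \<rho>)\<^sup>2"
      unfolding A(3)[OF that] by (simp add: power2_eq_square algebra_simps)
    then show ?thesis using s[OF that] A(4)[OF that] by simp
  qed
  have m0: "(of_nat m :: complex) \<noteq> 0" using m_pos by simp
  have i: "algebraic_int (poly A \<rho>)" "algebraic_int (poly B \<rho>)" if "\<rho> \<in> Z" for \<rho>
  proof -
    have "algebraic_int (of_nat m * ((poly A \<rho> - 1) / of_nat m) + 1)"
      using A(5)[OF that] by (intro algebraic_int_add algebraic_int_mult) auto
    then show "algebraic_int (poly A \<rho>)" using m0 by simp
    have "algebraic_int (of_nat m * ((poly B \<rho> - y \<rho>) / of_nat m) + y \<rho>)"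
      using A(6)[OF that] assms that
      by (intro algebraic_int_add algebraic_int_mult) (auto simp: pell_unit_def)
    then show "algebraic_int (poly B \<rho>)" using m0 by simp
  qed
  show ?thesis
    by (rule that[OF A(1,2,3) inverse_unique[OF e] _ A(4,5,6) i]) (use e in force)+
qed

lemma pell_unit_inverse:
  assumes "pell_unit P y"
  shows "pell_unit (\<lambda>\<rho>. inverse (P \<rho>)) (\<lambda>\<rho>. - y \<rho>)"
proof -
  obtain A B where A: "A \<in> poly_over \<rat>" "B \<in> poly_over \<rat>"
    "\<And>\<rho>. \<rho> \<in> Z \<Longrightarrow> inverse (P \<rho>) = poly A \<rho> - poly B \<rho> * s \<rho>"
    "\<And>\<rho>. \<rho> \<in> Z \<Longrightarrow> (poly A \<rho>)\<^sup>2 - poly d \<rho> * (poly B \<rho>)\<^sup>2 = 1"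
    "\<And>\<rho>. \<rho> \<in> Z \<Longrightarrow> algebraic_int ((poly A \<rho> - 1) / of_nat m)"
    "\<And>\<rho>. \<rho> \<in> Z \<Longrightarrow> algebraic_int ((poly B \<rho> - y \<rho>) / of_nat m)"
    using pell_unit_norm[OF assms] by metis
  have "algebraic_int ((poly (- B) \<rho> - - y \<rho>) / of_nat m)" if "\<rho> \<in> Z" for \<rho>
    using algebraic_int_minus[OF A(6)[OF that]] by (simp add: minus_divide_left)
  then show ?thesis
    using A assms unfolding pell_unit_def
    by (intro conjI bexI[of _ A] bexI[of _ "- B"]) auto
qed

lemma pell_unit_one: "pell_unit (\<lambda>_. 1) (\<lambda>_. 0)"
  unfolding pell_unit_def by (intro conjI bexI[of _ 1] bexI[of _ 0]) auto

lemma pell_unit_power: "pell_unit P y \<Longrightarrow> pell_unit (\<lambda>\<rho>. P \<rho> ^ k) (\<lambda>\<rho>. of_nat k * y \<rho>)"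
proof (induction k)
  case 0
  then show ?case using pell_unit_one by simp
next
  case (Suc k)
  then show ?case using pell_unit_mult[of P y "\<lambda>\<rho>. P \<rho> ^ k" "\<lambda>\<rho>. of_nat k * y \<rho>"] by (simp add: algebra_simps)
qed

lemma pell_unit_power_int: "pell_unit P y \<Longrightarrow> pell_unit (\<lambda>\<rho>. P \<rho> powi k) (\<lambda>\<rho>. of_int k * y \<rho>)"
proof (cases k rule: int_cases2)
  case (nonneg n)
  assume "pell_unit P y"
  then show ?thesis using pell_unit_power[of P y n] nonneg by simp
next
  case (nonpos n)
  assume "pell_unit P y"
  then show ?thesis using pell_unit_inverse[OF pell_unit_power[of P y n]] nonpos
    by (simp add: power_int_minus)
qed

lemma pell_unit_prod:
  assumes "\<And>k. k < (n::nat) \<Longrightarrow> pell_unit (P k) (y k)"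
  shows "pell_unit (\<lambda>\<rho>. \<Prod>k<n. P k \<rho> powi e k) (\<lambda>\<rho>. \<Sum>k<n. of_int (e k) * y k \<rho>)"
  using assms
proof (induction n)
  case 0
  then show ?case using pell_unit_one by simp
next
  case (Suc n)
  then show ?case using pell_unit_mult[OF Suc.IH pell_unit_power_int[of "P n" "y n" "e n"]] by simp
qed

text \<open>Here a multiplicative relation becomes a linear congruence: if the unit is 1 then
  \<open>P - 1 / P = 2 B \<surd>d\<close> vanishes, so \<open>B = 0\<close>, while \<open>B\<close>
  is congruent to \<open>y\<close>.\<close>

lemma pell_unit_trivial:
  assumes "pell_unit P y" "P t = 1"
  shows "algebraic_int (y t / of_nat m)"
proof -
  obtain A B where A: "P t = poly A t + poly B t * s t" "inverse (P t) = poly A t - poly B t * s t"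
    "algebraic_int ((poly B t - y t) / of_nat m)"
    using pell_unit_norm[OF assms(1)] t_in_Z by metis
  have "s t \<noteq> 0" using s[OF t_in_Z] d_nonzero by auto
  moreover have "P t - inverse (P t) = 2 * (poly B t * s t)" by (subst A(2), subst A(1)) simp
  then have "poly B t * s t = 0" using assms(2) by simp
  ultimately have "poly B t = 0" by simp
  then show ?thesis using algebraic_int_minus[OF A(3)] by simp
qed

text \<open>
  A nontrivial \<open>q\<close>-th root of unity \<open>1 + w\<close> has \<open>w\<close> dividing \<open>q\<close>, while \<open>m\<close> divides \<open>w\<^sup>2\<close> here.
\<close>

lemma pell_unit_torsion_free:
  assumes P: "pell_unit P y" and q: "prime q" and Pq: "P t ^ q = 1" and m: "6 dvd m"
  shows "P t = 1"
proof (rule ccontr)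
  assume ne: "P t \<noteq> 1"
  obtain A B where A: "P t = poly A t + poly B t * s t" 
    "algebraic_int ((poly A t - 1) / of_nat m)" "algebraic_int (poly A t)" "algebraic_int (poly B t)"
    using pell_unit_norm[OF P] t_in_Z by metis
  have m0: "(of_nat m :: complex) \<noteq> 0" using m_pos by simp
  define w where "w = P t - 1"
  define a where "a = (poly A t - 1) / of_nat m"
  have wa: "w = of_nat m * a + poly B t * s t" using A(1) m0 by (simp add: w_def a_def)
  have "algebraic_int (poly d t)"
    using algebraic_int_mult[OF _ d_dvd, of "of_nat m"] m0 by simp
  then have "algebraic_int ((s t)\<^sup>2)" using s[OF t_in_Z] by simp
  then have si: "algebraic_int (s t)" by (rule algebraic_int_root[of "(s t)\<^sup>2" "monom 1 2"])
      (auto simp: poly_monom degree_monom_eq coeff_monom)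
  have wi: "algebraic_int w"
    unfolding wa a_def using A(2,4) si by (intro algebraic_int_add algebraic_int_mult) auto
  \<comment> \<open>The term \<open>B \<surd>d\<close> of \<open>w\<close> yields a multiple of
    \<open>d\<close>, and with it of \<open>m\<close>, only after squaring.\<close>
  have "w\<^sup>2 / of_nat m = of_nat m * a\<^sup>2 + 2 * a * poly B t * s t + (poly B t)\<^sup>2 * (poly d t / of_nat m)"
    unfolding wa s[OF t_in_Z, symmetric] using m0 by (simp add: power2_eq_square field_simps)
  moreover have "algebraic_int \<dots>"
    using A(2,4) si d_dvd unfolding a_def
    by (intro algebraic_int_add algebraic_int_mult algebraic_int_power) auto
  ultimately have w2: "algebraic_int (w\<^sup>2 / of_nat m)" by simp
  have w0: "w \<noteq> 0" using ne by (simp add: w_def)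
  have q2: "q \<ge> 2" using q prime_ge_2_nat by blast
  then obtain r where r: "q = Suc (Suc r)" by (metis Suc_le_D numeral_2_eq_2 Suc_le_mono)
  have "1 = (w + 1) ^ q" using Pq by (simp add: w_def)
  also have "\<dots> = (\<Sum>k\<le>q. of_nat (q choose k) * w ^ k)" by (simp add: binomial_ring)
  also have "\<dots> = 1 + of_nat q * w + (\<Sum>k\<le>r. of_nat (q choose (Suc (Suc k))) * w ^ Suc (Suc k))"
    unfolding r by (subst sum.atMost_Suc_shift, subst sum.atMost_Suc_shift) simp
  also have "(\<Sum>k\<le>r. of_nat (q choose (Suc (Suc k))) * w ^ Suc (Suc k)) =
      w * (w * (\<Sum>k\<le>r. of_nat (q choose (Suc (Suc k))) * w ^ k))"
    by (simp add: sum_distrib_left algebra_simps)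
  finally have "w * (of_nat q + w * (\<Sum>k\<le>r. of_nat (q choose (Suc (Suc k))) * w ^ k)) = 0"
    by (simp add: algebra_simps)
  then have "of_nat q = - (w * (\<Sum>k\<le>r. of_nat (q choose (Suc (Suc k))) * w ^ k))"
    using w0 by (simp add: eq_neg_iff_add_eq_0)
  \<comment> \<open>Squared because divisibility by \<open>m\<close> is known for
    \<open>w\<^sup>2\<close> only.\<close>
  then have "(of_nat q)\<^sup>2 / of_nat m = (w\<^sup>2 / of_nat m) * (\<Sum>k\<le>r. of_nat (q choose (Suc (Suc k))) * w ^ k)\<^sup>2"
    by (simp add: power_mult_distrib)
  moreover have "algebraic_int \<dots>"
    using w2 wi by (intro algebraic_int_mult algebraic_int_power algebraic_int_sum) auto
  ultimately have "algebraic_int ((of_nat q)\<^sup>2 / of_nat m :: complex)" by (simp only:)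
  moreover have "(of_nat q)\<^sup>2 / of_nat m \<in> (\<rat> :: complex set)" by auto
  ultimately have "(of_nat q)\<^sup>2 / of_nat m \<in> (\<int> :: complex set)"
    by (rule rational_algebraic_int_is_int)
  then obtain z :: int where "(of_nat q)\<^sup>2 / of_nat m = (of_int z :: complex)" by (auto elim: Ints_cases)
  then have "(of_int (int q ^ 2) :: complex) = of_int (z * int m)" using m0 by (simp add: field_simps)
  then have "int q ^ 2 = z * int m" by (simp only: of_int_eq_iff)
  then have "int m dvd int q ^ 2" by simp
  then have "m dvd q ^ 2" by (metis int_dvd_int_iff of_nat_power)
  \<comment> \<open>The factor 6 of \<open>m\<close> consists of two distinct primes, and one prime
    \<open>q\<close> cannot equal both.\<close>
  then have "6 dvd q ^ 2" using m dvd_trans by blast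
  then have "2 dvd q ^ 2" "3 dvd q ^ 2"
    by (rule dvd_trans[rotated], simp)+
  moreover have "prime (2::nat)" "prime (3::nat)" by simp_all
  ultimately have "2 dvd q" "3 dvd q" using prime_dvd_power by blast+
  then have "q = 2" "q = 3" using q by (auto simp: prime_nat_iff)
  then show False by simp
qed

text \<open>\<open>P + 1 / P = 2 A\<close> bounds all conjugates of \<open>A\<close>, which leaves
  finitely many values \<open>A(t)\<close>, and \<open>P\<close> is a root of
  \<open>x\<^sup>2 - 2 A x + 1\<close>.\<close>

lemma finite_bounded_units:
  "finite {P t | P y. pell_unit P y \<and> (\<forall>\<rho>\<in>Z. cmod (P \<rho>) \<le> C \<and> cmod (inverse (P \<rho>)) \<le> C)}" (is "finite ?X")
proof -
  define Y where "Y = {x. \<exists>h\<in>poly_over \<rat>. x = poly h t \<and> algebraic_int (poly h t) \<and> (\<forall>\<rho>\<in>Z. cmod (poly h \<rho>) \<le> C)}"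
  have "?X \<subseteq> (\<Union>a\<in>Y. {x. poly [:1, - 2 * a, 1:] x = 0})"
  proof
    fix x assume "x \<in> ?X"
    then obtain P y where P: "x = P t" "pell_unit P y"
      "\<And>\<rho>. \<rho> \<in> Z \<Longrightarrow> cmod (P \<rho>) \<le> C \<and> cmod (inverse (P \<rho>)) \<le> C" by auto
    obtain A B where A: "A \<in> poly_over \<rat>"
      "\<And>\<rho>. \<rho> \<in> Z \<Longrightarrow> P \<rho> = poly A \<rho> + poly B \<rho> * s \<rho>"
      "\<And>\<rho>. \<rho> \<in> Z \<Longrightarrow> inverse (P \<rho>) = poly A \<rho> - poly B \<rho> * s \<rho>"
      "\<And>\<rho>. \<rho> \<in> Z \<Longrightarrow> P \<rho> \<noteq> 0"
      "\<And>\<rho>. \<rho> \<in> Z \<Longrightarrow> algebraic_int (poly A \<rho>)"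
      using pell_unit_norm[OF P(2)] by metis
    have half: "P \<rho> + inverse (P \<rho>) = 2 * poly A \<rho>" if "\<rho> \<in> Z" for \<rho>
      unfolding A(2)[OF that] using A(2,3)[OF that] by simp
    have "cmod (poly A \<rho>) \<le> C" if "\<rho> \<in> Z" for \<rho>
    proof -
      have "cmod (2 * poly A \<rho>) \<le> C + C"
        unfolding half[OF that, symmetric] using P(3)[OF that]
        by (intro order_trans[OF norm_triangle_ineq] add_mono) auto
      then show ?thesis by (simp add: norm_mult)
    qed
    then have "poly A t \<in> Y" using A t_in_Z by (auto simp: Y_def)
    moreover have "poly [:1, - 2 * poly A t, 1:] x = 0"
    proof -
      have "poly [:1, - 2 * poly A t, 1:] x = 1 + x * (x - 2 * poly A t)" by simp
      also have "x - 2 * poly A t = - inverse x"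
        unfolding P(1) half[OF t_in_Z, symmetric] by simp
      finally show ?thesis using A(4)[OF t_in_Z] P(1) by simp
    qed
    ultimately show "x \<in> (\<Union>a\<in>Y. {x. poly [:1, - 2 * a, 1:] x = 0})" by blast
  qed
  moreover have "finite Y" unfolding Y_def by (rule finite_bounded_values)
  then have "finite (\<Union>a\<in>Y. {x. poly [:1, - 2 * a, 1:] x = 0})"
    by (intro finite_UN_I poly_roots_finite) simp_all
  ultimately show ?thesis by (rule finite_subset)
qed

text \<open>
  By \<open>special\<close>, the logarithms at \<open>\<rho>0\<close> are determined by those at the other conjugates, so that the
  rank is less than the number of conjugates.
\<close>

lemma unit_relation_exists:
  assumes \<rho>0: "\<rho>0 \<in> Z"
    and special: "(\<forall>P y. pell_unit P y \<longrightarrow> cmod (P \<rho>0) = 1) \<or>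
      (\<exists>\<rho>'\<in>Z - {\<rho>0}. \<forall>P y. pell_unit P y \<longrightarrow> cmod (P \<rho>0) = cmod (P \<rho>'))"
    and P: "\<And>k. k < degree f \<Longrightarrow> pell_unit (P k) (y k)"
  shows "\<exists>e :: nat \<Rightarrow> int. (\<exists>k<degree f. e k \<noteq> 0) \<and> (\<Prod>k<degree f. P k t powi e k) = 1"
proof -
  let ?n = "degree f"
  define X where "X = {P t | P y. pell_unit P y \<and> (\<forall>\<rho>\<in>Z. cmod (P \<rho>) \<le> exp 1 \<and> cmod (inverse (P \<rho>)) \<le> exp 1)}"
  have finX: "finite X" unfolding X_def by (rule finite_bounded_units)
  have P0: "P k \<rho> \<noteq> 0" if "k < ?n" "\<rho> \<in> Z" for k \<rho> using pell_unit_norm[OF P[OF that(1)]] that by metis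
  have cI: "card (Z - {\<rho>0}) < ?n"
    using \<rho>0 card_Z finite_Z by (metis card_Diff1_less)
  obtain E where E: "E \<subseteq> {..<?n} \<rightarrow>\<^sub>E UNIV" "finite E" "card E > card X"
    "\<forall>e\<in>E. \<forall>e'\<in>E. \<forall>\<rho>\<in>Z - {\<rho>0}. \<bar>\<Sum>k<?n. (real (e k) - real (e' k)) * ln (cmod (P k \<rho>))\<bar> \<le> 1"
    using small_combinations[of "Z - {\<rho>0}" ?n "card X" "\<lambda>k \<rho>. ln (cmod (P k \<rho>))"] finite_Z cI by auto
  obtain e0 where e0: "e0 \<in> E" using E(3) by fastforce
  \<comment> \<open>Division by the product that belongs to one fixed vector \<open>e0\<close>
    brings all these units into the finite set \<open>X\<close>. There are more vectors than
    elements of \<open>X\<close>, so two of the units coincide at \<open>t\<close>.\<close>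
  define G where "G e \<rho> = (\<Prod>k<?n. P k \<rho> powi (int (e k) - int (e0 k)))" for e \<rho>
  have Gu: "pell_unit (G e) (\<lambda>\<rho>. \<Sum>k<?n. of_int (int (e k) - int (e0 k)) * y k \<rho>)" for e
    unfolding G_def by (rule pell_unit_prod[OF P])
  have bound: "cmod (G e \<rho>) \<le> exp 1 \<and> cmod (inverse (G e \<rho>)) \<le> exp 1" if e: "e \<in> E" and \<rho>: "\<rho> \<in> Z" for e \<rho>
  proof -
    have b: "cmod (G e \<sigma>) \<le> exp 1 \<and> cmod (inverse (G e \<sigma>)) \<le> exp 1" if \<sigma>: "\<sigma> \<in> Z - {\<rho>0}" for \<sigma>
    proof -
      let ?S = "\<Sum>k<?n. (real (e k) - real (e0 k)) * ln (cmod (P k \<sigma>))"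
      have "cmod (G e \<sigma>) = exp ?S"
        unfolding G_def using \<sigma> P0 by (subst norm_prod_power_int) auto
      moreover have "\<bar>?S\<bar> \<le> 1" using E(4) e e0 \<sigma> by blast
      ultimately show ?thesis unfolding norm_inverse by (simp add: exp_minus[symmetric]) linarith
    qed
    show ?thesis
    proof (cases "\<rho> = \<rho>0")
      case False
      then show ?thesis using b \<rho> by blast
    next
      case True
      from special show ?thesis
      proof
        assume "\<forall>P y. pell_unit P y \<longrightarrow> cmod (P \<rho>0) = 1"
        then have "cmod (G e \<rho>) = 1" using Gu True by blast
        then show ?thesis by (simp add: norm_inverse)
      next
        assume "\<exists>\<rho>'\<in>Z - {\<rho>0}. \<forall>P y. pell_unit P y \<longrightarrow> cmod (P \<rho>0) = cmod (P \<rho>')"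
        then obtain \<rho>' where "\<rho>' \<in> Z - {\<rho>0}" "cmod (G e \<rho>) = cmod (G e \<rho>')" using Gu True by blast
        then show ?thesis using b[of \<rho>'] by (simp add: norm_inverse)
      qed
    qed
  qed
  have "(\<lambda>e. G e t) ` E \<subseteq> X" using Gu bound unfolding X_def by blast
  then have "card ((\<lambda>e. G e t) ` E) < card E" using E(3) finX by (meson card_mono le_less_trans)
  then have "\<not> inj_on (\<lambda>e. G e t) E" by (rule pigeonhole)
  then obtain e e' where ee: "e \<in> E" "e' \<in> E" "e \<noteq> e'" "G e t = G e' t" by (auto simp: inj_on_def)
  obtain k where k: "k < ?n" "e k \<noteq> e' k"
  proof -
    have "\<exists>k\<in>{..<?n}. e k \<noteq> e' k" using ee E(1) PiE_ext[of e "{..<?n}" "\<lambda>_. UNIV" e'] by blast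
    then show ?thesis using that by auto
  qed
  have "(\<Prod>k<?n. P k t powi (int (e k) - int (e' k))) = (\<Prod>k<?n. (P k t powi (int (e k) - int (e0 k))) / (P k t powi (int (e' k) - int (e0 k))))"
    using P0 t_in_Z by (intro prod.cong) (auto simp: power_int_diff[symmetric])
  also have "\<dots> = G e t / G e' t" by (simp add: prod_dividef G_def)
  also have "\<dots> = 1"
    using ee(4) P0 t_in_Z by (auto simp: G_def)
  finally show ?thesis using k by (intro exI[of _ "\<lambda>k. int (e k) - int (e' k)"]) auto
qed

text \<open>A relation of least size is primitive: a common prime \<open>q\<close> of its exponents
  would make the relation divided by \<open>q\<close> a \<open>q\<close>-th root of unity, hence 1
  by torsion-freeness, and so a smaller relation.\<close>

lemma primitive_unit_relation:
  assumes \<rho>0: "\<rho>0 \<in> Z"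
    and special: "(\<forall>P y. pell_unit P y \<longrightarrow> cmod (P \<rho>0) = 1) \<or>
      (\<exists>\<rho>'\<in>Z - {\<rho>0}. \<forall>P y. pell_unit P y \<longrightarrow> cmod (P \<rho>0) = cmod (P \<rho>'))"
    and P: "\<And>k. k < degree f \<Longrightarrow> pell_unit (P k) (y k)" and m: "6 dvd m"
  shows "\<exists>e :: nat \<Rightarrow> int. Gcd (e ` {..<degree f}) = 1 \<and>
    algebraic_int ((\<Sum>k<degree f. of_int (e k) * y k t) / of_nat m)"
proof -
  let ?n = "degree f"
  define R where "R e \<longleftrightarrow> (\<exists>k<?n. e k \<noteq> 0) \<and> (\<Prod>k<?n. P k t powi e k) = 1" for e :: "nat \<Rightarrow> int"
  define size where "size e = nat (\<Sum>k<?n. \<bar>e k\<bar>)" for e :: "nat \<Rightarrow> int"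
  have "\<exists>e. R e" unfolding R_def by (rule unit_relation_exists[OF \<rho>0 special P])
  then obtain e1 where "R e1" by blast
  define e where "e = arg_min size R"
  have e: "R e" unfolding e_def using arg_min_natI[of R e1 size] \<open>R e1\<close> by blast
  have min: "size e \<le> size e'" if "R e'" for e' unfolding e_def using arg_min_nat_le[of R e' size] that by blast
  have "Gcd (e ` {..<?n}) = 1"
  proof (rule ccontr)
    assume g: "Gcd (e ` {..<?n}) \<noteq> 1"
    have "Gcd (e ` {..<?n}) \<noteq> 0" using e by (auto simp: R_def Gcd_0_iff)
    moreover have "\<not> is_unit (Gcd (e ` {..<?n}))" using g by (metis Gcd_int_greater_eq_0 zdvd1_eq abs_of_nonneg)
    ultimately obtain q where q: "prime q" "q dvd Gcd (e ` {..<?n})" using prime_divisorE by metis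
    define e' where "e' k = e k div q" for k
    have q0: "q > 0" using q prime_gt_0_int by blast
    have ek: "e k = q * e' k" if "k < ?n" for k
    proof -
      have "q dvd e k" using q that by (simp add: dvd_Gcd_iff)
      then show ?thesis by (simp add: e'_def)
    qed
    define p where "p = nat q"
    have p: "prime p" "q = int p" using q q0 by (simp_all add: p_def)
    let ?Q = "\<lambda>\<rho>. \<Prod>k<?n. P k \<rho> powi e' k"
    have "?Q t ^ p = (\<Prod>k<?n. P k t powi e k)"
      unfolding prod_power_distrib
    proof (rule prod.cong[OF refl])
      fix k assume "k \<in> {..<?n}"
      then have "P k t powi e k = P k t powi (e' k * int p)" using ek p by (simp add: mult.commute)
      also have "\<dots> = (P k t powi e' k) ^ p" by (simp add: power_int_mult)
      finally show "(P k t powi e' k) ^ p = P k t powi e k" by simp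
    qed
    then have "?Q t ^ p = 1" using e by (simp add: R_def)
    moreover have "pell_unit ?Q (\<lambda>\<rho>. \<Sum>k<?n. of_int (e' k) * y k \<rho>)" by (rule pell_unit_prod[OF P])
    ultimately have "?Q t = 1" using pell_unit_torsion_free[OF _ p(1) _ m, of ?Q] by blast
    moreover obtain k where k: "k < ?n" "e k \<noteq> 0" using e by (auto simp: R_def)
    ultimately have "R e'" using ek[OF k(1)] by (auto simp: R_def)
    then have le: "size e \<le> size e'" by (rule min)
    have "(\<Sum>k<?n. \<bar>e' k\<bar>) < (\<Sum>k<?n. \<bar>e k\<bar>)"
    proof (rule sum_strict_mono_ex1)
      have q2: "q \<ge> 2" using q prime_ge_2_int by blast
      have lt: "\<bar>e' j\<bar> \<le> \<bar>e j\<bar> \<and> (e j \<noteq> 0 \<longrightarrow> \<bar>e' j\<bar> < \<bar>e j\<bar>)" if "j < ?n" for j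
      proof -
        have "2 * \<bar>e' j\<bar> \<le> q * \<bar>e' j\<bar>" using q2 by (intro mult_right_mono) auto
        then show ?thesis using ek[OF that] q0 by (auto simp: abs_mult)
      qed
      show "\<forall>x\<in>{..<?n}. \<bar>e' x\<bar> \<le> \<bar>e x\<bar>" using lt by auto
      show "\<exists>a\<in>{..<?n}. \<bar>e' a\<bar> < \<bar>e a\<bar>" using lt k by auto
    qed simp
    moreover have "0 \<le> (\<Sum>k<?n. \<bar>e' k\<bar>)" by (intro sum_nonneg) auto
    ultimately have "size e' < size e" unfolding size_def by (simp only: nat_less_eq_zless)
    then show False using le by simp
  qed
  moreover have "algebraic_int ((\<Sum>k<?n. of_int (e k) * y k t) / of_nat m)"
  proof (rule pell_unit_trivial)
    show "pell_unit (\<lambda>\<rho>. \<Prod>k<?n. P k \<rho> powi e k) (\<lambda>\<rho>. \<Sum>k<?n. of_int (e k) * y k \<rho>)"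
      by (rule pell_unit_prod[OF P])
  qed (use e in \<open>simp add: R_def\<close>)
  ultimately show ?thesis by blast
qed

end

section \<open>Elements satisfying the Pell congruence are integers\<close>

text \<open>After cancelling powers of \<open>W\<close> from its equation, the constant term
  \<open>a\<close> is a nonzero integer with \<open>a / W = - p(W)\<close>.\<close>

lemma algebraic_int_divides_nat:
  fixes W :: complex
  assumes "algebraic_int W" "W \<noteq> 0"
  shows "\<exists>D::nat > 0. algebraic_int (of_nat D / W)"
proof -
  obtain p where p: "lead_coeff p = 1" "\<forall>i. coeff p i \<in> \<int>" "poly p W = 0"
    using assms by (auto simp: algebraic_int.simps)
  have "\<exists>a. a \<noteq> 0 \<and> a \<in> \<int> \<and> algebraic_int (a / W)" if "\<forall>i. coeff p i \<in> \<int>" "poly p W = 0" "p \<noteq> 0" for p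
    using that
  proof (induction p)
    case (pCons a p)
    have c: "a \<in> \<int>" "\<forall>i. coeff p i \<in> \<int>"
      using pCons.prems(1) by (metis coeff_pCons_0, metis coeff_pCons_Suc)
    show ?case
    proof (cases "a = 0")
      case True
      with pCons c assms show ?thesis by auto
    next
      case False
      have "a + W * poly p W = 0" using pCons.prems by simp
      then have "a / W = - poly p W" using assms(2) by (simp add: field_simps add_eq_0_iff)
      moreover have "algebraic_int (coeff p i)" for i using c by (intro int_imp_algebraic_int) auto
      then have "algebraic_int (poly p W)"
        unfolding poly_altdef using assms(1)
        by (intro algebraic_int_sum algebraic_int_mult algebraic_int_power)
      ultimately show ?thesis using False c by (intro exI[of _ a]) auto
    qed
  qed auto
  moreover have "p \<noteq> 0" using p(1) by auto
  ultimately obtain a where a: "a \<noteq> 0" "a \<in> \<int>" "algebraic_int (a / W)" using p(2,3) by blast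
  then obtain z where z: "a = of_int z" by (auto elim: Ints_cases)
  have "algebraic_int (of_nat (nat \<bar>z\<bar>) / W)"
    using a(3) algebraic_int_minus[OF a(3)] z by (cases "z \<ge> 0") auto
  moreover have "nat \<bar>z\<bar> > 0" using a z by simp
  ultimately show ?thesis by blast
qed

context conjugates
begin

lemma algebraic_int_coeff_prod_roots:
  assumes "A \<subseteq> Z" shows "algebraic_int (coeff (\<Prod>\<sigma>\<in>A. [:- \<sigma>, 1:]) k)"
proof -
  obtain \<sigma>s where \<sigma>s: "set \<sigma>s = A" "distinct \<sigma>s"
    using finite_distinct_list finite_subset[OF assms finite_Z] by blast
  have "(\<Prod>\<sigma>\<in>A. [:- \<sigma>, 1:]) = (\<Prod>\<sigma>\<leftarrow>\<sigma>s. [:- \<sigma>, 1:])"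
    using \<sigma>s by (simp add: prod.distinct_set_conv_list[symmetric])
  then show ?thesis using \<sigma>s assms conjugate_algebraic_int by (auto intro!: algebraic_int_coeff_prod)
qed

text \<open>Lagrange interpolation at the conjugates; \<open>D\<close> is a multiple of the discriminant.\<close>

lemma coefficient_denominator:
  "\<exists>D::nat > 0. \<forall>e :: nat \<Rightarrow> int. \<forall>\<kappa>\<in>\<rat>. algebraic_int (\<kappa> * (\<Sum>k<degree f. of_int (e k) * t ^ k)) \<longrightarrow>
     (\<forall>k<degree f. algebraic_int (of_nat D * \<kappa> * of_int (e k)))"
proof -
  let ?n = "degree f"
  \<comment> \<open>\<open>w \<rho>\<close> is the derivative of \<open>f\<close> at \<rho>, so that
    \<open>W\<close> is the discriminant up to sign.\<close>
  define w where "w \<rho> = (\<Prod>\<sigma>\<in>Z - {\<rho>}. \<rho> - \<sigma>)" for \<rho>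
  define W where "W = (\<Prod>\<rho>\<in>Z. w \<rho>)"
  define L where "L \<rho> = (\<Prod>\<sigma>\<in>Z - {\<rho>}. [:- \<sigma>, 1:])" for \<rho>
  have wi: "algebraic_int (w \<rho>)" if "\<rho> \<in> Z" for \<rho>
    unfolding w_def using that conjugate_algebraic_int
    by (intro algebraic_int_prod algebraic_int_diff) auto
  have w0: "w \<rho> \<noteq> 0" for \<rho> using finite_Z by (auto simp: w_def)
  have "algebraic_int W" "W \<noteq> 0" using wi w0 finite_Z by (auto simp: W_def intro!: algebraic_int_prod)
  then obtain D :: nat where D: "D > 0" "algebraic_int (of_nat D / W)"
    using algebraic_int_divides_nat by blast
  have "algebraic_int (of_nat D * \<kappa> * of_int (e k))"
    if \<kappa>: "\<kappa> \<in> \<rat>" "algebraic_int (\<kappa> * (\<Sum>k<?n. of_int (e k) * t ^ k))" and k: "k < ?n"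
    for e :: "nat \<Rightarrow> int" and \<kappa> k
  proof -
    define p where "p = (\<Sum>k<?n. monom (of_int (e k) :: complex) k)"
    have co: "coeff p j = (if j < ?n then of_int (e j) else 0)" for j
      by (simp add: p_def coeff_sum coeff_monom if_distrib cong: if_cong)
    have np: "?n > 0" using k by simp
    have "degree p \<le> ?n - 1" by (rule degree_le) (auto simp: co)
    then have dp: "degree p < card Z" using np card_Z by linarith
    have pr: "p \<in> poly_over \<rat>" by (auto simp: poly_over_def co)
    have px: "poly p x = (\<Sum>k<?n. of_int (e k) * x ^ k)" for x
      by (simp add: p_def poly_sum poly_monom)
    define q where "q = (\<Sum>\<rho>\<in>Z. Polynomial.smult (poly p \<rho> / w \<rho>) (L \<rho>))"
    have "poly (L \<rho>) \<rho>' = (if \<rho>' = \<rho> then w \<rho> else 0)" if "\<rho> \<in> Z" "\<rho>' \<in> Z" for \<rho> \<rho>'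
    proof (cases "\<rho>' = \<rho>")
      case True
      then show ?thesis by (simp add: L_def w_def poly_prod)
    next
      case False
      then have "\<rho>' \<in> Z - {\<rho>}" using that by simp
      then show ?thesis using False finite_Z by (auto simp: L_def poly_prod)
    qed
    then have "poly q \<rho> = poly p \<rho>" if "\<rho> \<in> Z" for \<rho>
    proof -
      have "poly q \<rho> = (\<Sum>\<sigma>\<in>Z. if \<rho> = \<sigma> then poly p \<sigma> else 0)"
        unfolding q_def poly_sum using that w0
          \<open>\<And>\<rho> \<rho>'. \<rho> \<in> Z \<Longrightarrow> \<rho>' \<in> Z \<Longrightarrow> poly (L \<rho>) \<rho>' = (if \<rho>' = \<rho> then w \<rho> else 0)\<close>
        by (intro sum.cong) auto
      then show ?thesis using that finite_Z by simp
    qed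
    moreover have "degree q < card Z"
    proof -
      have "degree (L \<rho>) \<le> ?n - 1" if "\<rho> \<in> Z" for \<rho>
      proof -
        have "degree (L \<rho>) = card (Z - {\<rho>})" unfolding L_def by (subst degree_prod_sum_eq) auto
        then show ?thesis using that card_Z finite_Z by simp
      qed
      then have "degree q \<le> ?n - 1" unfolding q_def
        by (intro degree_sum_le) (auto intro: order_trans[OF degree_smult_le] finite_Z)
      then show ?thesis using np card_Z by linarith
    qed
    ultimately have pq: "p = q" using dp by (intro poly_eqI_degree[of Z]) auto
    \<comment> \<open>Multiplication by \<open>W\<close> clears the denominators of the
      interpolation formula; every remaining factor is then an algebraic integer, as
      \<open>\<kappa> p(\<rho>)\<close> is a conjugate of the given one.\<close>
    have "\<kappa> * W * of_int (e k) = (\<Sum>\<rho>\<in>Z. (\<kappa> * poly p \<rho>) * (\<Prod>\<sigma>\<in>Z - {\<rho>}. w \<sigma>) * coeff (L \<rho>) k)"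
    proof -
      have "of_int (e k) = coeff q k" using co[of k] k pq by simp
      also have "\<dots> = (\<Sum>\<rho>\<in>Z. poly p \<rho> / w \<rho> * coeff (L \<rho>) k)" by (simp add: q_def coeff_sum)
      finally have "\<kappa> * W * of_int (e k) = (\<Sum>\<rho>\<in>Z. \<kappa> * W * (poly p \<rho> / w \<rho> * coeff (L \<rho>) k))"
        by (simp add: sum_distrib_left)
      also have "\<dots> = (\<Sum>\<rho>\<in>Z. (\<kappa> * poly p \<rho>) * (\<Prod>\<sigma>\<in>Z - {\<rho>}. w \<sigma>) * coeff (L \<rho>) k)"
      proof (rule sum.cong[OF refl])
        fix \<rho> assume "\<rho> \<in> Z"
        then have "W = w \<rho> * (\<Prod>\<sigma>\<in>Z - {\<rho>}. w \<sigma>)" unfolding W_def by (rule prod.remove[OF finite_Z])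
        then show "\<kappa> * W * (poly p \<rho> / w \<rho> * coeff (L \<rho>) k) =
            (\<kappa> * poly p \<rho>) * (\<Prod>\<sigma>\<in>Z - {\<rho>}. w \<sigma>) * coeff (L \<rho>) k"
          using w0[of \<rho>] by simp
      qed
      finally show ?thesis .
    qed
    moreover have "algebraic_int (\<kappa> * poly p \<rho>)" if "\<rho> \<in> Z" for \<rho>
      using algebraic_int_transfer[of "Polynomial.smult \<kappa> p" \<rho>] pr \<kappa> that px by (simp add: Q.poly_over_smult)
    then have "algebraic_int ((\<kappa> * poly p \<rho>) * (\<Prod>\<sigma>\<in>Z - {\<rho>}. w \<sigma>) * coeff (L \<rho>) k)" if "\<rho> \<in> Z" for \<rho>
      using that wi unfolding L_def
      by (intro algebraic_int_mult[OF algebraic_int_mult] algebraic_int_prod algebraic_int_coeff_prod_roots) auto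
    ultimately have "algebraic_int (\<kappa> * W * of_int (e k))"
      by (simp only: algebraic_int_sum)
    then have "algebraic_int ((of_nat D / W) * (\<kappa> * W * of_int (e k)))" by (rule algebraic_int_mult[OF D(2)])
    then show ?thesis using \<open>W \<noteq> 0\<close> by (simp add: mult.assoc)
  qed
  then show ?thesis using D(1) by blast
qed

end

section \<open>Conjugates at which the rank of the unit group drops\<close>

lemma poly_over_Rats_cnj: "p \<in> poly_over \<rat> \<Longrightarrow> poly p (cnj z) = cnj (poly p z)"
proof -
  assume "p \<in> poly_over \<rat>"
  moreover have "x \<in> \<real>" if "x \<in> \<rat>" for x :: complex using that by (elim Rats_cases') auto
  ultimately have "coeff p n \<in> \<real>" for n by (auto simp: poly_over_def)
  then show ?thesis by (simp add: poly_cnj_real)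
qed

context pell_conjugates
begin

lemma units_conjugate_norm:
  assumes "\<rho> \<in> Z" "cnj \<rho> \<in> Z" "s (cnj \<rho>) = cnj (s \<rho>)" "pell_unit P y"
  shows "cmod (P \<rho>) = cmod (P (cnj \<rho>))"
proof -
  obtain A B where A: "A \<in> poly_over \<rat>" "B \<in> poly_over \<rat>"
    "\<And>\<rho>. \<rho> \<in> Z \<Longrightarrow> P \<rho> = poly A \<rho> + poly B \<rho> * s \<rho>"
    using pell_unit_norm[OF assms(4)] by metis
  have "P (cnj \<rho>) = cnj (P \<rho>)"
    using A assms by (simp add: poly_over_Rats_cnj)
  then show ?thesis by simp
qed

text \<open>\<open>A\<close> and \<open>B\<close> are real here and the square root is purely
  imaginary, so complex conjugation sends \<open>A + B \<surd>d\<close> to its inverse.\<close>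

lemma units_imaginary_norm:
  assumes "\<rho> \<in> Z" "\<rho> \<in> \<real>" "poly d \<rho> = of_real \<delta>" "\<delta> < 0" "pell_unit P y"
  shows "cmod (P \<rho>) = 1"
proof -
  obtain A B where A: "A \<in> poly_over \<rat>" "B \<in> poly_over \<rat>"
    "\<And>\<rho>. \<rho> \<in> Z \<Longrightarrow> P \<rho> = poly A \<rho> + poly B \<rho> * s \<rho>"
    "\<And>\<rho>. \<rho> \<in> Z \<Longrightarrow> inverse (P \<rho>) = poly A \<rho> - poly B \<rho> * s \<rho>"
    "\<And>\<rho>. \<rho> \<in> Z \<Longrightarrow> P \<rho> \<noteq> 0"
    using pell_unit_norm[OF assms(5)] by metis
  have "cnj \<rho> = \<rho>" using assms(2) by (simp add: Reals_cnj_iff)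
  then have AB: "cnj (poly A \<rho>) = poly A \<rho>" "cnj (poly B \<rho>) = poly B \<rho>"
    using poly_over_Rats_cnj[OF A(1), of \<rho>] poly_over_Rats_cnj[OF A(2), of \<rho>] by auto
  have "(s \<rho>)\<^sup>2 = (\<i> * of_real (sqrt (- \<delta>)))\<^sup>2"
    using s[OF assms(1)] assms(3,4) by (simp add: power_mult_distrib of_real_power[symmetric] del: of_real_power)
  then have "cnj (s \<rho>) = - s \<rho>" by (auto simp: power2_eq_iff)
  then have "cnj (P \<rho>) = inverse (P \<rho>)" using A(3,4)[OF assms(1)] AB by simp
  then have "cmod (P \<rho>) = inverse (cmod (P \<rho>))" by (metis complex_mod_cnj norm_inverse)
  moreover have "cmod (P \<rho>) > 0" using A(5)[OF assms(1)] by simp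
  ultimately have "(cmod (P \<rho>))\<^sup>2 = 1" by (metis power2_eq_square right_inverse less_irrefl)
  then show ?thesis by (simp add: power2_eq_1_iff) (smt (verit) norm_ge_zero)
qed

end

text \<open>Dirichlet's box principle: two of the \<open>m + 1\<close> fractional parts of the
  multiples of \<open>x\<close> fall into the same interval of length \<open>1 / m\<close>. The
  difference is nonzero because \<open>x\<close> is irrational, and its sign can be chosen.\<close>

lemma small_negative_combination:
  fixes x :: real
  assumes "x \<notin> \<rat>" "m > 0"
  shows "\<exists>u v :: int. - 1 / real m < of_int u + of_int v * x \<and> of_int u + of_int v * x < 0"
proof -
  define g where "g k = \<lfloor>real m * frac (real k * x)\<rfloor>" for k :: nat
  have "g ` {..m} \<subseteq> {0..<int m}"
  proof
    fix z assume "z \<in> g ` {..m}"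
    then obtain k where "z = g k" by auto
    moreover have "real m * frac (real k * x) < real m" using frac_lt_1 assms(2) by simp
    ultimately show "z \<in> {0..<int m}" using frac_ge_0 by (auto simp: g_def floor_less_iff)
  qed
  then have "card (g ` {..m}) < card {..m}"
    using card_mono[of "{0..<int m}" "g ` {..m}"] by simp
  then have "\<not> inj_on g {..m}" by (rule pigeonhole)
  then obtain i j where ij: "i \<noteq> j" "g i = g j" by (auto simp: inj_on_def)
  define u v where "u = \<lfloor>real j * x\<rfloor> - \<lfloor>real i * x\<rfloor>" and "v = int i - int j"
  have e: "of_int u + of_int v * x = frac (real i * x) - frac (real j * x)"
    by (simp add: u_def v_def frac_def algebra_simps)
  have "\<bar>real m * frac (real i * x) - real m * frac (real j * x)\<bar> < 1"
    using ij(2) unfolding g_def by linarith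
  then have lt: "\<bar>of_int u + of_int v * x\<bar> < 1 / real m"
    using assms(2) unfolding e by (simp add: field_simps abs_less_iff)
  have ne: "of_int u + of_int v * x \<noteq> 0"
  proof
    assume "of_int u + of_int v * x = 0"
    moreover have "v \<noteq> 0" using ij by (simp add: v_def)
    ultimately have "x = of_int (- u) / of_int v" by (simp add: field_simps add_eq_0_iff)
    then show False using assms(1) by (metis Rats_divide Rats_of_int)
  qed
  show ?thesis
  proof (cases "of_int u + of_int v * x < 0")
    case True
    then show ?thesis using lt by (intro exI[of _ u] exI[of _ v]) auto
  next
    case False
    then show ?thesis using lt ne by (intro exI[of _ "- u"] exI[of _ "- v"]) auto
  qed
qed

text \<open>
  With \<open>a = 1 + b\<close>, \<open>X = 1 + b U\<close> and \<open>Y = t + b V\<close>, this is the Pell equation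
  \<open>X\<^sup>2 - (a\<^sup>2 - 1) Y\<^sup>2 = 1\<close> divided by \<open>b\<close>.
\<close>

definition pell_integer :: "complex set \<Rightarrow> complex \<Rightarrow> bool" where
  "pell_integer R t \<longleftrightarrow> (\<forall>b\<in>R. \<exists>U\<in>R. \<exists>V\<in>R. 2 * U + b * U\<^sup>2 = (b + 2) * (t + b * V)\<^sup>2)"

section \<open>The elements satisfying the Pell condition form a ring\<close>

locale complex_subring =
  fixes R :: "complex set"
  assumes one_in: "1 \<in> R"
    and add_in: "x \<in> R \<Longrightarrow> y \<in> R \<Longrightarrow> x + y \<in> R"
    and mult_in: "x \<in> R \<Longrightarrow> y \<in> R \<Longrightarrow> x * y \<in> R"
    and minus_in: "x \<in> R \<Longrightarrow> - x \<in> R"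
begin

lemma zero_in: "0 \<in> R" using add_in[OF one_in minus_in[OF one_in]] by simp

lemma of_nat_in: "of_nat n \<in> R" by (induction n) (auto simp: zero_in one_in add_in)

lemma of_int_in: "of_int z \<in> R" by (cases z rule: int_cases2) (auto simp: of_nat_in minus_in)

lemma pell_integer_one: "pell_integer R 1"
  unfolding pell_integer_def
  by (intro ballI bexI[of _ 1] bexI[of _ 0]) (auto simp: one_in zero_in algebra_simps)

lemma pell_integer_minus: "pell_integer R t \<Longrightarrow> pell_integer R (- t)"
  unfolding pell_integer_def
proof (intro ballI)
  fix b assume "\<forall>b\<in>R. \<exists>U\<in>R. \<exists>V\<in>R. 2 * U + b * U\<^sup>2 = (b + 2) * (t + b * V)\<^sup>2" "b \<in> R"
  then obtain U V where UV: "U \<in> R" "V \<in> R" "2 * U + b * U\<^sup>2 = (b + 2) * (t + b * V)\<^sup>2" by blast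
  have "- t + b * (- V) = - (t + b * V)" by simp
  then show "\<exists>U\<in>R. \<exists>V\<in>R. 2 * U + b * U\<^sup>2 = (b + 2) * (- t + b * V)\<^sup>2"
    using UV by (metis minus_in power2_minus)
qed

text \<open>The product of the two units at the same \<open>b\<close> adds the residues of
  \<open>Y\<close>; \<open>?U\<close> and \<open>?V\<close> are its components with the residues
  removed, divided by \<open>b\<close>.\<close>

lemma pell_integer_add:
  assumes "t \<in> R" "t' \<in> R" "pell_integer R t" "pell_integer R t'"
  shows "pell_integer R (t + t')"
  unfolding pell_integer_def
proof
  fix b assume b: "b \<in> R"
  obtain U V where U: "U \<in> R" "V \<in> R" "2 * U + b * U\<^sup>2 = (b + 2) * (t + b * V)\<^sup>2"
    using assms b unfolding pell_integer_def by blast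
  obtain U' V' where U': "U' \<in> R" "V' \<in> R" "2 * U' + b * U'\<^sup>2 = (b + 2) * (t' + b * V')\<^sup>2"
    using assms b unfolding pell_integer_def by blast
  define Y Y' where "Y = t + b * V" and "Y' = t' + b * V'"
  let ?U = "U + U' + b * U * U' + (b + 2) * Y * Y'" and ?V = "V + V' + U * Y' + U' * Y"
  have two: "2 \<in> R" using of_nat_in[of 2] by simp
  have "Y \<in> R" "Y' \<in> R" using b U U' assms by (auto simp: Y_def Y'_def intro!: add_in mult_in)
  then have "?U \<in> R" "?V \<in> R" using b U U' two by (auto intro!: add_in mult_in)
  moreover have "2 * ?U + b * ?U\<^sup>2 = (b + 2) * (t + t' + b * ?V)\<^sup>2"
  proof -
    have YV: "t + t' + b * ?V = Y * (1 + b * U') + Y' * (1 + b * U)"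
      by (simp add: Y_def Y'_def algebra_simps)
    have "2 * U + b * U\<^sup>2 = (b + 2) * Y\<^sup>2" "2 * U' + b * U'\<^sup>2 = (b + 2) * Y'\<^sup>2"
      using U U' by (simp_all add: Y_def Y'_def)
    then have zero: "2 * U + b * U\<^sup>2 - (b + 2) * Y\<^sup>2 = 0" "2 * U' + b * U'\<^sup>2 - (b + 2) * Y'\<^sup>2 = 0"
      by simp_all
    \<comment> \<open>With norms \<open>1 + b \<delta>\<close> and \<open>1 + b \<delta>'\<close> of
      the factors, this is \<open>(1 + b \<delta>) (1 + b \<delta>') = 1 + b (\<delta> + \<delta>' +
      b \<delta> \<delta>')\<close>.\<close>
    have "2 * ?U + b * ?U\<^sup>2 - (b + 2) * (Y * (1 + b * U') + Y' * (1 + b * U))\<^sup>2 =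
        (2 * U + b * U\<^sup>2 - (b + 2) * Y\<^sup>2) + (2 * U' + b * U'\<^sup>2 - (b + 2) * Y'\<^sup>2) +
        b * (2 * U + b * U\<^sup>2 - (b + 2) * Y\<^sup>2) * (2 * U' + b * U'\<^sup>2 - (b + 2) * Y'\<^sup>2)"
      by (simp add: power2_eq_square algebra_simps)
    then show ?thesis unfolding YV zero by simp
  qed
  ultimately show "\<exists>U\<in>R. \<exists>V\<in>R. 2 * U + b * U\<^sup>2 = (b + 2) * (t + t' + b * V)\<^sup>2" by blast
qed

text \<open>
  For products, the power of \<open>X + Y \<surd>(a\<^sup>2 - 1)\<close> prescribed by \<open>t'\<close> is taken at the parameter \<open>X\<close>.
\<close>

lemma pell_integer_mult:
  assumes "t \<in> R" "t' \<in> R" "pell_integer R t" "pell_integer R t'"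
  shows "pell_integer R (t * t')"
  unfolding pell_integer_def
proof
  fix b assume b: "b \<in> R"
  obtain U V where U: "U \<in> R" "V \<in> R" "2 * U + b * U\<^sup>2 = (b + 2) * (t + b * V)\<^sup>2"
    using assms b unfolding pell_integer_def by blast
  have "b * U \<in> R" using b U mult_in by blast
  then obtain U' V' where U': "U' \<in> R" "V' \<in> R"
    "2 * U' + (b * U) * U'\<^sup>2 = (b * U + 2) * (t' + b * U * V')\<^sup>2"
    using assms unfolding pell_integer_def by blast
  \<comment> \<open>At parameter \<open>X = 1 + b U\<close> the square root of
    \<open>X\<^sup>2 - 1\<close> is \<open>Y \<surd>d\<close>, so relative to \<surd>d the new
    second component is the product of the two old ones.\<close>
  let ?U = "U * U'" and ?V = "t * U * V' + V * t' + b * V * U * V'"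
  have "?U \<in> R" "?V \<in> R" using assms b U U' by (auto intro!: add_in mult_in)
  moreover have "2 * ?U + b * ?U\<^sup>2 = (b + 2) * (t * t' + b * ?V)\<^sup>2"
  proof -
    have "2 * ?U + b * ?U\<^sup>2 = U * (2 * U' + (b * U) * U'\<^sup>2)" by (simp add: power2_eq_square algebra_simps)
    also have "\<dots> = (2 * U + b * U\<^sup>2) * (t' + b * U * V')\<^sup>2"
      unfolding U' by (simp add: power2_eq_square algebra_simps)
    also have "\<dots> = (b + 2) * ((t + b * V) * (t' + b * U * V'))\<^sup>2"
      unfolding U by (simp add: power_mult_distrib)
    also have "(t + b * V) * (t' + b * U * V') = t * t' + b * ?V" by (simp add: algebra_simps)
    finally show ?thesis .
  qed
  ultimately show "\<exists>U\<in>R. \<exists>V\<in>R. 2 * U + b * U\<^sup>2 = (b + 2) * (t * t' + b * V)\<^sup>2" by blast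
qed

lemma pell_integer_power: "t \<in> R \<Longrightarrow> pell_integer R t \<Longrightarrow> pell_integer R (t ^ k)"
proof (induction k)
  case 0
  then show ?case using pell_integer_one by simp
next
  case (Suc k)
  moreover have "t ^ k \<in> R" using \<open>t \<in> R\<close> by (induction k) (auto simp: one_in mult_in)
  ultimately show ?case using pell_integer_mult by simp
qed

lemma pell_integer_of_int: "pell_integer R (of_int z)"
proof -
  have z0: "pell_integer R 0"
    using pell_integer_add[OF one_in minus_in[OF one_in] pell_integer_one pell_integer_minus[OF pell_integer_one]]
    by simp
  have "pell_integer R (of_nat n)" for n
    by (induction n) (auto simp: z0 pell_integer_one of_nat_in one_in pell_integer_add)
  then show ?thesis by (cases z rule: int_cases2) (auto simp: pell_integer_minus)
qed

end

section \<open>Only integers satisfy the Pell condition over a non-big field\<close>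

lemma complex_subring_ring_of_integers:
  assumes "is_subfield K" shows "complex_subring (ring_of_integers K)"
proof -
  interpret complex_subfield K by unfold_locales fact
  show ?thesis
    by unfold_locales (auto simp: ring_of_integers_def intro: algebraic_int_add algebraic_int_mult)
qed

theorem pell_integer_imp_int:
  assumes K: "K \<in> non_big_fields" and t: "t \<in> ring_of_integers K"
    and pell: "pell_integer (ring_of_integers K) t"
  shows "t \<in> \<int>"
proof (rule ccontr)
  assume "t \<notin> \<int>"
  have Kf: "field_of_algebraic_numbers K" and Ks: "is_subfield K" and "\<not> big K"
    and Kalg: "\<And>x. x \<in> K \<Longrightarrow> algebraic x"
    using K by (auto simp: non_big_fields_def field_of_algebraic_numbers_def)
  then obtain n0 where n0: "n0 > 0" "\<And>F. F \<subseteq> K \<Longrightarrow> number_field F \<Longrightarrow> \<not> n0 dvd degree_over_rat F"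
    unfolding big_def by blast
  interpret K: complex_subfield K by unfold_locales fact
  interpret R: complex_subring "ring_of_integers K" by (rule complex_subring_ring_of_integers[OF Ks])
  have tK: "t \<in> K" and ti: "algebraic_int t" using t by (auto simp: ring_of_integers_def)
  have tQ: "t \<notin> \<rat>" using \<open>t \<notin> \<int>\<close> ti rational_algebraic_int_is_int by blast
  have sub0: "adjoin \<rat> t \<subseteq> K"
    using complex_subfield.adjoin_subset[OF complex_subfield_Rats Ks K.Rats_subset tK] .
  then have alg0: "algebraic x" if "x \<in> adjoin \<rat> t" for x using that Kalg by blast
  obtain f where f: "is_minpoly \<rat> t f"
    using complex_subfield.is_minpoly_exists[OF complex_subfield_Rats] ti by blast
  interpret conjugates t f using f alg0 ti by unfold_locales
  obtain D :: nat where D: "D > 0"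
    "\<And>e \<kappa> k. \<kappa> \<in> \<rat> \<Longrightarrow> algebraic_int (\<kappa> * (\<Sum>k<degree f. of_int (e k) * t ^ k)) \<Longrightarrow>
     k < degree f \<Longrightarrow> algebraic_int (of_nat D * \<kappa> * of_int (e k))"
    using coefficient_denominator by blast
  \<comment> \<open>6 kills torsion, \<open>D\<close> absorbs the denominators from passing to
    coefficients, and \<open>n0\<close> is what remains to divide \<open>c\<close>.\<close>
  define m where "m = 6 * n0 * D"
  have m0: "m > 0" using n0 D by (simp add: m_def)
  define bet where "bet u v = [:of_int u, of_int v :: complex:]" for u v :: int
  define dd where "dd u v = Polynomial.smult (of_nat m) (bet u v) * (Polynomial.smult (of_nat m) (bet u v) + 2)" for u v
  have bet_rat: "bet u v \<in> poly_over \<rat>" for u v by (simp add: bet_def Q.poly_over_pCons)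
  have two: "(2 :: complex poly) \<in> poly_over \<rat>"
  proof -
    have "(2 :: complex poly) = 1 + 1" by simp
    then show ?thesis by (simp only:) (intro Q.poly_over_add Q.poly_over_1)
  qed
  have dd_rat: "dd u v \<in> poly_over \<rat>" for u v
    unfolding dd_def by (intro Q.poly_over_mult Q.poly_over_add Q.poly_over_smult bet_rat two Q.of_nat_closed)
  have betK: "poly (bet u v) t \<in> ring_of_integers K" for u v
    using t by (auto simp: bet_def intro!: R.add_in R.mult_in R.of_int_in)
  have dd_val: "poly (dd u v) x = of_nat m * poly (bet u v) x * (of_nat m * poly (bet u v) x + 2)" for u v x
    by (simp add: dd_def)
  have dvd: "algebraic_int (poly (dd u v) t / of_nat m)" for u v
  proof -
    have "algebraic_int (poly (bet u v) t)" using betK by (simp add: ring_of_integers_def)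
    then have "algebraic_int (poly (bet u v) t * (of_nat m * poly (bet u v) t + 2))"
      by (intro algebraic_int_mult algebraic_int_add) auto
    then show ?thesis using m0 by (simp add: dd_val)
  qed
  have choice: "\<exists>u v \<rho>0. poly (dd u v) t \<noteq> 0 \<and> \<rho>0 \<in> Z \<and>
      ((\<rho>0 \<notin> \<real> \<and> u = 1 \<and> v = 0) \<or> (\<rho>0 \<in> \<real> \<and> (\<exists>\<delta><0. poly (dd u v) \<rho>0 = of_real \<delta>)))"
  proof (cases "Z \<subseteq> \<real>")
    case False
    then obtain \<rho>0 where "\<rho>0 \<in> Z" "\<rho>0 \<notin> \<real>" by auto
    moreover have "poly (dd 1 0) t \<noteq> 0"
    proof -
      have "poly (dd 1 0) t = of_nat (m * (m + 2))" by (simp add: dd_val bet_def algebra_simps)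
      then show ?thesis using m0 by (simp only: of_nat_eq_0_iff) simp
    qed
    ultimately show ?thesis by blast
  next
    case True
    then obtain x where x: "t = of_real x" using t_in_Z by (auto elim: Reals_cases)
    have "x \<notin> \<rat>" using tQ x by (auto elim!: Rats_cases)
    then obtain u v where uv: "- 1 / real m < of_int u + of_int v * x" "of_int u + of_int v * x < 0"
      using small_negative_combination m0 by blast
    \<comment> \<open>\<open>z\<close> is the value of \<open>b\<close>. It lies between -1 and 0,
      so \<open>d = z (z + 2)\<close> is negative at \<open>t\<close>, which itself serves as
      \<open>\<rho>0\<close>.\<close>
    define z where "z = real m * (of_int u + of_int v * x)"
    have "-1 < z" using uv(1) m0 by (simp add: z_def field_simps)
    moreover have "z < 0" unfolding z_def using uv(2) m0 by (intro mult_pos_neg) auto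
    ultimately have z: "-1 < z" "z < 0" by auto
    have "poly (dd u v) t = of_real (z * (z + 2))"
      by (simp add: dd_val bet_def z_def x algebra_simps)
    moreover have "z * (z + 2) < 0" using z by (intro mult_neg_pos) auto
    ultimately have "poly (dd u v) t \<noteq> 0 \<and> (t \<in> \<real> \<and> (\<exists>\<delta><0. poly (dd u v) t = of_real \<delta>))"
      using x by (metis Reals_of_real less_irrefl of_real_eq_0_iff)
    then show ?thesis using t_in_Z by blast
  qed
  then obtain u v \<rho>0 where uv: "poly (dd u v) t \<noteq> 0" and \<rho>0: "\<rho>0 \<in> Z"
    and cs: "(\<rho>0 \<notin> \<real> \<and> u = 1 \<and> v = 0) \<or> (\<rho>0 \<in> \<real> \<and> (\<exists>\<delta><0. poly (dd u v) \<rho>0 = of_real \<delta>))" by blast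
  define d where "d = dd u v"
  define s where "s \<rho> = csqrt (poly d \<rho>)" for \<rho>
  interpret P: pell_conjugates t f m d s
    using m0 dd_rat uv dvd by unfold_locales (auto simp: d_def s_def)
  have special: "(\<forall>P y. P.pell_unit P y \<longrightarrow> cmod (P \<rho>0) = 1) \<or>
      (\<exists>\<rho>'\<in>Z - {\<rho>0}. \<forall>P y. P.pell_unit P y \<longrightarrow> cmod (P \<rho>0) = cmod (P \<rho>'))"
    using cs
  proof
    assume c: "\<rho>0 \<notin> \<real> \<and> u = 1 \<and> v = 0"
    have "cnj \<rho>0 \<in> Z" using \<rho>0 poly_over_Rats_cnj[OF f_rat, of \<rho>0] by (simp add: Z_def)
    moreover have "cnj \<rho>0 \<noteq> \<rho>0" using c Reals_cnj_iff by blast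
    \<comment> \<open>In this case \<open>d\<close> is the constant \<open>m (m + 2)\<close>, so the
      same real square root is chosen at every conjugate.\<close>
    moreover have "s (cnj \<rho>0) = cnj (s \<rho>0)"
    proof -
      have "poly d x = of_real (real (m * (m + 2)))" for x
        using c by (simp add: d_def dd_val bet_def algebra_simps)
      then have "s x = of_real (sqrt (real (m * (m + 2))))" for x
        unfolding s_def by (simp only:) (rule csqrt_of_real, simp)
      then show ?thesis by (simp only: complex_cnj_complex_of_real)
    qed
    ultimately show ?thesis using P.units_conjugate_norm[OF \<rho>0] by blast
  next
    assume "\<rho>0 \<in> \<real> \<and> (\<exists>\<delta><0. poly (dd u v) \<rho>0 = of_real \<delta>)"
    then show ?thesis using P.units_imaginary_norm[OF \<rho>0] unfolding d_def by blast
  qed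
  define \<beta> where "\<beta> = poly (bet u v) t"
  define b where "b = of_nat m * \<beta>"
  have bR: "b \<in> ring_of_integers K" unfolding b_def \<beta>_def by (intro R.mult_in R.of_nat_in betK)
  have dt: "poly d t = b * (b + 2)" by (simp add: d_def dd_val b_def \<beta>_def)
  have "\<exists>U V. U \<in> ring_of_integers K \<and> V \<in> ring_of_integers K \<and> 2 * U + b * U\<^sup>2 = (b + 2) * (t ^ k + b * V)\<^sup>2" for k
    using R.pell_integer_power[OF t pell, of k] bR unfolding pell_integer_def by blast
  then obtain U V where U: "\<And>k. U k \<in> ring_of_integers K" "\<And>k. V k \<in> ring_of_integers K"
    "\<And>k. 2 * U k + b * (U k)\<^sup>2 = (b + 2) * (t ^ k + b * V k)\<^sup>2" by metis
  define X Y where "X k = 1 + b * U k" and "Y k = t ^ k + b * V k" for k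
  have XY: "(X k)\<^sup>2 - poly d t * (Y k)\<^sup>2 = 1" for k
  proof -
    have "(X k)\<^sup>2 - 1 = b * (2 * U k + b * (U k)\<^sup>2)" by (simp add: X_def power2_eq_square algebra_simps)
    also have "\<dots> = poly d t * (Y k)\<^sup>2" unfolding U(3) dt Y_def by simp
    finally show ?thesis by (simp add: algebra_simps)
  qed
  have \<beta>i: "algebraic_int \<beta>" using betK by (simp add: \<beta>_def ring_of_integers_def)
  have Ui: "algebraic_int (U k)" "algebraic_int (V k)" "U k \<in> K" "V k \<in> K" for k
    using U by (auto simp: ring_of_integers_def)
  have bK: "b \<in> K" using bR by (simp add: ring_of_integers_def)
  have XK: "X k \<in> K" "Y k \<in> K" for k
    using bK Ui(3,4)[of k] tK
    by (auto simp: X_def Y_def intro!: K.add_closed K.mult_closed K.power_closed)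
  have cong: "algebraic_int ((X k - 1) / of_nat m)" "algebraic_int ((Y k - t ^ k) / of_nat m)" for k
  proof -
    have "(X k - 1) / of_nat m = \<beta> * U k" "(Y k - t ^ k) / of_nat m = \<beta> * V k"
      using m0 by (simp_all add: X_def Y_def b_def)
    then show "algebraic_int ((X k - 1) / of_nat m)" "algebraic_int ((Y k - t ^ k) / of_nat m)"
      using \<beta>i Ui by (simp_all add: algebraic_int_mult)
  qed
  let ?F = "adjoin \<rat> t" and ?n = "degree f"
  have F: "number_field ?F" using number_field_adjoin[OF number_field_Rats(1) f alg0] by simp
  interpret F: complex_subfield ?F by (rule number_field_subfield[OF F])
  \<comment> \<open>One field \<open>G\<close> holds all solutions, so that their norms share the
    factor \<open>c\<close>.\<close>
  have "set (map X [0..<?n] @ map Y [0..<?n]) \<subseteq> K" using XK by auto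
  then obtain G c where G: "number_field G" "G \<subseteq> K" "set (map X [0..<?n] @ map Y [0..<?n]) \<subseteq> G"
    "pell_norm c ?F G" "degree_over_rat G = c * degree_over_rat ?F"
    using pell_norm_extension[OF Kf F sub0] by blast
  have "\<exists>A B. A \<in> poly_over \<rat> \<and> B \<in> poly_over \<rat> \<and> (poly A t)\<^sup>2 - poly d t * (poly B t)\<^sup>2 = 1 \<and>
      algebraic_int ((poly A t - 1) / of_nat m) \<and> algebraic_int ((poly B t - of_nat c * t ^ k) / of_nat m)"
    if k: "k < ?n" for k
  proof -
    have XG: "X k \<in> G" "Y k \<in> G" using G(3) k by auto
    have dF: "poly d t \<in> ?F" using P.d_rat by (auto simp: adjoin_def)
    have tF: "t ^ k \<in> ?F" using Q.generator_in_adjoin by (rule F.power_closed)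
    have "\<exists>A\<in>?F. \<exists>B\<in>?F. A\<^sup>2 - poly d t * B\<^sup>2 = 1 \<and> algebraic_int ((A - 1) / of_nat m) \<and>
        algebraic_int ((B - of_nat c * t ^ k) / of_nat m)"
      using G(4)[unfolded pell_norm_def, rule_format, OF dF tF F.of_nat_closed[of m] _ _ P.d_dvd
          algebraic_int_power[OF ti] XG XY cong] m0 by simp
    then show ?thesis unfolding adjoin_def by auto
  qed
  then obtain A B where AB: "\<And>k. k < ?n \<Longrightarrow> A k \<in> poly_over \<rat>" "\<And>k. k < ?n \<Longrightarrow> B k \<in> poly_over \<rat>"
    "\<And>k. k < ?n \<Longrightarrow> (poly (A k) t)\<^sup>2 - poly d t * (poly (B k) t)\<^sup>2 = 1"
    "\<And>k. k < ?n \<Longrightarrow> algebraic_int ((poly (A k) t - 1) / of_nat m)"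
    "\<And>k. k < ?n \<Longrightarrow> algebraic_int ((poly (B k) t - of_nat c * t ^ k) / of_nat m)" by metis
  have inv_m: "1 / of_nat m \<in> (\<rat> :: complex set)" by (intro Q.divide_closed Q.one_closed Q.of_nat_closed)
  \<comment> \<open>Equation and congruences are identities over the rationals at \<open>t\<close>,
    hence hold at each conjugate \<rho>, with residue \<open>c \<rho> ^ k\<close> there.\<close>
  have unit: "P.pell_unit (\<lambda>\<rho>. poly (A k) \<rho> + poly (B k) \<rho> * s \<rho>) (\<lambda>\<rho>. of_nat c * \<rho> ^ k)" if k: "k < ?n" for k
    unfolding P.pell_unit_def
  proof (rule conjI, rule ballI, goal_cases)
    case (1 \<rho>)
    then show ?case
      using conjugate_algebraic_int[OF 1] by (intro algebraic_int_mult algebraic_int_power) auto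
  next
    case 2
    show ?case
    proof (rule bexI[of _ "A k"], rule bexI[of _ "B k"], rule ballI, intro conjI)
      fix \<rho> assume \<rho>: "\<rho> \<in> Z"
      have "poly ((A k)\<^sup>2 - d * (B k)\<^sup>2 - 1) \<rho> = 0"
        using AB[OF k] P.d_rat
        by (intro root_transfer[OF _ _ \<rho>] Q.poly_over_diff Q.poly_over_mult Q.poly_over_power Q.poly_over_1) auto
      then show "(poly (A k) \<rho>)\<^sup>2 - poly d \<rho> * (poly (B k) \<rho>)\<^sup>2 = 1" by simp
      have "algebraic_int (poly (Polynomial.smult (1 / of_nat m) (A k - 1)) \<rho>)"
        using AB[OF k] inv_m
        by (intro algebraic_int_transfer[OF _ _ \<rho>] Q.poly_over_smult Q.poly_over_diff Q.poly_over_1) auto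
      then show "algebraic_int ((poly (A k) \<rho> - 1) / of_nat m)" by simp
      have "algebraic_int (poly (Polynomial.smult (1 / of_nat m) (B k - monom (of_nat c) k)) \<rho>)"
        using AB[OF k] inv_m
        by (intro algebraic_int_transfer[OF _ _ \<rho>] Q.poly_over_smult Q.poly_over_diff Q.poly_over_monom)
          (auto simp: poly_monom)
      then show "algebraic_int ((poly (B k) \<rho> - of_nat c * \<rho> ^ k) / of_nat m)" by (simp add: poly_monom)
    qed (use AB k in simp_all)
  qed
  have m6: "6 dvd m" by (simp add: m_def)
  have "\<exists>e :: nat \<Rightarrow> int. Gcd (e ` {..<?n}) = 1 \<and>
      algebraic_int ((\<Sum>k<?n. of_int (e k) * (of_nat c * t ^ k)) / of_nat m)"
    by (rule P.primitive_unit_relation[OF \<rho>0 special unit m6])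
  then obtain e where e: "Gcd (e ` {..<?n}) = 1"
    "algebraic_int ((\<Sum>k<?n. of_int (e k) * (of_nat c * t ^ k)) / of_nat m)" by blast
  \<comment> \<open>Moving \<open>c / m\<close> out as a rational factor leaves the primitive
    integers \<open>e k\<close> as coefficients.\<close>
  have "algebraic_int ((of_nat c / of_nat m) * (\<Sum>k<?n. of_int (e k) * t ^ k))"
  proof -
    have "(\<Sum>k<?n. of_int (e k) * (of_nat c * t ^ k)) / of_nat m =
        (of_nat c / of_nat m) * (\<Sum>k<?n. of_int (e k) * t ^ k)"
      by (simp add: sum_distrib_left sum_divide_distrib mult_ac)
    then show ?thesis using e(2) by (simp only:)
  qed
  moreover have "of_nat c / of_nat m \<in> (\<rat> :: complex set)" by (intro Q.divide_closed Q.of_nat_closed)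
  ultimately have De: "algebraic_int (of_nat D * (of_nat c / of_nat m) * of_int (e k) :: complex)" if "k < ?n" for k
    using D(2) that by blast
  have "int (6 * n0) dvd int c * e k" if k: "k < ?n" for k
  proof -
    have "of_nat D * (of_nat c / of_nat m) * of_int (e k) = (of_int (int c * e k) / of_int (int (6 * n0)) :: complex)"
      using D(1) n0(1) by (simp add: m_def field_simps)
    then have "algebraic_int (of_int (int c * e k) / of_int (int (6 * n0)) :: complex)" using De[OF k] by (simp only:)
    moreover have "of_int (int c * e k) / of_int (int (6 * n0)) \<in> (\<rat> :: complex set)"
      by (intro Q.divide_closed Q.of_int_closed)
    ultimately have "of_int (int c * e k) / of_int (int (6 * n0)) \<in> (\<int> :: complex set)"
      by (rule rational_algebraic_int_is_int)
    then obtain z where "of_int (int c * e k) / of_int (int (6 * n0)) = (of_int z :: complex)" by (auto elim: Ints_cases)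
    then have "(of_int (int c * e k) :: complex) = of_int (z * int (6 * n0))"
      using n0(1) by (simp add: field_simps)
    then have "int c * e k = z * int (6 * n0)" by (simp only: of_int_eq_iff)
    then show ?thesis by simp
  qed
  \<comment> \<open>Primitivity eliminates the exponents: the gcd of all \<open>c * e k\<close> is
    \<open>c\<close>.\<close>
  then have "int (6 * n0) dvd Gcd ((*) (int c) ` e ` {..<?n})" by (auto simp: dvd_Gcd_iff)
  also have "\<dots> = int c" using e(1) by (simp add: Gcd_mult)
  finally have "6 * n0 dvd c" by (simp only: int_dvd_int_iff)
  then have "n0 dvd c" using dvd_mult_right by blast
  then have "n0 dvd degree_over_rat G" using G(5) by simp
  then show False using n0(2)[OF G(2,1)] by blast
qed

theorem pell_integer_iff:
  assumes "K \<in> non_big_fields" "t \<in> ring_of_integers K"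
  shows "pell_integer (ring_of_integers K) t \<longleftrightarrow> t \<in> \<int>"
proof
  assume "t \<in> \<int>"
  moreover have "is_subfield K" using assms(1) by (simp add: non_big_fields_def field_of_algebraic_numbers_def)
  ultimately show "pell_integer (ring_of_integers K) t"
    using complex_subring.pell_integer_of_int[OF complex_subring_ring_of_integers] by (auto elim: Ints_cases)
qed (rule pell_integer_imp_int[OF assms])

section \<open>Arithmetic in rings with definable integers\<close>

definition rational_four_squares :: "int \<Rightarrow> bool" where
  "rational_four_squares n \<longleftrightarrow> (\<exists>v a b c d. v \<noteq> 0 \<and> n * v\<^sup>2 = a\<^sup>2 + b\<^sup>2 + c\<^sup>2 + d\<^sup>2)"

lemma rational_four_squaresI:
  "v \<noteq> 0 \<Longrightarrow> n * v\<^sup>2 = a\<^sup>2 + b\<^sup>2 + c\<^sup>2 + d\<^sup>2 \<Longrightarrow> rational_four_squares n"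
  unfolding rational_four_squares_def by blast

text \<open>Euler's four-square identity; the denominators multiply.\<close>

lemma rational_four_squares_mult:
  assumes "rational_four_squares m" "rational_four_squares n"
  shows "rational_four_squares (m * n)"
proof -
  from assms obtain v a b c d w x y z t where
    1: "v \<noteq> 0" "m * v\<^sup>2 = a\<^sup>2 + b\<^sup>2 + c\<^sup>2 + d\<^sup>2" and 2: "w \<noteq> 0" "n * w\<^sup>2 = x\<^sup>2 + y\<^sup>2 + z\<^sup>2 + t\<^sup>2"
    unfolding rational_four_squares_def by blast
  have "m * n * (v * w)\<^sup>2 = (m * v\<^sup>2) * (n * w\<^sup>2)" by (simp add: power_mult_distrib)
  also have "\<dots> = (a*x + b*y + c*z + d*t)\<^sup>2 + (a*y - b*x + c*t - d*z)\<^sup>2 +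
      (a*z - b*t - c*x + d*y)\<^sup>2 + (a*t + b*z - c*y - d*x)\<^sup>2"
    unfolding 1 2 by (simp add: power2_eq_square algebra_simps)
  finally show ?thesis using 1 2 by (intro rational_four_squaresI[of "v * w"]) auto
qed

text \<open>Pigeonhole: with \<open>a\<close> and \<open>b\<close> in
  \<open>{0..(p - 1) div 2}\<close>, the squares \<open>a\<^sup>2\<close> and the numbers
  \<open>- 1 - b\<^sup>2\<close> give \<open>p + 1\<close> residues in total, so one is common. The
  size of \<open>a\<close> and \<open>b\<close> forces \<open>m < p\<close>.\<close>

lemma prime_dvd_sum_two_squares_plus_one:
  fixes p :: int
  assumes p: "prime p" "odd p"
  shows "\<exists>a b m. a\<^sup>2 + b\<^sup>2 + 1 = m * p \<and> 0 < m \<and> m < p"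
proof -
  define h where "h = (p - 1) div 2"
  have ph: "p = 2 * h + 1" using p(2) by (auto simp: h_def elim!: oddE)
  have p2: "p \<ge> 2" using p prime_ge_2_int by blast
  have h1: "h \<ge> 1" using p2 ph by linarith
  define F where "F a = a\<^sup>2 mod p" for a :: int
  define G where "G b = (- 1 - b\<^sup>2) mod p" for b :: int
  have inj: "a = a'" if "a \<in> {0..h}" "a' \<in> {0..h}" "p dvd a\<^sup>2 - a'\<^sup>2" for a a'
  proof -
    have "p dvd (a - a') * (a + a')" using that(3) by (simp add: power2_eq_square algebra_simps)
    then have "p dvd a - a' \<or> p dvd a + a'" using p(1) prime_dvd_multD by blast
    then show ?thesis
    proof
      assume "p dvd a - a'"
      moreover have "\<bar>a - a'\<bar> < p" using that ph by auto
      ultimately show ?thesis using dvd_imp_le_int[of "a - a'" p] p2 by fastforce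
    next
      assume "p dvd a + a'"
      moreover have "\<bar>a + a'\<bar> < p" using that ph by auto
      ultimately have "a + a' = 0" using dvd_imp_le_int[of "a + a'" p] p2 by fastforce
      then show ?thesis using that by auto
    qed
  qed
  have "inj_on F {0..h}"
  proof (rule inj_onI)
    fix a a' assume "a \<in> {0..h}" "a' \<in> {0..h}" "F a = F a'"
    then show "a = a'" by (intro inj) (auto simp: F_def mod_eq_dvd_iff)
  qed
  then have cF: "card (F ` {0..h}) = nat (h + 1)" by (simp add: card_image)
  have "inj_on G {0..h}"
  proof (rule inj_onI)
    fix a a' assume *: "a \<in> {0..h}" "a' \<in> {0..h}" "G a = G a'"
    then have "p dvd (- 1 - a'\<^sup>2) - (- 1 - a\<^sup>2)" unfolding G_def by (metis mod_eq_dvd_iff)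
    then show "a = a'" using * by (intro inj) auto
  qed
  then have cG: "card (G ` {0..h}) = nat (h + 1)" by (simp add: card_image)
  have sub: "F ` {0..h} \<union> G ` {0..h} \<subseteq> {0..<p}" using p2 by (auto simp: F_def G_def)
  have "F ` {0..h} \<inter> G ` {0..h} \<noteq> {}"
  proof
    assume "F ` {0..h} \<inter> G ` {0..h} = {}"
    then have "card (F ` {0..h} \<union> G ` {0..h}) = nat (h + 1) + nat (h + 1)"
      using cF cG by (simp add: card_Un_disjoint)
    moreover have "card (F ` {0..h} \<union> G ` {0..h}) \<le> nat p" using card_mono[OF _ sub] by simp
    ultimately show False using ph h1 by linarith
  qed
  then obtain a b where ab: "a \<in> {0..h}" "b \<in> {0..h}" "F a = G b" by blast
  then have "p dvd a\<^sup>2 - (- 1 - b\<^sup>2)" by (simp add: F_def G_def mod_eq_dvd_iff)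
  then obtain m where m: "a\<^sup>2 + b\<^sup>2 + 1 = m * p" by (auto simp: dvd_def algebra_simps)
  have "m * p > 0" unfolding m[symmetric] by (simp add: add_nonneg_pos)
  then have "m > 0" using p2 by (simp add: zero_less_mult_iff)
  moreover have "m < p"
  proof -
    have "a\<^sup>2 \<le> h\<^sup>2" "b\<^sup>2 \<le> h\<^sup>2" using ab by (auto intro!: power_mono)
    then have "m * p \<le> 2 * h\<^sup>2 + 1" using m by simp
    also have "\<dots> < p * p" unfolding ph power2_eq_square using h1 by (simp add: algebra_simps) (smt (verit) mult_pos_pos)
    finally show ?thesis using p2 by simp
  qed
  ultimately show ?thesis using m by blast
qed

text \<open>The denominator replaces Lagrange's descent: for a prime \<open>n\<close> with
  \<open>m * n\<close> a sum of squares and \<open>m < n\<close>, the product of the representations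
  of \<open>m\<close> and \<open>m * n\<close> represents \<open>n\<close> with \<open>m\<close>
  joining the denominator.\<close>

lemma rational_four_squares_nat: "rational_four_squares (int n)"
proof (induction n rule: less_induct)
  case (less n)
  consider "n \<le> 2" | "n > 2" "prime n" | "n > 2" "\<not> prime n" by linarith
  then show ?case
  proof cases
    case 1
    have "rational_four_squares 0" by (rule rational_four_squaresI[of 1 _ 0 0 0 0]) auto
    moreover have "rational_four_squares 1" by (rule rational_four_squaresI[of 1 _ 1 0 0 0]) auto
    moreover have "rational_four_squares 2" by (rule rational_four_squaresI[of 1 _ 1 1 0 0]) auto
    moreover have "n = 0 \<or> n = 1 \<or> n = 2" using 1 by auto
    ultimately show ?thesis by auto
  next
    case 2
    then have "odd n" by (auto simp: prime_odd_nat)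
    then obtain a b m where m: "a\<^sup>2 + b\<^sup>2 + 1 = m * int n" "0 < m" "m < int n"
      using prime_dvd_sum_two_squares_plus_one[of "int n"] 2 by auto
    have "rational_four_squares m" using less[of "nat m"] m by simp
    moreover have "rational_four_squares (m * int n)"
      using m(1) by (intro rational_four_squaresI[of 1 _ a b 1 0]) auto
    ultimately have "rational_four_squares (m * (m * int n))" by (rule rational_four_squares_mult)
    then obtain v a b c d where "v \<noteq> 0" "m * (m * int n) * v\<^sup>2 = a\<^sup>2 + b\<^sup>2 + c\<^sup>2 + d\<^sup>2"
      unfolding rational_four_squares_def by blast
    moreover have "m * (m * int n) * v\<^sup>2 = int n * (m * v)\<^sup>2" by (simp add: power2_eq_square)
    ultimately show ?thesis using m by (intro rational_four_squaresI[of "m * v"]) auto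
  next
    case 3
    then obtain a where a: "a dvd n" "a \<noteq> 1" "a \<noteq> n" by (auto simp: prime_nat_iff)
    then obtain b where b: "n = a * b" by (auto simp: dvd_def)
    then have "a \<noteq> 0" "b \<noteq> 0" "b \<noteq> 1" using a 3 by auto
    then have ab: "n = a * b" "1 < a" "1 < b" using a b by auto
    then have "a < n" "b < n" by auto
    then show ?thesis using rational_four_squares_mult[OF less[of a] less[of b]] ab by simp
  qed
qed

lemma int_nonneg_iff_rational_four_squares: "n \<ge> 0 \<longleftrightarrow> rational_four_squares n"
proof
  assume "n \<ge> 0"
  then show "rational_four_squares n" using rational_four_squares_nat[of "nat n"] by simp
next
  assume "rational_four_squares n"
  then obtain v a b c d where v: "v \<noteq> 0" "n * v\<^sup>2 = a\<^sup>2 + b\<^sup>2 + c\<^sup>2 + d\<^sup>2"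
    unfolding rational_four_squares_def by blast
  then have "n * v\<^sup>2 \<ge> 0" by simp
  moreover have "v\<^sup>2 > 0" using v by simp
  ultimately show "n \<ge> 0" by (simp add: zero_le_mult_iff)
qed

primrec nval :: "(nat \<Rightarrow> nat) \<Rightarrow> rterm \<Rightarrow> nat" where
  "nval e (Var i) = e i"
| "nval e Zero = 0"
| "nval e One = 1"
| "nval e (Add s t) = nval e s + nval e t"
| "nval e (Mul s t) = nval e s * nval e t"

lemma tval_of_nat: "tval (\<lambda>i. of_nat (e i)) s = of_nat (nval e s)"
  by (induction s) simp_all

text \<open>\<open>at_var i \<phi>\<close> is \<open>\<phi>\<close> with variable \<open>i\<close> substituted for the variable \<open>0\<close>.\<close>

definition at_var :: "nat \<Rightarrow> rform \<Rightarrow> rform" where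
  "at_var i \<phi> = (if i = 0 then \<phi> else Exists 0 (Conj (Eq (Var 0) (Var i)) \<phi>))"

lemma sat_at_var: "e i \<in> R \<Longrightarrow> sat R e (at_var i \<phi>) \<longleftrightarrow> sat R (e(0 := e i)) \<phi>"
  by (auto simp: at_var_def)

section \<open>Coding of finite sequences and of computations\<close>

definition beta :: "nat \<Rightarrow> nat \<Rightarrow> nat \<Rightarrow> nat" where
  "beta c d i = c mod (1 + (i + 1) * d)"

text \<open>Chinese remaindering with \<open>d = fact s\<close>: a prime common to two moduli
  divides \<open>(j - i) * d\<close>, hence \<open>d\<close>, hence 1. Including all values in
  \<open>s\<close> makes each modulus exceed its residue.\<close>

lemma beta_exists: "\<exists>c d. \<forall>i\<le>N. beta c d i = a i"
proof -
  define s where "s = N + (\<Sum>i\<le>N. a i) + 1"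
  define d :: nat where "d = fact s"
  have cop: "coprime (1 + (i + 1) * d) (1 + (j + 1) * d)" if "i \<le> N" "j \<le> N" "i < j" for i j
  proof (rule ccontr)
    assume "\<not> coprime (1 + (i + 1) * d) (1 + (j + 1) * d)"
    then obtain q where q: "prime q" "q dvd 1 + (i + 1) * d" "q dvd 1 + (j + 1) * d"
      using prime_factor_nat[of "gcd (1 + (i + 1) * d) (1 + (j + 1) * d)"] by (auto simp: coprime_iff_gcd_eq_1)
    have "q dvd (1 + (j + 1) * d) - (1 + (i + 1) * d)" by (rule dvd_diff_nat[OF q(3,2)])
    also have "(1 + (j + 1) * d) - (1 + (i + 1) * d) = (j - i) * d" by (simp add: diff_mult_distrib)
    finally have "q dvd j - i \<or> q dvd d" using q(1) by (simp add: prime_dvd_mult_iff)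
    moreover have "q dvd d" if "q dvd j - i"
    proof -
      have "q \<le> j - i" using that \<open>i < j\<close> by (intro dvd_imp_le) auto
      then have "q \<le> s" using \<open>j \<le> N\<close> by (simp add: s_def)
      then show ?thesis unfolding d_def using prime_ge_1_nat[OF q(1)] by (intro dvd_fact)
    qed
    ultimately have "q dvd d" by blast
    then have "q dvd (i + 1) * d" by simp
    then have "q dvd 1" using q(2) dvd_add_left_iff by blast
    then show False using q(1) by simp
  qed
  have "\<forall>i\<in>{..N}. \<forall>j\<in>{..N}. i \<noteq> j \<longrightarrow> coprime (1 + (i + 1) * d) (1 + (j + 1) * d)"
    using cop by (metis atMost_iff coprime_commute nat_neq_iff)
  then obtain c where c: "\<forall>i\<in>{..N}. [c = a i] (mod (1 + (i + 1) * d))"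
    using chinese_remainder_nat[of "{..N}" "\<lambda>i. 1 + (i + 1) * d" a] by auto
  have "beta c d i = a i" if "i \<le> N" for i
  proof -
    have "a i \<le> (\<Sum>i\<le>N. a i)" using that by (intro member_le_sum) auto
    also have "\<dots> \<le> s" by (simp add: s_def)
    also have "s \<le> d" unfolding d_def by (rule fact_ge_self)
    also have "d < 1 + (i + 1) * d" by simp
    finally show ?thesis using c that by (simp add: beta_def cong_def)
  qed
  then show ?thesis by blast
qed

lemma reval_zero_iff: "reval RZero xs y \<longleftrightarrow> y = 0"
  by (auto intro: reval_zero elim: reval.cases)

lemma reval_succ_iff: "reval RSucc xs y \<longleftrightarrow> (\<exists>x. xs = [x] \<and> y = Suc x)"
  by (auto intro: reval_succ elim: reval.cases)

lemma reval_proj_iff: "reval (RProj i) xs y \<longleftrightarrow> i < length xs \<and> y = xs ! i"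
  by (auto intro: reval_proj elim: reval.cases)

lemma reval_comp_iff:
  "reval (RComp f gs) xs z \<longleftrightarrow> (\<exists>ys. list_all2 (\<lambda>g y. reval g xs y) gs ys \<and> reval f ys z)"
proof
  assume "reval (RComp f gs) xs z"
  then show "\<exists>ys. list_all2 (\<lambda>g y. reval g xs y) gs ys \<and> reval f ys z"
    by (cases rule: reval.cases) auto
qed (auto intro: reval_comp)

lemma reval_min_iff:
  "reval (RMin f) xs n \<longleftrightarrow> reval f (n # xs) 0 \<and> (\<forall>m<n. \<exists>y. reval f (m # xs) (Suc y))"
proof
  assume "reval (RMin f) xs n"
  then show "reval f (n # xs) 0 \<and> (\<forall>m<n. \<exists>y. reval f (m # xs) (Suc y))"
    by (cases rule: reval.cases) auto
qed (auto intro: reval_min)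

lemma reval_prec_Nil: "\<not> reval (RPrec f g) [] z"
  by (auto elim: reval.cases)

text \<open>Primitive recursion as the existence of the sequence of its intermediate values, which
  is the shape that the beta function can encode.\<close>

lemma reval_prec_iff:
  "reval (RPrec f g) (N # xs) z \<longleftrightarrow>
     (\<exists>a. reval f xs (a 0) \<and> (\<forall>m<N. reval g (m # a m # xs) (a (Suc m))) \<and> z = a N)"
proof (induction N arbitrary: z)
  case 0
  have "reval (RPrec f g) (0 # xs) z \<longleftrightarrow> reval f xs z"
    by (auto intro: reval_prec_0 elim: reval.cases)
  then show ?case by (auto intro: exI[of _ "\<lambda>_. z"])
next
  case (Suc N)
  have "reval (RPrec f g) (Suc N # xs) z \<longleftrightarrow> (\<exists>y. reval (RPrec f g) (N # xs) y \<and> reval g (N # y # xs) z)"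
    by (auto intro: reval_prec_Suc elim: reval.cases)
  also have "\<dots> \<longleftrightarrow> (\<exists>a. reval f xs (a 0) \<and> (\<forall>m<N. reval g (m # a m # xs) (a (Suc m))) \<and> reval g (N # a N # xs) z)"
    unfolding Suc by blast
  also have "\<dots> \<longleftrightarrow> (\<exists>a. reval f xs (a 0) \<and> (\<forall>m<Suc N. reval g (m # a m # xs) (a (Suc m))) \<and> z = a (Suc N))"
  proof
    assume "\<exists>a. reval f xs (a 0) \<and> (\<forall>m<N. reval g (m # a m # xs) (a (Suc m))) \<and> reval g (N # a N # xs) z"
    then obtain a where a: "reval f xs (a 0)" "\<forall>m<N. reval g (m # a m # xs) (a (Suc m))" "reval g (N # a N # xs) z"
      by blast
    show "\<exists>a. reval f xs (a 0) \<and> (\<forall>m<Suc N. reval g (m # a m # xs) (a (Suc m))) \<and> z = a (Suc N)"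
      using a by (intro exI[of _ "a(Suc N := z)"]) (auto simp: less_Suc_eq)
  qed auto
  finally show ?case .
qed

text \<open>The substitution of a numeral is written with a quantifier, so the code of the instance
  is a simple function of \<open>n\<close> and the code of the formula.\<close>

definition instance_form :: "nat \<Rightarrow> rform \<Rightarrow> rform" where
  "instance_form n \<phi> = Exists 0 (Conj (Eq (Var 0) (nat_tm n)) \<phi>)"

definition instance_code :: "nat \<Rightarrow> nat \<Rightarrow> nat" where
  "instance_code n k = prod_encode (4, prod_encode (0, prod_encode (2,
     prod_encode (prod_encode (0, prod_encode (tcode (Var 0), tcode (nat_tm n))), k))))"

lemma fcode_instance_form: "fcode (instance_form n \<phi>) = instance_code n (fcode \<phi>)"
  by (simp add: instance_form_def instance_code_def)

lemma finite_tvars: "finite (tvars t)" by (induction t) auto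

lemma finite_fvars: "finite (fvars \<phi>)" by (induction \<phi>) (auto simp: finite_tvars)

section \<open>Arithmetical predicates over a ring with definable integers\<close>

locale int_definable =
  fixes R :: "complex set" and \<zeta> :: rform
  assumes Ints_subset: "\<int> \<subseteq> R"
    and sat_int: "e 0 \<in> R \<Longrightarrow> sat R e \<zeta> \<longleftrightarrow> e 0 \<in> \<int>"
begin

text \<open>The auxiliary variables are confined to the integers too, since sums of squares in
  \<open>R\<close> may be negative.\<close>

definition nat_form :: rform where
  "nat_form = Conj \<zeta> (Exists 1 (Exists 2 (Exists 3 (Exists 4 (Exists 5
     (Conj (at_var 1 \<zeta>) (Conj (at_var 2 \<zeta>) (Conj (at_var 3 \<zeta>) (Conj (at_var 4 \<zeta>) (Conj (at_var 5 \<zeta>)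
     (Conj (Neg (Eq (Var 5) Zero))
       (Eq (Mul (Var 0) (Mul (Var 5) (Var 5)))
         (Add (Add (Mul (Var 1) (Var 1)) (Mul (Var 2) (Var 2)))
              (Add (Mul (Var 3) (Var 3)) (Mul (Var 4) (Var 4))))))))))))))))"

lemma of_int_in: "of_int z \<in> R" and of_nat_in: "of_nat n \<in> R"
  using Ints_subset by (auto simp: Ints_of_int Ints_of_nat subsetD)

lemma sat_nat_form:
  assumes "e 0 \<in> R" shows "sat R e nat_form \<longleftrightarrow> e 0 \<in> \<nat>"
proof -
  have "sat R e nat_form \<longleftrightarrow> e 0 \<in> \<int> \<and> (\<exists>a\<in>\<int>. \<exists>b\<in>\<int>. \<exists>c\<in>\<int>. \<exists>d\<in>\<int>. \<exists>v\<in>\<int>.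
      v \<noteq> 0 \<and> e 0 * (v * v) = a * a + b * b + (c * c + d * d))"
  proof -
    have "sat R e nat_form \<longleftrightarrow> e 0 \<in> \<int> \<and> (\<exists>a\<in>R. \<exists>b\<in>R. \<exists>c\<in>R. \<exists>d\<in>R. \<exists>v\<in>R.
        a \<in> \<int> \<and> b \<in> \<int> \<and> c \<in> \<int> \<and> d \<in> \<int> \<and> v \<in> \<int> \<and>
        v \<noteq> 0 \<and> e 0 * (v * v) = a * a + b * b + (c * c + d * d))"
      using assms by (simp add: nat_form_def sat_at_var sat_int cong: bex_cong)
    then show ?thesis using Ints_subset by blast
  qed
  also have "\<dots> \<longleftrightarrow> e 0 \<in> \<nat>"
  proof
    assume "e 0 \<in> \<int> \<and> (\<exists>a\<in>\<int>. \<exists>b\<in>\<int>. \<exists>c\<in>\<int>. \<exists>d\<in>\<int>. \<exists>v\<in>\<int>.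
      v \<noteq> 0 \<and> e 0 * (v * v) = a * a + b * b + (c * c + d * d))"
    then obtain n v a b c d where h: "e 0 = of_int n" "(of_int v :: complex) \<noteq> 0"
      "(of_int n * (of_int v * of_int v) :: complex) = of_int a * of_int a + of_int b * of_int b +
        (of_int c * of_int c + of_int d * of_int d)" by (metis Ints_cases)
    from h(3) have "(of_int (n * v\<^sup>2) :: complex) = of_int (a\<^sup>2 + b\<^sup>2 + c\<^sup>2 + d\<^sup>2)" by (simp add: power2_eq_square)
    then have "n * v\<^sup>2 = a\<^sup>2 + b\<^sup>2 + c\<^sup>2 + d\<^sup>2" by (simp only: of_int_eq_iff)
    moreover have "v \<noteq> 0" using h(2) by simp
    ultimately have "n \<ge> 0" unfolding int_nonneg_iff_rational_four_squares rational_four_squares_def by blast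
    then have "e 0 = of_nat (nat n)" using h(1) by simp
    then show "e 0 \<in> \<nat>" by simp
  next
    assume "e 0 \<in> \<nat>"
    then obtain n where n: "e 0 = of_nat n" by (auto elim: Nats_cases)
    obtain v a b c d :: int where h: "v \<noteq> 0" "int n * v\<^sup>2 = a\<^sup>2 + b\<^sup>2 + c\<^sup>2 + d\<^sup>2"
      using rational_four_squares_nat[of n] unfolding rational_four_squares_def by blast
    have "(of_int (int n * v\<^sup>2) :: complex) = of_int (a\<^sup>2 + b\<^sup>2 + c\<^sup>2 + d\<^sup>2)" by (simp only: h)
    then have "e 0 * (of_int v * of_int v) = of_int a * of_int a + of_int b * of_int b +
        (of_int c * of_int c + of_int d * of_int d)" using n by (simp add: power2_eq_square)
    moreover have "(of_int v :: complex) \<noteq> 0" using h by simp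
    moreover have "e 0 \<in> \<int>" using n by simp
    ultimately show "e 0 \<in> \<int> \<and> (\<exists>a\<in>\<int>. \<exists>b\<in>\<int>. \<exists>c\<in>\<int>. \<exists>d\<in>\<int>. \<exists>v\<in>\<int>.
      v \<noteq> 0 \<and> e 0 * (v * v) = a * a + b * b + (c * c + d * d))" using Ints_of_int by blast
  qed
  finally show ?thesis .
qed

text \<open>Definability by a formula over \<open>R\<close>, kept semantic: the closure rules build
  predicates on environments of naturals while the formulas stay hidden.\<close>

definition arith :: "((nat \<Rightarrow> nat) \<Rightarrow> bool) \<Rightarrow> bool" where
  "arith P \<longleftrightarrow> (\<exists>\<phi>. \<forall>e. sat R (\<lambda>i. of_nat (e i)) \<phi> \<longleftrightarrow> P e)"

lemma arith_eq: "arith (\<lambda>e. nval e s = nval e t)"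
  unfolding arith_def by (rule exI[of _ "Eq s t"]) (simp add: tval_of_nat)

lemma arith_neg: "arith P \<Longrightarrow> arith (\<lambda>e. \<not> P e)"
  unfolding arith_def
proof (elim exE)
  fix \<phi> assume "\<forall>e. sat R (\<lambda>i. of_nat (e i)) \<phi> = P e"
  then show "\<exists>\<phi>. \<forall>e. sat R (\<lambda>i. of_nat (e i)) \<phi> = (\<not> P e)" by (intro exI[of _ "Neg \<phi>"]) simp
qed

lemma arith_conj: "arith P \<Longrightarrow> arith Q \<Longrightarrow> arith (\<lambda>e. P e \<and> Q e)"
  unfolding arith_def
proof (elim exE)
  fix \<phi> \<psi>
  assume "\<forall>e. sat R (\<lambda>i. of_nat (e i)) \<phi> = P e" "\<forall>e. sat R (\<lambda>i. of_nat (e i)) \<psi> = Q e"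
  then show "\<exists>\<phi>. \<forall>e. sat R (\<lambda>i. of_nat (e i)) \<phi> = (P e \<and> Q e)" by (intro exI[of _ "Conj \<phi> \<psi>"]) simp
qed

lemma arith_imp: "arith P \<Longrightarrow> arith Q \<Longrightarrow> arith (\<lambda>e. P e \<longrightarrow> Q e)"
proof -
  assume "arith P" "arith Q"
  then have "arith (\<lambda>e. \<not> (P e \<and> \<not> Q e))" by (intro arith_neg arith_conj)
  then show ?thesis by simp
qed

lemma arith_False: "arith (\<lambda>e. False)"
  using arith_eq[of Zero One] by simp

lemma arith_ex_var: 
  assumes "arith P" shows "arith (\<lambda>e. \<exists>n. P (e(i := n)))"
proof -
  obtain \<phi> where \<phi>: "\<And>e. sat R (\<lambda>i. of_nat (e i)) \<phi> \<longleftrightarrow> P e" using assms unfolding arith_def by blast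
  have upd: "(\<lambda>j. of_nat (e j))(i := of_nat n) = (\<lambda>j. of_nat ((e(i := n)) j) :: complex)" for e n by auto
  have "sat R (\<lambda>j. of_nat (e j)) (Exists i (Conj (at_var i nat_form) \<phi>)) \<longleftrightarrow> (\<exists>n. P (e(i := n)))" for e
  proof -
    have "sat R (\<lambda>j. of_nat (e j)) (Exists i (Conj (at_var i nat_form) \<phi>)) \<longleftrightarrow>
        (\<exists>a\<in>R. a \<in> \<nat> \<and> sat R ((\<lambda>j. of_nat (e j))(i := a)) \<phi>)"
      by (auto simp: sat_at_var sat_nat_form)
    also have "\<dots> \<longleftrightarrow> (\<exists>n. sat R ((\<lambda>j. of_nat (e j))(i := of_nat n)) \<phi>)"
      using of_nat_in by (auto simp: Nats_def)
    finally show ?thesis unfolding upd \<phi> .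
  qed
  then show ?thesis unfolding arith_def by blast
qed

text \<open>\<open>S\<close> collects the variables that \<open>Q\<close> may read. A variable
  outside \<open>S\<close> is fresh, can hold the bound value, and may be overwritten without
  changing \<open>Q\<close>.\<close>

lemma arith_ex:
  assumes "finite S" "\<And>i. i \<notin> S \<Longrightarrow> arith (\<lambda>e. Q (e i) e)"
    and "\<And>x e i v. i \<notin> S \<Longrightarrow> Q x (e(i := v)) = Q x e"
  shows "arith (\<lambda>e. \<exists>x. Q x e)"
proof -
  obtain i where i: "i \<notin> S" using ex_new_if_finite[OF infinite_UNIV_nat assms(1)] by blast
  from arith_ex_var[OF assms(2)[OF i], of i] assms(3)[OF i] show ?thesis by simp
qed

lemma arith_all:
  assumes "finite S" "\<And>i. i \<notin> S \<Longrightarrow> arith (\<lambda>e. Q (e i) e)"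
    and "\<And>x e i v. i \<notin> S \<Longrightarrow> Q x (e(i := v)) = Q x e"
  shows "arith (\<lambda>e. \<forall>x. Q x e)"
proof -
  have "arith (\<lambda>e. \<exists>x. \<not> Q x e)" using assms by (intro arith_ex[of S] arith_neg) auto
  from arith_neg[OF this] show ?thesis by simp
qed

lemma arith_less: "arith (\<lambda>e. e i < e j)"
proof -
  have "arith (\<lambda>e. \<exists>x. e j = e i + x + 1)"
  proof (rule arith_ex[of "{i, j}"])
    fix k show "arith (\<lambda>e. e j = e i + e k + 1)"
      using arith_eq[of "Var j" "Add (Add (Var i) (Var k)) One"] by simp
  qed auto
  then show ?thesis by (rule back_subst[of arith]) (auto simp: fun_eq_iff less_iff_Suc_add)
qed

lemma arith_beta: "arith (\<lambda>e. e v = beta (e c) (e d) (e i))"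
proof -
  have A: "arith (\<lambda>e. \<exists>r. e v + r + 1 = 1 + (e i + 1) * e d \<and> (\<exists>q. e c = q * (1 + (e i + 1) * e d) + e v))"
  proof (rule arith_ex[of "{v, c, d, i}"])
    fix r assume r: "r \<notin> {v, c, d, i}"
    have "arith (\<lambda>e. \<exists>q. e c = q * (1 + (e i + 1) * e d) + e v)"
    proof (rule arith_ex[of "{v, c, d, i}"])
      fix q show "arith (\<lambda>e. e c = e q * (1 + (e i + 1) * e d) + e v)"
        using arith_eq[of "Var c" "Add (Mul (Var q) (Add One (Mul (Add (Var i) One) (Var d)))) (Var v)"] by simp
    qed auto
    moreover have "arith (\<lambda>e. e v + e r + 1 = 1 + (e i + 1) * e d)"
      using arith_eq[of "Add (Add (Var v) (Var r)) One" "Add One (Mul (Add (Var i) One) (Var d))"] by simp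
    ultimately show "arith (\<lambda>e. e v + e r + 1 = 1 + (e i + 1) * e d \<and>
        (\<exists>q. e c = q * (1 + (e i + 1) * e d) + e v))" by (rule arith_conj[rotated])
  qed auto
  \<comment> \<open>The remainder is described by \<open>x < M\<close> and
    \<open>y = q * M + x\<close>, with \<open>r\<close> as the witness of the strict
    inequality.\<close>
  have "(\<exists>r. x + r + 1 = M \<and> (\<exists>q. y = q * M + x)) \<longleftrightarrow> x = y mod M" if "M > 0" for x y M :: nat
  proof
    assume "x = y mod M"
    then have "x < M" using that by simp
    then obtain r where "M = Suc (x + r)" using less_iff_Suc_add by auto
    moreover have "y = (y div M) * M + x" using \<open>x = y mod M\<close> by simp
    ultimately show "\<exists>r. x + r + 1 = M \<and> (\<exists>q. y = q * M + x)" by (metis Suc_eq_plus1)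
  next
    assume "\<exists>r. x + r + 1 = M \<and> (\<exists>q. y = q * M + x)"
    then obtain q where "x < M" "y = q * M + x" by auto
    then show "x = y mod M" by simp
  qed
  note eq = this
  show ?thesis unfolding beta_def by (rule back_subst[of arith, OF A]) (intro ext eq, simp)
qed

text \<open>A quantifier over sequences becomes one over the pair \<open>c\<close>,
  \<open>d\<close>, because only the values up to \<open>e n\<close> matter.\<close>

lemma arith_sequence:
  assumes S: "finite S" "n \<in> S" "z \<in> S"
    and F: "\<And>i. i \<notin> S \<Longrightarrow> arith (\<lambda>e. F (e i) e)"
    and G: "\<And>i u w. i \<notin> S \<Longrightarrow> u \<notin> S \<Longrightarrow> w \<notin> S \<Longrightarrow> arith (\<lambda>e. G (e i) (e u) (e w) e)"
    and F_fresh: "\<And>x e i v. i \<notin> S \<Longrightarrow> F x (e(i := v)) = F x e"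
    and G_fresh: "\<And>x y w e i v. i \<notin> S \<Longrightarrow> G x y w (e(i := v)) = G x y w e"
  shows "arith (\<lambda>e. \<exists>a::nat \<Rightarrow> nat. F (a 0) e \<and> (\<forall>m<e n. G m (a m) (a (Suc m)) e) \<and> e z = a (e n))"
proof -
  \<comment> \<open>\<open>k\<close>, \<open>u\<close> and \<open>w\<close> name intermediate
    values, since the hypotheses and \<open>arith_beta\<close> apply to variables.\<close>
  have "arith (\<lambda>e. \<exists>c. \<exists>d. (\<exists>k. k = 0 \<and> (\<exists>u. u = beta c d k \<and> F u e)) \<and>
      (\<forall>m. m < e n \<longrightarrow> (\<exists>k. k = m + 1 \<and> (\<exists>u. u = beta c d m \<and> (\<exists>w. w = beta c d k \<and> G m u w e)))) \<and>
      e z = beta c d (e n))"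
  proof (rule arith_ex[OF S(1)])
    fix c assume c: "c \<notin> S"
    show "arith (\<lambda>e. \<exists>d. (\<exists>k. k = 0 \<and> (\<exists>u. u = beta (e c) d k \<and> F u e)) \<and>
      (\<forall>m. m < e n \<longrightarrow> (\<exists>k. k = m + 1 \<and> (\<exists>u. u = beta (e c) d m \<and> (\<exists>w. w = beta (e c) d k \<and> G m u w e)))) \<and>
      e z = beta (e c) d (e n))"
    proof (rule arith_ex[of "insert c S"])
      fix d assume d: "d \<notin> insert c S"
      have 1: "arith (\<lambda>e. \<exists>k. k = 0 \<and> (\<exists>u. u = beta (e c) (e d) k \<and> F u e))"
      proof (rule arith_ex[of "insert d (insert c S)"])
        fix k assume k: "k \<notin> insert d (insert c S)"
        have "arith (\<lambda>e. \<exists>u. u = beta (e c) (e d) (e k) \<and> F u e)"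
          by (rule arith_ex[of "insert k (insert d (insert c S))"])
            (use S F F_fresh in \<open>auto intro!: arith_conj arith_beta\<close>)
        then show "arith (\<lambda>e. e k = 0 \<and> (\<exists>u. u = beta (e c) (e d) (e k) \<and> F u e))"
          using arith_eq[of "Var k" Zero] by (auto intro: arith_conj)
      qed (use S F_fresh in auto)
      have 2: "arith (\<lambda>e. \<forall>m. m < e n \<longrightarrow> (\<exists>k. k = m + 1 \<and> (\<exists>u. u = beta (e c) (e d) m \<and>
          (\<exists>w. w = beta (e c) (e d) k \<and> G m u w e))))"
      proof (rule arith_all[of "insert d (insert c S)"])
        fix m assume m: "m \<notin> insert d (insert c S)"
        have "arith (\<lambda>e. \<exists>k. k = e m + 1 \<and> (\<exists>u. u = beta (e c) (e d) (e m) \<and>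
          (\<exists>w. w = beta (e c) (e d) k \<and> G (e m) u w e)))"
        proof (rule arith_ex[of "insert m (insert d (insert c S))"])
          fix k assume k: "k \<notin> insert m (insert d (insert c S))"
          have "arith (\<lambda>e. \<exists>u. u = beta (e c) (e d) (e m) \<and>
            (\<exists>w. w = beta (e c) (e d) (e k) \<and> G (e m) u w e))"
          proof (rule arith_ex[of "insert k (insert m (insert d (insert c S)))"])
            fix u assume u: "u \<notin> insert k (insert m (insert d (insert c S)))"
            have "arith (\<lambda>e. \<exists>w. w = beta (e c) (e d) (e k) \<and> G (e m) (e u) w e)"
              by (rule arith_ex[of "insert u (insert k (insert m (insert d (insert c S))))"])
                (use S G G_fresh m u in \<open>auto intro!: arith_conj arith_beta\<close>)
            then show "arith (\<lambda>e. e u = beta (e c) (e d) (e m) \<and>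
              (\<exists>w. w = beta (e c) (e d) (e k) \<and> G (e m) (e u) w e))"
              by (rule arith_conj[OF arith_beta])
          qed (use S G_fresh in auto)
          moreover have "arith (\<lambda>e. e k = e m + 1)" using arith_eq[of "Var k" "Add (Var m) One"] by simp
          ultimately show "arith (\<lambda>e. e k = e m + 1 \<and> (\<exists>u. u = beta (e c) (e d) (e m) \<and>
            (\<exists>w. w = beta (e c) (e d) (e k) \<and> G (e m) u w e)))" by (rule arith_conj[rotated])
        qed (use S G_fresh in auto)
        then show "arith (\<lambda>e. e m < e n \<longrightarrow> (\<exists>k. k = e m + 1 \<and> (\<exists>u. u = beta (e c) (e d) (e m) \<and>
          (\<exists>w. w = beta (e c) (e d) k \<and> G (e m) u w e))))"
          by (rule arith_imp[OF arith_less])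
      qed (use S G_fresh in auto)
      show "arith (\<lambda>e. (\<exists>k. k = 0 \<and> (\<exists>u. u = beta (e c) (e d) k \<and> F u e)) \<and>
        (\<forall>m. m < e n \<longrightarrow> (\<exists>k. k = m + 1 \<and> (\<exists>u. u = beta (e c) (e d) m \<and> (\<exists>w. w = beta (e c) (e d) k \<and> G m u w e)))) \<and>
        e z = beta (e c) (e d) (e n))"
        by (rule arith_conj[OF 1 arith_conj[OF 2 arith_beta]])
    qed (use S F_fresh G_fresh in auto)
  qed (use S F_fresh G_fresh in auto)
  moreover have "(\<exists>a. F (a 0) e \<and> (\<forall>m<e n. G m (a m) (a (Suc m)) e) \<and> e z = a (e n)) \<longleftrightarrow>
      (\<exists>c d. F (beta c d 0) e \<and> (\<forall>m<e n. G m (beta c d m) (beta c d (Suc m)) e) \<and> e z = beta c d (e n))" for e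
  proof
    assume "\<exists>a. F (a 0) e \<and> (\<forall>m<e n. G m (a m) (a (Suc m)) e) \<and> e z = a (e n)"
    then obtain a where a: "F (a 0) e" "\<forall>m<e n. G m (a m) (a (Suc m)) e" "e z = a (e n)" by blast
    obtain c d where cd: "\<And>i. i \<le> e n \<Longrightarrow> beta c d i = a i" using beta_exists by metis
    show "\<exists>c d. F (beta c d 0) e \<and> (\<forall>m<e n. G m (beta c d m) (beta c d (Suc m)) e) \<and> e z = beta c d (e n)"
      using a cd by (intro exI[of _ c] exI[of _ d]) simp
  qed blast
  ultimately show ?thesis by simp
qed

section \<open>Recursive functions are arithmetical\<close>

lemma arith_reval: "arith (\<lambda>e. reval f (map e is) (e j))"
proof (induction f arbitrary: "is" j)
  case RZero
  show ?case unfolding reval_zero_iff using arith_eq[of "Var j" Zero] by simp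
next
  case RSucc
  show ?case
  proof (cases "\<exists>i. is = [i]")
    case True
    then obtain i where "is = [i]" by blast
    then show ?thesis using arith_eq[of "Var j" "Add (Var i) One"] by (simp add: reval_succ_iff)
  next
    case False
    then have "\<not> reval RSucc (map e is) (e j)" for e by (auto simp: reval_succ_iff map_eq_Cons_conv)
    then show ?thesis using arith_False by simp
  qed
next
  case (RProj i)
  show ?case
  proof (cases "i < length is")
    case True
    then show ?thesis using arith_eq[of "Var j" "Var (is ! i)"] by (simp add: reval_proj_iff)
  next
    case False
    then show ?thesis using arith_False by (simp add: reval_proj_iff)
  qed
next
  case (RComp f gs)
  \<comment> \<open>The arguments are quantified one by one; \<open>as\<close> holds the variables
    for the values already introduced.\<close>
  have "arith (\<lambda>e. \<exists>ys. list_all2 (\<lambda>g y. reval g (map e is) y) hs ys \<and> reval f (map e as @ ys) (e j))"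
    if "set hs \<subseteq> set gs" for hs as
    using that
  proof (induction hs arbitrary: as)
    case Nil
    then show ?case using RComp.IH(1)[of as j] by simp
  next
    case (Cons g hs)
    have "arith (\<lambda>e. \<exists>y. reval g (map e is) y \<and>
        (\<exists>ys. list_all2 (\<lambda>g y. reval g (map e is) y) hs ys \<and> reval f (map e as @ y # ys) (e j)))"
    proof (rule arith_ex[of "set is \<union> set as \<union> {j}"])
      fix i assume i: "i \<notin> set is \<union> set as \<union> {j}"
      have "arith (\<lambda>e. \<exists>ys. list_all2 (\<lambda>g y. reval g (map e is) y) hs ys \<and> reval f (map e (as @ [i]) @ ys) (e j))"
        using Cons by (intro Cons.IH) auto
      moreover have "arith (\<lambda>e. reval g (map e is) (e i))" using RComp.IH(2) Cons.prems by auto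
      ultimately show "arith (\<lambda>e. reval g (map e is) (e i) \<and>
        (\<exists>ys. list_all2 (\<lambda>g y. reval g (map e is) y) hs ys \<and> reval f (map e as @ e i # ys) (e j)))"
        by (simp add: arith_conj)
    qed auto
    then show ?case by (rule back_subst[of arith]) (auto simp: fun_eq_iff list_all2_Cons1)
  qed
  from this[of gs "[]"] show ?case by (simp add: reval_comp_iff)
next
  case (RPrec f g)
  show ?case
  proof (cases "is")
    case Nil
    then show ?thesis using arith_False by (simp add: reval_prec_Nil)
  next
    case (Cons n js)
    have [simp]: "map (\<lambda>a. if a = i then v else e a) js = map e js" if "i \<notin> set js" for i v :: nat and e
      using that by (induction js) auto
    have "arith (\<lambda>e. \<exists>a. reval f (map e js) (a 0) \<and>
        (\<forall>m<e n. reval g (m # a m # map e js) (a (Suc m))) \<and> e j = a (e n))"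
    proof (rule arith_sequence[of "{n, j} \<union> set js"])
      show "arith (\<lambda>e. reval f (map e js) (e i))" for i by (rule RPrec.IH)
      show "arith (\<lambda>e. reval g (e i # e u # map e js) (e w))" for i u w
        using RPrec.IH(2)[of "i # u # js" w] by simp
    qed auto
    then show ?thesis using Cons by (simp add: reval_prec_iff)
  qed
next
  case (RMin f)
  have 1: "arith (\<lambda>e. \<exists>z. z = 0 \<and> reval f (e j # map e is) z)"
  proof (rule arith_ex[of "{j} \<union> set is"])
    fix z show "arith (\<lambda>e. e z = 0 \<and> reval f (e j # map e is) (e z))"
      using arith_conj[OF arith_eq[of "Var z" Zero] RMin.IH[of "j # is" z]] by simp
  qed auto
  have "arith (\<lambda>e. \<forall>m. m < e j \<longrightarrow> (\<exists>y. \<exists>w. w = y + 1 \<and> reval f (m # map e is) w))"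
  proof (rule arith_all[of "{j} \<union> set is"])
    fix m assume m: "m \<notin> {j} \<union> set is"
    have "arith (\<lambda>e. \<exists>y. \<exists>w. w = y + 1 \<and> reval f (e m # map e is) w)"
    proof (rule arith_ex[of "{m} \<union> set is"])
      fix y assume y: "y \<notin> {m} \<union> set is"
      show "arith (\<lambda>e. \<exists>w. w = e y + 1 \<and> reval f (e m # map e is) w)"
      proof (rule arith_ex[of "{m, y} \<union> set is"])
        fix w show "arith (\<lambda>e. e w = e y + 1 \<and> reval f (e m # map e is) (e w))"
          using arith_conj[OF arith_eq[of "Var w" "Add (Var y) One"] RMin.IH[of "m # is" w]] by simp
      qed auto
    qed auto
    then show "arith (\<lambda>e. e m < e j \<longrightarrow> (\<exists>y. \<exists>w. w = y + 1 \<and> reval f (e m # map e is) w))"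
      by (rule arith_imp[OF arith_less])
  qed auto
  from arith_conj[OF 1 this] show ?case by (simp add: reval_min_iff)
qed

section \<open>Undecidability by diagonalization\<close>

text \<open>The Cantor pairing is a triangular number plus \<open>a\<close>; doubling the equation
  removes the division.\<close>

lemma arith_prod_encode: "arith (\<lambda>e. e z = prod_encode (e a, e b))"
proof -
  have "2 * triangle k = k * (k + 1)" for k by (simp add: triangle_def)
  then have "z = prod_encode (a, b) \<longleftrightarrow> z + z = (a + b) * (a + b + 1) + (a + a)" for z a b
  proof -
    have "2 * triangle (a + b) = (a + b) * (a + b + 1)" by fact
    then show ?thesis unfolding prod_encode_def prod.case by linarith
  qed
  then show ?thesis
    using arith_eq[of "Add (Var z) (Var z)" "Add (Mul (Add (Var a) (Var b)) (Add (Add (Var a) (Var b)) One)) (Add (Var a) (Var a))"]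
    by simp
qed

lemma arith_const: "arith (\<lambda>e. e z = k)"
proof -
  have "nval e (nat_tm k) = k" for e by (induction k) auto
  then show ?thesis using arith_eq[of "Var z" "nat_tm k"] by simp
qed

definition arith_fun :: "(nat \<Rightarrow> nat) \<Rightarrow> bool" where
  "arith_fun h \<longleftrightarrow> (\<forall>z a. arith (\<lambda>e. e z = h (e a)))"

lemma arith_fun_id: "arith_fun (\<lambda>n. n)"
proof (unfold arith_fun_def, intro allI)
  fix z a show "arith (\<lambda>e. e z = e a)" using arith_eq[of "Var z" "Var a"] by simp
qed

lemma arith_fun_const: "arith_fun (\<lambda>n. k)"
  unfolding arith_fun_def using arith_const by simp

lemma arith_fun_prod_encode:
  assumes "arith_fun h" "arith_fun k"
  shows "arith_fun (\<lambda>n. prod_encode (h n, k n))"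
  unfolding arith_fun_def
proof (intro allI)
  fix z a
  have "arith (\<lambda>e. \<exists>x. x = h (e a) \<and> (\<exists>y. y = k (e a) \<and> e z = prod_encode (x, y)))"
  proof (rule arith_ex[of "{z, a}"])
    fix x assume "x \<notin> {z, a}"
    have "arith (\<lambda>e. \<exists>y. y = k (e a) \<and> e z = prod_encode (e x, y))"
      by (rule arith_ex[of "{z, a, x}"]) (use assms in \<open>auto simp: arith_fun_def intro!: arith_conj arith_prod_encode\<close>)
    then show "arith (\<lambda>e. e x = h (e a) \<and> (\<exists>y. y = k (e a) \<and> e z = prod_encode (e x, y)))"
      using assms by (intro arith_conj) (auto simp: arith_fun_def)
  qed auto
  then show "arith (\<lambda>e. e z = prod_encode (h (e a), k (e a)))" by simp
qed

text \<open>Aimed at the codes of numerals, which arise by iterating one coding step.\<close>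

lemma arith_fun_iterate:
  assumes h: "arith_fun h" shows "arith_fun (\<lambda>n. (h ^^ n) k)"
  unfolding arith_fun_def
proof (intro allI)
  fix z n
  have "arith (\<lambda>e. \<exists>a. a 0 = k \<and> (\<forall>m<e n. a (Suc m) = h (a m)) \<and> e z = a (e n))"
    by (rule arith_sequence[of "{n, z}"]) (use h arith_const in \<open>auto simp: arith_fun_def\<close>)
  moreover have "(\<exists>a. a 0 = k \<and> (\<forall>m<N. a (Suc m) = h (a m)) \<and> y = a N) \<longleftrightarrow> y = (h ^^ N) k" for N y
  proof
    assume "\<exists>a. a 0 = k \<and> (\<forall>m<N. a (Suc m) = h (a m)) \<and> y = a N"
    then obtain a where a: "a 0 = k" "\<forall>m<N. a (Suc m) = h (a m)" "y = a N" by blast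
    have "m \<le> N \<Longrightarrow> a m = (h ^^ m) k" for m by (induction m) (use a in auto)
    then show "y = (h ^^ N) k" using a by simp
  next
    assume "y = (h ^^ N) k"
    then show "\<exists>a. a 0 = k \<and> (\<forall>m<N. a (Suc m) = h (a m)) \<and> y = a N"
      by (intro exI[of _ "\<lambda>m. (h ^^ m) k"]) auto
  qed
  ultimately show "arith (\<lambda>e. e z = (h ^^ e n) k)" by simp
qed

lemma arith_fun_diagonal: "arith_fun (\<lambda>n. instance_code n n)"
proof -
  have "tcode (nat_tm n) = ((\<lambda>k. prod_encode (3, prod_encode (k, tcode One))) ^^ n) (tcode Zero)" for n
    by (induction n) simp_all
  then have "arith_fun (\<lambda>n. tcode (nat_tm n))"
    by (simp only:) (intro arith_fun_iterate arith_fun_prod_encode arith_fun_const arith_fun_id)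
  then show ?thesis unfolding instance_code_def
    by (intro arith_fun_prod_encode arith_fun_const arith_fun_id)
qed

text \<open>A formula obtained from \<open>arith\<close> has unknown free variables; those other
  than 0 are bound and pinned to zero, so that an instance of it is a sentence.\<close>

lemma close_formula:
  "\<exists>\<psi>. fvars \<psi> \<subseteq> {0} \<and> (\<forall>e. sat R e \<psi> \<longleftrightarrow> sat R (\<lambda>i. if i = 0 then e 0 else 0) \<phi>)"
proof -
  obtain js where js: "set js = fvars \<phi> - {0}" using finite_list[OF finite_Diff[OF finite_fvars]] by blast
  define \<psi> where "\<psi> = foldr (\<lambda>j \<chi>. Exists j (Conj (Eq (Var j) Zero) \<chi>)) js \<phi>"
  have R0: "0 \<in> R" using of_nat_in[of 0] by simp
  have fv: "fvars (foldr (\<lambda>j \<chi>. Exists j (Conj (Eq (Var j) Zero) \<chi>)) js \<phi>) = fvars \<phi> - set js" for js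
    by (induction js) auto
  have sat: "sat R e (foldr (\<lambda>j \<chi>. Exists j (Conj (Eq (Var j) Zero) \<chi>)) js \<phi>) \<longleftrightarrow>
      sat R (\<lambda>i. if i \<in> set js then 0 else e i) \<phi>" for js e
  proof (induction js arbitrary: e)
    case (Cons j js)
    have "(\<lambda>i. if i \<in> set js then 0 else (e(j := 0)) i) = (\<lambda>i. if i \<in> set (j # js) then 0 else e i)"
      by auto
    moreover have "sat R e (foldr (\<lambda>j \<chi>. Exists j (Conj (Eq (Var j) Zero) \<chi>)) (j # js) \<phi>) \<longleftrightarrow>
        sat R (e(j := 0)) (foldr (\<lambda>j \<chi>. Exists j (Conj (Eq (Var j) Zero) \<chi>)) js \<phi>)"
      using R0 by auto
    ultimately show ?case unfolding Cons.IH by simp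
  qed simp
  have "sat R e \<psi> \<longleftrightarrow> sat R (\<lambda>i. if i = 0 then e 0 else 0) \<phi>" for e
    unfolding \<psi>_def sat by (rule sat_cong) (auto simp: js)
  moreover have "fvars \<psi> \<subseteq> {0}" unfolding \<psi>_def fv js by auto
  ultimately show ?thesis by blast
qed

text \<open>A decider would make membership in the theory definable over \<open>R\<close>, hence
  yield a sentence equivalent to its own rejection.\<close>

theorem undecidable: "\<not> decidable (first_order_theory R)"
proof
  assume "decidable (first_order_theory R)"
  then obtain f where f: "\<And>n. reval f [n] (if n \<in> fcode ` first_order_theory R then 1 else 0)"
    unfolding decidable_def decidable_nat_set_def by blast
  \<comment> \<open>The decider is total and single-valued, so non-membership is the computation
    with output 0, which \<open>arith_reval\<close> expresses.\<close>
  have f0: "reval f [n] 0 \<longleftrightarrow> n \<notin> fcode ` first_order_theory R" for n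
    using f[of n] reval_deterministic[of f "[n]" _ 0] by (auto split: if_splits)
  have "arith (\<lambda>e. \<exists>w. w = instance_code (e 0) (e 0) \<and> (\<exists>y. y = 0 \<and> reval f [w] y))"
  proof (rule arith_ex[of "{0}"])
    fix w :: nat assume "w \<notin> {0}"
    have "arith (\<lambda>e. \<exists>y. y = 0 \<and> reval f [e w] y)"
    proof (rule arith_ex[of "{w}"])
      fix y show "arith (\<lambda>e. e y = 0 \<and> reval f [e w] (e y))"
        using arith_conj[OF arith_const[of y 0] arith_reval[of f "[w]" y]] by simp
    qed auto
    moreover have "arith (\<lambda>e. e w = instance_code (e 0) (e 0))"
      using arith_fun_diagonal unfolding arith_fun_def by blast
    ultimately show "arith (\<lambda>e. e w = instance_code (e 0) (e 0) \<and> (\<exists>y. y = 0 \<and> reval f [e w] y))"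
      by (rule arith_conj[rotated])
  qed auto
  then obtain \<phi> where \<phi>: "\<And>e. sat R (\<lambda>i. of_nat (e i)) \<phi> \<longleftrightarrow> reval f [instance_code (e 0) (e 0)] 0"
    unfolding arith_def by auto
  obtain \<psi> where \<psi>: "fvars \<psi> \<subseteq> {0}" "\<And>e. sat R e \<psi> \<longleftrightarrow> sat R (\<lambda>i. if i = 0 then e 0 else 0) \<phi>"
    using close_formula by blast
  \<comment> \<open>\<open>\<psi>\<close> at the code of a formula says that the instance of that
    formula at its own code is rejected; here it is applied to itself.\<close>
  define n where "n = fcode \<psi>"
  define \<chi> where "\<chi> = instance_form n \<psi>"
  have "tvars (nat_tm k) = {}" for k by (induction k) auto
  then have fv: "fvars \<chi> = {}" using \<psi>(1) by (auto simp: \<chi>_def instance_form_def)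
  have "sat R (\<lambda>_. 0) \<chi> \<longleftrightarrow> sat R ((\<lambda>_. 0)(0 := of_nat n)) \<psi>"
    using of_nat_in by (auto simp: \<chi>_def instance_form_def tval_nat_tm)
  also have "\<dots> \<longleftrightarrow> sat R (\<lambda>i. of_nat ((\<lambda>j. if j = 0 then n else 0) i)) \<phi>"
    unfolding \<psi>(2) by (rule arg_cong[of _ _ "\<lambda>e. sat R e \<phi>"]) auto
  also have "\<dots> \<longleftrightarrow> reval f [instance_code n n] 0" unfolding \<phi> by simp
  also have "\<dots> \<longleftrightarrow> \<chi> \<notin> first_order_theory R"
  proof -
    have "instance_code n n = fcode \<chi>" by (simp add: \<chi>_def n_def fcode_instance_form)
    moreover have "inj fcode" by (rule injI) (simp add: fcode_inject)
    ultimately show ?thesis unfolding f0 by (simp add: inj_image_mem_iff)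
  qed
  finally show False using fv by (auto simp: first_order_theory_def)
qed

end

section \<open>The defining formula\<close>

definition monomial_eval :: "(nat \<Rightarrow> 'a::comm_ring_1) \<Rightarrow> (nat \<Rightarrow>\<^sub>0 nat) \<Rightarrow> 'a" where
  "monomial_eval e m = (\<Prod>i\<in>Poly_Mapping.keys m. e i ^ Poly_Mapping.lookup m i)"

lemma monomial_eval_superset:
  "finite S \<Longrightarrow> Poly_Mapping.keys m \<subseteq> S \<Longrightarrow> monomial_eval e m = (\<Prod>i\<in>S. e i ^ Poly_Mapping.lookup m i)"
  unfolding monomial_eval_def by (intro prod.mono_neutral_left) (auto simp: in_keys_iff)

lemma monomial_eval_add: "monomial_eval e (m + m') = monomial_eval e m * monomial_eval e m'"
proof -
  let ?S = "Poly_Mapping.keys m \<union> Poly_Mapping.keys m'"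
  have "finite ?S" "Poly_Mapping.keys (m + m') \<subseteq> ?S" using Poly_Mapping.keys_add[of m m'] by auto
  then show ?thesis
    by (simp add: monomial_eval_superset[of ?S] lookup_add power_add prod.distrib)
qed

text \<open>Cancellation can shrink the support of a sum, so evaluations are compared over a common
  superset of the supports.\<close>

lemma poly_eval_superset:
  "finite S \<Longrightarrow> Poly_Mapping.keys P \<subseteq> S \<Longrightarrow>
    poly_eval e P = (\<Sum>m\<in>S. of_int (Poly_Mapping.lookup P m) * monomial_eval e m)"
  unfolding poly_eval_def monomial_eval_def by (intro sum.mono_neutral_left) (auto simp: in_keys_iff)

lemma poly_eval_add: "poly_eval e (P + Q) = poly_eval e P + poly_eval e Q"
proof -
  let ?S = "Poly_Mapping.keys P \<union> Poly_Mapping.keys Q"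
  have "finite ?S" "Poly_Mapping.keys (P + Q) \<subseteq> ?S" using Poly_Mapping.keys_add[of P Q] by auto
  then show ?thesis
    by (simp add: poly_eval_superset[of ?S] lookup_add sum.distrib distrib_right)
qed

lemma poly_vars_add: "poly_vars (P + Q) \<subseteq> poly_vars P \<union> poly_vars Q"
  using Poly_Mapping.keys_add[of P Q] by (auto simp: poly_vars_def)

text \<open>Variables are listed with multiplicity: \<open>[1, 3, 3]\<close> has exponent 1 at
  variable 1 and 2 at variable 3.\<close>

definition monomial_of :: "nat list \<Rightarrow> (nat \<Rightarrow>\<^sub>0 nat)" where
  "monomial_of is = sum_list (map (\<lambda>i. Poly_Mapping.single i 1) is)"

definition mpoly_term :: "int \<Rightarrow> nat list \<Rightarrow> int_mpoly" where
  "mpoly_term c is = Poly_Mapping.single (monomial_of is) c"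

lemma monomial_eval_monomial_of: "monomial_eval e (monomial_of is) = prod_list (map e is)"
proof (induction "is")
  case (Cons i "is")
  have "monomial_eval e (Poly_Mapping.single i 1) = e i" by (simp add: monomial_eval_def)
  with Cons show ?case by (simp add: monomial_of_def monomial_eval_add)
qed (simp add: monomial_of_def monomial_eval_def)

lemma poly_eval_mpoly_term: "poly_eval e (mpoly_term c is) = of_int c * prod_list (map e is)"
  by (simp add: poly_eval_superset[of "{monomial_of is}"] mpoly_term_def monomial_eval_monomial_of)

lemma poly_vars_mpoly_term: "poly_vars (mpoly_term c is) \<subseteq> set is"
proof -
  have "Poly_Mapping.keys (monomial_of is) \<subseteq> set is"
    by (induction "is") (auto simp: monomial_of_def dest!: Poly_Mapping.keys_add[THEN subsetD])
  then show ?thesis by (auto simp: poly_vars_def mpoly_term_def split: if_splits)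
qed

text \<open>
  Variables \<open>0\<close>, \<open>1\<close>, \<open>3\<close>, \<open>4\<close> are \<open>t\<close>, \<open>b\<close>, \<open>U\<close>, \<open>V\<close> of \<open>pell_integer\<close>; variable \<open>5\<close> abbreviates
  \<open>t + b V\<close>, and variable \<open>2\<close> is a dummy.
\<close>

definition pell_polys :: "int_mpoly list" where
  "pell_polys =
    [mpoly_term 1 [5] + mpoly_term (-1) [0] + mpoly_term (-1) [1, 4],
     mpoly_term 2 [3] + mpoly_term 1 [1, 3, 3] + mpoly_term (-1) [1, 5, 5] + mpoly_term (-2) [5, 5]]"

lemma poly_vars_pell_polys:
  assumes "P \<in> set pell_polys" shows "poly_vars P \<subseteq> {0..5}"
proof -
  have add: "poly_vars (P + Q) \<subseteq> {0..5}" if "poly_vars P \<subseteq> {0..5}" "poly_vars Q \<subseteq> {0..5}" for P Q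
    using poly_vars_add[of P Q] that by blast
  have "poly_vars (mpoly_term c is) \<subseteq> {0..5}" if "set is \<subseteq> {0..5}" for c "is"
    using poly_vars_mpoly_term[of c "is"] that by blast
  note intros = add this
  have "P = pell_polys ! 0 \<or> P = pell_polys ! 1" using assms by (auto simp: pell_polys_def)
  then show ?thesis unfolding pell_polys_def nth_Cons_0 One_nat_def nth_Cons_Suc
    by (elim disjE) (simp_all only:, (intro intros, simp_all)+)
qed

lemma sat_pell_formula:
  assumes "complex_subring R" "e 0 \<in> R"
  shows "sat R e (AAE_formula 5 pell_polys) \<longleftrightarrow> pell_integer R (e 0)"
proof -
  interpret complex_subring R by fact
  have "[3..<Suc 5] = [3, 4, 5]" by (simp add: upt_rec)
  then have "sat R e (AAE_formula 5 pell_polys) \<longleftrightarrow> (\<forall>b\<in>R. \<forall>x\<in>R. \<exists>U\<in>R. \<exists>V\<in>R. \<exists>W\<in>R.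
      W - e 0 - b * V = 0 \<and> 2 * U + b * (U * U) - b * (W * W) - 2 * (W * W) = 0)"
    unfolding AAE_formula_def
    by (simp add: sat_conj_list pell_polys_def sat_poly_eqn poly_eval_add poly_eval_mpoly_term del: upt_Suc)
  also have "\<dots> \<longleftrightarrow> (\<forall>b\<in>R. \<exists>U\<in>R. \<exists>V\<in>R. \<exists>W\<in>R. W = e 0 + b * V \<and> 2 * U + b * U\<^sup>2 = (b + 2) * W\<^sup>2)"
  proof -
    have "W - t - b * V = 0 \<and> 2 * U + b * (U * U) - b * (W * W) - 2 * (W * W) = 0 \<longleftrightarrow>
        W = t + b * V \<and> 2 * U + b * U\<^sup>2 = (b + 2) * W\<^sup>2" for t b U V W :: complex
      by (auto simp: power2_eq_square algebra_simps)
    then show ?thesis using zero_in by auto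
  qed
  also have "\<dots> \<longleftrightarrow> pell_integer R (e 0)"
  proof -
    have "e 0 + b * V \<in> R" if "b \<in> R" "V \<in> R" for b V using assms(2) that add_in mult_in by blast
    then show ?thesis unfolding pell_integer_def by (intro ball_cong bex_cong refl) auto
  qed
  finally show ?thesis .
qed

theorem theorem4p8:
  shows "(\<exists>(r::nat) (Ps :: int_mpoly list).
            3 \<le> r \<and> Ps \<noteq> [] \<and> (\<forall>P\<in>set Ps. poly_vars P \<subseteq> {0..r}) \<and>
            (\<forall>K\<in>non_big_fields.
               defined_set (ring_of_integers K) (AAE_formula r Ps) = \<int>)) \<and>
         (\<forall>K\<in>non_big_fields. \<not> decidable (first_order_theory (ring_of_integers K)))"
proof -
  have sub: "complex_subring (ring_of_integers K)" if "K \<in> non_big_fields" for K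
    using that by (intro complex_subring_ring_of_integers) (simp add: non_big_fields_def field_of_algebraic_numbers_def)
  have Ints: "\<int> \<subseteq> ring_of_integers K" if "K \<in> non_big_fields" for K
    using complex_subring.of_int_in[OF sub[OF that]] by (auto elim: Ints_cases)
  have sat: "sat (ring_of_integers K) e (AAE_formula 5 pell_polys) \<longleftrightarrow> e 0 \<in> \<int>"
    if "K \<in> non_big_fields" "e 0 \<in> ring_of_integers K" for K e
    using sat_pell_formula[OF sub] pell_integer_iff that by simp
  have "defined_set (ring_of_integers K) (AAE_formula 5 pell_polys) = \<int>" if "K \<in> non_big_fields" for K
    using sat[OF that] Ints[OF that] by (auto simp: defined_set_def)
  moreover have "pell_polys \<noteq> []" by (simp add: pell_polys_def)
  moreover have "\<not> decidable (first_order_theory (ring_of_integers K))" if "K \<in> non_big_fields" for K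
  proof -
    interpret int_definable "ring_of_integers K" "AAE_formula 5 pell_polys"
      using sat[OF that] Ints[OF that] by unfold_locales auto
    show ?thesis by (rule undecidable)
  qed
  ultimately show ?thesis using poly_vars_pell_polys
    by (intro conjI exI[of _ 5] exI[of _ pell_polys]) auto
qed

end
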